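(* Any simple cuspidal $\mathcal{B}$-module $V$ is isomorphic to the module $\mathcal{A}'_{a,b}$ of the intermediate series for some $a,b\in\mathbb{C}$.
   Context: All vector spaces are over $\mathbb{C}$. The $N=1$ BMS$_3$ superalgebra $\mathcal{B}$ is the Lie superalgebra with basis $\{L_m,I_m,Q_r,C_1,C_2\mid m\in\mathbb{Z},\ r\in\mathbb{Z}+\frac12\}$, where $L_m,I_m,C_1,C_2$ are even, the $Q_r$ are odd, $C_1,C_2$ are central, and $[L_m,L_n]=(m-n)L_{m+n}+\frac1{12}\delta_{m+n,0}(m^3-m)C_1$, $[L_m,I_n]=(m-n)I_{m+n}+\frac1{12}\delta_{m+n,0}(m^3-m)C_2$, $[Q_r,Q_s]=2I_{r+s}+\frac13\delta_{r+s,0}(r^2-\frac14)C_2$, $[L_m,Q_r]=(\frac m2-r)Q_{m+r}$, $[I_m,I_n]=[I_n,Q_r]=0$ for all $m,n\in\mathbb{Z}$, $r,s\in\mathbb{Z}+\frac12$. A $\mathcal{B}$-module (always $\mathbb{Z}/2$-graded) is cuspidal if $L_0$ acts diagonalizably and the dimensions of the $L_0$-eigenspaces are finite and uniformly bounded. For $a,b\in\mathbb{C}$, $\mathcal{A}_{a,b}=\bigoplus_{i\in\mathbb{Z}}\mathbb{C}v_i$ is the $\mathcal{B}$-module, concentrated in a single parity, with $L_m v_i=-(a+i+bm)v_{m+i}$ and with $I_m$, $Q_r$, $C_1$, $C_2$ acting as zero. It is simple if and only if $a\notin\mathbb{Z}$ or $b\neq0,1$. $\mathcal{A}'_{a,b}$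 denotes $\mathcal{A}_{a,b}$ if this is simple, and otherwise a simple subquotient of it (the one-dimensional trivial module being allowed). Isomorphisms are understood up to parity change. *)

theory Defs
  imports Complex_Main "HOL-Library.Poly_Mapping" "HOL-Library.Z2"
begin

section \<open>Free complex vector spaces\<close>

text \<open>The complex vector space with basis \<open>'i\<close> is modelled by finitely supported functions
  \<open>'i \<Rightarrow>\<^sub>0 complex\<close>; the basis vector belonging to \<open>i\<close> is \<open>Poly_Mapping.single i 1\<close>.\<close>

definition pm_scale :: "complex \<Rightarrow> ('i \<Rightarrow>\<^sub>0 complex) \<Rightarrow> ('i \<Rightarrow>\<^sub>0 complex)" where
  "pm_scale c f = Poly_Mapping.map ((*) c) f"

definition bilinear_extension ::
    "('i \<Rightarrow> 'j \<Rightarrow> ('k \<Rightarrow>\<^sub>0 complex)) \<Rightarrow> ('i \<Rightarrow>\<^sub>0 complex) \<Rightarrow> ('j \<Rightarrow>\<^sub>0 complex) \<Rightarrow> ('k \<Rightarrow>\<^sub>0 complex)"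
  where
  "bilinear_extension f x y =
     (\<Sum>i\<in>Poly_Mapping.keys x. \<Sum>j\<in>Poly_Mapping.keys y.
        pm_scale (Poly_Mapping.lookup x i * Poly_Mapping.lookup y j) (f i j))"

lemma lookup_pm_scale [simp]:
  "Poly_Mapping.lookup (pm_scale c f) i = c * Poly_Mapping.lookup f i"
  by (simp add: pm_scale_def Poly_Mapping.map.rep_eq when_def)

lemma vector_space_pm_scale: "vector_space pm_scale"
  by unfold_locales (auto intro!: poly_mapping_eqI simp: lookup_add algebra_simps)


section \<open>The \<open>N = 1\<close> BMS$_3$ superalgebra\<close>

text \<open>\<open>bmsQ k\<close> stands for $Q_r$ with \<open>r = k + 1/2\<close>.\<close>

datatype bms_basis = bmsL int | bmsI int | bmsQ int | bmsC1 | bmsC2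

type_synonym bms = "bms_basis \<Rightarrow>\<^sub>0 complex"

abbreviation bms_vec :: "bms_basis \<Rightarrow> bms" where
  "bms_vec \<beta> \<equiv> Poly_Mapping.single \<beta> 1"

text \<open>Parities live in $\mathbb{Z}/2$, here the field \<open>bit\<close>: \<open>0\<close> is even and \<open>1\<close> is odd.\<close>

fun bms_parity :: "bms_basis \<Rightarrow> bit" where
  "bms_parity (bmsQ k) = 1"
| "bms_parity _ = 0"

definition bms_part :: "bit \<Rightarrow> bms set" where
  "bms_part p = {x. \<forall>\<beta>\<in>Poly_Mapping.keys x. bms_parity \<beta> = p}"

text \<open>With \<open>r = k + 1/2\<close> and \<open>s = l + 1/2\<close> one has \<open>r + s = k + l + 1\<close>. The brackets not listed in
  the definition of the algebra are those forced by super skew-symmetry and centrality, or zero.\<close>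

fun bms_basis_bracket :: "bms_basis \<Rightarrow> bms_basis \<Rightarrow> bms" where
  "bms_basis_bracket (bmsL m) (bmsL n) =
     Poly_Mapping.single (bmsL (m + n)) (of_int (m - n))
     + (if m + n = 0 then Poly_Mapping.single bmsC1 (of_int (m ^ 3 - m) / 12) else 0)"
| "bms_basis_bracket (bmsL m) (bmsI n) =
     Poly_Mapping.single (bmsI (m + n)) (of_int (m - n))
     + (if m + n = 0 then Poly_Mapping.single bmsC2 (of_int (m ^ 3 - m) / 12) else 0)"
| "bms_basis_bracket (bmsI n) (bmsL m) =
     - (Poly_Mapping.single (bmsI (m + n)) (of_int (m - n))
        + (if m + n = 0 then Poly_Mapping.single bmsC2 (of_int (m ^ 3 - m) / 12) else 0))"
| "bms_basis_bracket (bmsQ k) (bmsQ l) =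
     Poly_Mapping.single (bmsI (k + l + 1)) 2
     + (if k + l + 1 = 0
        then Poly_Mapping.single bmsC2 (((of_int k + 1/2) ^ 2 - 1/4) / 3) else 0)"
| "bms_basis_bracket (bmsL m) (bmsQ k) =
     Poly_Mapping.single (bmsQ (m + k)) (of_int m / 2 - (of_int k + 1/2))"
| "bms_basis_bracket (bmsQ k) (bmsL m) =
     - Poly_Mapping.single (bmsQ (m + k)) (of_int m / 2 - (of_int k + 1/2))"
| "bms_basis_bracket _ _ = 0"

definition bms_bracket :: "bms \<Rightarrow> bms \<Rightarrow> bms" where
  "bms_bracket = bilinear_extension bms_basis_bracket"

definition parity_sign :: "bit \<Rightarrow> bit \<Rightarrow> complex" where
  "parity_sign p q = (if p = 1 \<and> q = 1 then -1 else 1)"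


section \<open>Modules\<close>

text \<open>The underlying vector space of a module is the whole type \<open>'v\<close>, with scalar
  multiplication \<open>smul\<close>.\<close>

record 'v bms_rep =
  smul :: "complex \<Rightarrow> 'v \<Rightarrow> 'v"
  part :: "bit \<Rightarrow> 'v set"
  act  :: "bms \<Rightarrow> 'v \<Rightarrow> 'v"

definition bms_module :: "'v::ab_group_add bms_rep \<Rightarrow> bool" where
  "bms_module V \<longleftrightarrow>
     vector_space (smul V) \<and>
     (\<forall>p. module.subspace (smul V) (part V p)) \<and>
     (\<forall>v. \<exists>u\<in>part V 0. \<exists>w\<in>part V 1. v = u + w) \<and>
     part V 0 \<inter> part V 1 = {0} \<and>
     (\<forall>x. Vector_Spaces.linear (smul V) (smul V) (act V x)) \<and>
     (\<forall>v. Vector_Spaces.linear pm_scale (smul V) (\<lambda>x. act V x v)) \<and>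
     (\<forall>p q. \<forall>x\<in>bms_part p. \<forall>v\<in>part V q. act V x v \<in> part V (p + q)) \<and>
     (\<forall>p q. \<forall>x\<in>bms_part p. \<forall>y\<in>bms_part q. \<forall>v.
        act V (bms_bracket x y) v =
          act V x (act V y v) - smul V (parity_sign p q) (act V y (act V x v)))"

text \<open>Submodules are graded: they contain the homogeneous components of their elements.\<close>

definition submodule :: "'v::ab_group_add bms_rep \<Rightarrow> 'v set \<Rightarrow> bool" where
  "submodule V S \<longleftrightarrow>
     module.subspace (smul V) S \<and>
     (\<forall>v\<in>S. \<exists>u\<in>S \<inter> part V 0. \<exists>w\<in>S \<inter> part V 1. v = u + w) \<and>
     (\<forall>x. \<forall>v\<in>S. act V x v \<in> S)"

definition simple_module :: "'v::ab_group_add bms_rep \<Rightarrow> bool" where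
  "simple_module V \<longleftrightarrow>
     bms_module V \<and> (UNIV :: 'v set) \<noteq> {0} \<and> (\<forall>S. submodule V S \<longrightarrow> S = {0} \<or> S = UNIV)"

definition L0_eigenspace :: "'v::ab_group_add bms_rep \<Rightarrow> complex \<Rightarrow> 'v set" where
  "L0_eigenspace V c = {v. act V (bms_vec (bmsL 0)) v = smul V c v}"

text \<open>Finite-dimensionality is required separately, because \<open>dim\<close> is \<open>0\<close> on
  infinite-dimensional spaces.\<close>

definition cuspidal_module :: "'v::ab_group_add bms_rep \<Rightarrow> bool" where
  "cuspidal_module V \<longleftrightarrow>
     bms_module V \<and>
     module.span (smul V) (\<Union>c. L0_eigenspace V c) = UNIV \<and>
     (\<exists>N. \<forall>c. (\<exists>B. finite B \<and> module.span (smul V) B = L0_eigenspace V c) \<and>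
              vector_space.dim (smul V) (L0_eigenspace V c) \<le> N)"

text \<open>Isomorphisms up to parity change: \<open>e = 0\<close> gives the even ones, \<open>e = 1\<close> the
  parity-reversing ones.\<close>

definition bms_isomorphic ::
    "'v::ab_group_add bms_rep \<Rightarrow> 'w::ab_group_add bms_rep \<Rightarrow> bool" where
  "bms_isomorphic V W \<longleftrightarrow>
     (\<exists>f e. Vector_Spaces.linear (smul V) (smul W) f \<and> bij f \<and>
            (\<forall>x v. f (act V x v) = act W x (f v)) \<and>
            (\<forall>p. f ` part V p = part W (p + e)))"

text \<open>\<open>W\<close> is isomorphic, up to parity change, to the quotient \<open>S / T\<close> of submodules
  \<open>T \<subseteq> S\<close> of \<open>V\<close>. The elements of \<open>S / T\<close> are the cosets \<open>(+) v ` T\<close> with \<open>v \<in> S\<close>, and the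
  operations and the grading of \<open>S / T\<close> are the ones induced on representatives.\<close>

definition isomorphic_to_quotient ::
    "'w::ab_group_add bms_rep \<Rightarrow> 'v::ab_group_add bms_rep \<Rightarrow> 'v set \<Rightarrow> 'v set \<Rightarrow> bool" where
  "isomorphic_to_quotient W V S T \<longleftrightarrow>
     (\<exists>f e. bij_betw f ((\<lambda>v. (+) v ` T) ` S) UNIV \<and>
            (\<forall>u\<in>S. \<forall>v\<in>S. f ((+) (u + v) ` T) = f ((+) u ` T) + f ((+) v ` T)) \<and>
            (\<forall>c. \<forall>v\<in>S. f ((+) (smul V c v) ` T) = smul W c (f ((+) v ` T))) \<and>
            (\<forall>x. \<forall>v\<in>S. f ((+) (act V x v) ` T) = act W x (f ((+) v ` T))) \<and>
            (\<forall>p. f ` (\<lambda>v. (+) v ` T) ` (S \<inter> part V p) = part W (p + e)))"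

definition simple_subquotient ::
    "'w::ab_group_add bms_rep \<Rightarrow> 'v::ab_group_add bms_rep \<Rightarrow> bool" where
  "simple_subquotient W V \<longleftrightarrow>
     simple_module W \<and>
     (\<exists>S T. submodule V S \<and> submodule V T \<and> T \<subseteq> S \<and> isomorphic_to_quotient W V S T)"


section \<open>Modules of the intermediate series\<close>

fun A_basis_act :: "complex \<Rightarrow> complex \<Rightarrow> bms_basis \<Rightarrow> int \<Rightarrow> (int \<Rightarrow>\<^sub>0 complex)" where
  "A_basis_act a b (bmsL m) i = Poly_Mapping.single (m + i) (- (a + of_int i + b * of_int m))"
| "A_basis_act a b _ i = 0"

text \<open>The single parity in which the module is concentrated is chosen to be even, which is
  no restriction up to parity change.\<close>

definition A_module :: "complex \<Rightarrow> complex \<Rightarrow> (int \<Rightarrow>\<^sub>0 complex) bms_rep" where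
  "A_module a b =
     \<lparr> smul = pm_scale,
       part = (\<lambda>p. if p = 0 then UNIV else {0}),
       act = bilinear_extension (A_basis_act a b) \<rparr>"

text \<open>\<open>isomorphic_to_A' V a b\<close>: up to isomorphism and parity change, \<open>V\<close> is
  $\mathcal{A}'_{a,b}$, respectively one of the simple subquotients which that symbol may denote.\<close>

definition isomorphic_to_A' ::
    "'v::ab_group_add bms_rep \<Rightarrow> complex \<Rightarrow> complex \<Rightarrow> bool" where
  "isomorphic_to_A' V a b \<longleftrightarrow>
     (if simple_module (A_module a b) then bms_isomorphic V (A_module a b)
      else simple_subquotient V (A_module a b))"

end

theory Submission
  imports Defs "HOL-Library.Function_Algebras" "HOL-Library.Product_Plus"
    "HOL-Computational_Algebra.Fundamental_Theorem_Algebra"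
begin

text \<open>
  A vector \<open>v\<close> with \<open>L\<^sub>0 v = - s v\<close> is given the weight \<open>s\<close>, so that \<open>L\<^sub>k\<close> raises weights by \<open>k\<close>.
  The idea of the proof is to treat the weight as a complex variable.

  Suppose that infinitely many weights lie in \<open>\<lambda> + \<nat>\<close>. The dimensions are bounded, so far enough up
  \<open>L\<^sub>1\<close> is bijective between consecutive weight spaces (\<open>L1_bijective_eventually\<close>). Powers of \<open>L\<^sub>1\<close>
  identify these spaces with two fixed ones, one for \<open>\<lambda> + \<int>\<close> and one for \<open>\<lambda> + 1/2 + \<int>\<close>. In this
  identification \<open>L\<^sub>1\<close> is the identity and the bracket with \<open>L\<^sub>1\<close> is a difference operator. Hence
  \<open>L\<^sub>k\<close> and \<open>I\<^sub>k\<close> with \<open>k \<le> 1\<close>, as well as \<open>Q\<^sub>r\<close> with \<open>r \<le> 1/2\<close>, depend polynomially on the weight, and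
  they satisfy their relations at all complex weights (\<open>T_bracket\<close>).

  The operator \<open>L\<^sub>2\<close> is a rational function of the weight, because its commutators with \<open>L\<^sub>-\<^sub>1\<close> and
  \<open>L\<^sub>-\<^sub>2\<close> form a solvable linear system (\<open>b2_rational_at\<close>). Comparing degrees shows that it is not
  polynomial (\<open>denominator_nonconstant\<close>). The residue at a pole with minimal real part is killed by
  lowering operators (\<open>residue_killed\<close>), and so there are highest weight vectors, although at complex
  weights that do not occur in the module. The nilpotency of \<open>I\<^sub>1\<close> and the finiteness of the
  spectrum of the Casimir operator then yield a vector killed by \<open>L\<^sub>-\<^sub>1\<close>, \<open>L\<^sub>-\<^sub>2\<close> and \<open>Q\<^sub>1\<^sub>/\<^sub>2\<close>
  (\<open>singular_vector_exists\<close>). Moved back to the weights of the module, it spans vectors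
  \<open>y\<^sub>0, y\<^sub>1, \<dots>\<close> on which the algebra acts as on the vectors \<open>v\<^sub>0, v\<^sub>1, \<dots>\<close> of some \<open>\<A>\<^sub>a\<^sub>,\<^sub>b\<close>, as
  long as the index stays nonnegative (\<open>half_line_exists\<close>).

  Now consider the submodule of \<open>V \<oplus> \<A>\<^sub>a\<^sub>,\<^sub>b\<close> generated by the pairs \<open>(y\<^sub>n, v\<^sub>n)\<close>. A product of
  operators that leads from one of these pairs to a weight of the half line leads to a multiple of
  another pair (\<open>word_in_line\<close>), so the submodule does not contain \<open>(y\<^sub>0, 0)\<close> if \<open>y\<^sub>0 \<noteq> 0\<close>. As \<open>V\<close> is
  simple, the submodule is the graph of a map from a submodule of \<open>\<A>\<^sub>a\<^sub>,\<^sub>b\<close> onto \<open>V\<close>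
  (\<open>isomorphic_of_relation\<close>).

  If infinitely many weights lie in some \<open>\<lambda> - \<nat>\<close>, then the same argument applies after the
  automorphism \<open>L\<^sub>m \<mapsto> - L\<^sub>-\<^sub>m\<close>. In the remaining case the algebra acts by zero, and \<open>V\<close> is
  the trivial subquotient of \<open>\<A>\<^sub>0\<^sub>,\<^sub>0\<close> (\<open>isomorphic_of_finite_weights\<close>).
\<close>

section \<open>Linear algebra over the complex numbers\<close>

locale cvs = vector_space scale
  for scale :: "complex \<Rightarrow> 'v::ab_group_add \<Rightarrow> 'v" (infixr "*s" 75)
begin

text \<open>Linearity is relative to subspaces, because the operators of interest are only determined on
  weight spaces.\<close>

definition lin_on :: "'v set \<Rightarrow> 'v set \<Rightarrow> ('v \<Rightarrow> 'v) \<Rightarrow> bool" where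
  "lin_on U W f \<longleftrightarrow> (\<forall>u\<in>U. f u \<in> W) \<and> (\<forall>u\<in>U. \<forall>v\<in>U. f (u + v) = f u + f v) \<and>
     (\<forall>c. \<forall>u\<in>U. f (c *s u) = c *s f u)"

lemma lin_onD:
  assumes "lin_on U W f"
  shows "u \<in> U \<Longrightarrow> f u \<in> W" "u \<in> U \<Longrightarrow> v \<in> U \<Longrightarrow> f (u + v) = f u + f v" "u \<in> U \<Longrightarrow> f (c *s u) = c *s f u"
  using assms by (auto simp: lin_on_def)

lemma lin_on_0: "lin_on U W f \<Longrightarrow> subspace U \<Longrightarrow> f 0 = 0"
  using lin_onD(3)[of U W f 0 0] subspace_0[of U] by simp

lemma lin_on_neg: "lin_on U W f \<Longrightarrow> subspace U \<Longrightarrow> u \<in> U \<Longrightarrow> f (- u) = - f u"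
  using lin_onD(3)[of U W f u "-1"] by simp

lemma lin_on_diff: "lin_on U W f \<Longrightarrow> subspace U \<Longrightarrow> u \<in> U \<Longrightarrow> v \<in> U \<Longrightarrow> f (u - v) = f u - f v"
  using lin_onD(2)[of U W f u "- v"] lin_on_neg[of U W f v] subspace_neg[of U v] by simp

lemma lin_on_sum:
  assumes "lin_on U W f" "subspace U" "\<And>i. i \<in> I \<Longrightarrow> g i \<in> U"
  shows "f (\<Sum>i\<in>I. g i) = (\<Sum>i\<in>I. f (g i))"
  using assms(3)
proof (induction I rule: infinite_finite_induct)
  case (insert x F)
  then show ?case
    using lin_onD(2)[OF assms(1), of "g x" "\<Sum>i\<in>F. g i"] subspace_sum[OF assms(2), of F g] by simp
qed (use lin_on_0[OF assms(1,2)] in auto)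

definition opoly :: "complex poly \<Rightarrow> ('v \<Rightarrow> 'v) \<Rightarrow> 'v \<Rightarrow> 'v" where
  "opoly p f v = (\<Sum>i\<le>degree p. coeff p i *s (f ^^ i) v)"

lemma opoly_le:
  assumes "degree p \<le> n" shows "opoly p f v = (\<Sum>i\<le>n. coeff p i *s (f ^^ i) v)"
  unfolding opoly_def
  by (rule sum.mono_neutral_left) (use assms in \<open>auto simp: coeff_eq_0\<close>)

lemma opoly_0 [simp]: "opoly 0 f v = 0"
  by (simp add: opoly_def)

lemma opoly_pCons: "opoly (pCons a p) f v = a *s v + opoly p f (f v)"
proof -
  have "opoly (pCons a p) f v = (\<Sum>i\<le>Suc (degree p). coeff (pCons a p) i *s (f ^^ i) v)"
    by (rule opoly_le) (rule degree_pCons_le)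
  also have "\<dots> = a *s v + (\<Sum>i\<le>degree p. coeff p i *s (f ^^ Suc i) v)"
    by (subst sum.atMost_Suc_shift) simp
  also have "\<dots> = a *s v + opoly p f (f v)"
    by (simp add: opoly_def funpow_swap1)
  finally show ?thesis .
qed

lemma opoly_add: "opoly (p + q) f v = opoly p f v + opoly q f v"
proof -
  let ?n = "max (degree p) (degree q)"
  have "degree (p + q) \<le> ?n" by (rule degree_add_le) auto
  then show ?thesis
    by (simp add: opoly_le[of _ ?n] scale_left_distrib sum.distrib)
qed

lemma opoly_smult: "opoly (smult c p) f v = c *s opoly p f v"
  using opoly_le[OF degree_smult_le[of c p], of f v]
  by (simp add: opoly_def scale_sum_right)

lemma opoly_diff: "opoly (p - q) f v = opoly p f v - opoly q f v"
  using opoly_add[of p "- q" f v] opoly_smult[of "-1" q f v] by simp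

lemma opoly_in:
  assumes "lin_on U U f" "subspace U" "v \<in> U" shows "opoly p f v \<in> U"
proof -
  have "(f ^^ i) v \<in> U" for i
    by (induction i) (use assms lin_onD(1) in auto)
  then show ?thesis unfolding opoly_def
    using assms(2) by (intro subspace_sum subspace_scale) auto
qed

lemma opoly_lin:
  assumes f: "lin_on U U f" and U: "subspace U" shows "lin_on U U (opoly p f)"
proof (induction p)
  case 0
  then show ?case using U by (auto simp: lin_on_def subspace_0)
next
  case (pCons a p)
  show ?case
    unfolding lin_on_def opoly_pCons
    using lin_onD[OF f] lin_onD[OF pCons(2)] U
    by (auto simp: scale_right_distrib algebra_simps subspace_add subspace_scale)
qed

lemma opoly_mult:
  assumes f: "lin_on U U f" and U: "subspace U" and v: "v \<in> U"
  shows "opoly (p * q) f v = opoly q f (opoly p f v)"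
  using v
proof (induction p arbitrary: v)
  case 0
  then show ?case using lin_on_0[OF opoly_lin[OF f U] U] by simp
next
  case (pCons a p)
  have "opoly (pCons a p * q) f v = a *s opoly q f v + opoly (p * q) f (f v)"
    by (simp add: opoly_add opoly_smult opoly_pCons)
  also have "\<dots> = opoly q f (a *s v) + opoly q f (opoly p f (f v))"
    using pCons lin_onD[OF f] lin_onD[OF opoly_lin[OF f U]] by simp
  also have "\<dots> = opoly q f (opoly (pCons a p) f v)"
    using pCons lin_onD[OF f] lin_onD[OF opoly_lin[OF f U, of q]] U opoly_in[OF f U]
    by (simp add: opoly_pCons subspace_scale)
  finally show ?case .
qed

lemma opoly_eigen:
  assumes f: "lin_on U U f" and v: "v \<in> U" "f v = r *s v" and U: "subspace U"
  shows "opoly p f v = poly p r *s v"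
proof (induction p)
  case (pCons a p)
  then show ?case
    using v lin_onD(3)[OF opoly_lin[OF f U, of p], of v r]
    by (simp add: opoly_pCons scale_left_distrib)
qed simp

lemma dependency_poly:
  assumes B: "finite B" and a: "\<And>i::nat. a i \<in> span B"
  obtains p where "p \<noteq> 0" "(\<Sum>i\<le>degree p. coeff p i *s a i) = 0"
  \<comment> \<open>A repetition \<open>a i = a j\<close> is a linear dependence that the set of the vectors does not show.\<close>
proof (cases "inj_on a {..card B}")
  case False
  then obtain i j where ij: "i < j" "a i = a j"
    unfolding inj_on_def by (metis linorder_neqE_nat)
  define p where "p = monom (1::complex) j - monom 1 i"
  have c: "coeff p k = (if k = j then 1 else if k = i then -1 else 0)" for k
    using ij by (auto simp: p_def)
  have "p \<noteq> 0" using c[of j] by auto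
  have "degree p = j"
    using ij c by (intro antisym degree_le le_degree) auto
  then have "(\<Sum>k\<le>degree p. coeff p k *s a k) = (\<Sum>k\<in>{i,j}. coeff p k *s a k)"
    using ij c by (intro sum.mono_neutral_right) auto
  also have "\<dots> = 0" using ij c by simp
  finally show ?thesis using that \<open>p \<noteq> 0\<close> by blast
next
  case True
  let ?S = "a ` {..card B}"
  have "dependent ?S"
  proof (rule ccontr)
    assume "independent ?S"
    then have "card ?S \<le> card B"
      using independent_span_bound[OF B, of ?S] a by auto
    with True show False by (simp add: card_image)
  qed
  then obtain u v where u: "v \<in> ?S" "u v \<noteq> 0" "(\<Sum>v\<in>?S. u v *s v) = 0"
    by (auto simp: dependent_finite)
  define p where "p = (\<Sum>i\<le>card B. monom (u (a i)) i)"
  have c: "coeff p k = (if k \<le> card B then u (a k) else 0)" for k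
    by (auto simp: p_def coeff_sum)
  obtain i where "i \<le> card B" "v = a i" using u(1) by auto
  with u(2) c[of i] have "coeff p i \<noteq> 0" by simp
  then have "p \<noteq> 0" by auto
  have d: "degree p \<le> card B" by (rule degree_le) (use c in auto)
  have "(\<Sum>k\<le>degree p. coeff p k *s a k) = (\<Sum>k\<le>card B. coeff p k *s a k)"
    by (rule sum.mono_neutral_left) (use d in \<open>auto simp: coeff_eq_0\<close>)
  also have "\<dots> = (\<Sum>v\<in>?S. u v *s v)"
    using True by (simp add: sum.reindex c)
  finally show ?thesis using that \<open>p \<noteq> 0\<close> u(3) by simp
qed

text \<open>The iterated images of a vector of \<open>B\<close> are linearly dependent, so that some polynomial in \<open>f\<close>
  annihilates it. The product of these polynomials annihilates the span.\<close>

lemma annihilating_poly: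
  assumes B: "finite B" and f: "lin_on (span B) (span B) f"
  obtains p where "p \<noteq> 0" "\<And>u. u \<in> span B \<Longrightarrow> opoly p f u = 0"
proof -
  let ?U = "span B"
  have "\<exists>p. p \<noteq> 0 \<and> opoly p f u = 0" if u: "u \<in> ?U" for u
  proof -
    have "(f ^^ i) u \<in> ?U" for i
      by (induction i) (use u lin_onD(1)[OF f] in auto)
    from dependency_poly[OF B this] obtain p
      where "p \<noteq> 0" "(\<Sum>i\<le>degree p. coeff p i *s (f ^^ i) u) = 0" .
    then show ?thesis by (auto simp: opoly_def)
  qed
  then obtain P where P: "\<And>u. u \<in> ?U \<Longrightarrow> P u \<noteq> 0" "\<And>u. u \<in> ?U \<Longrightarrow> opoly (P u) f u = 0"
    by metis
  let ?p = "\<Prod>b\<in>B. P b"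
  have "?p \<noteq> 0" using P(1) B by (simp add: span_base)
  moreover have z: "opoly ?p f b = 0" if "b \<in> B" for b
  proof -
    have "?p = P b * (\<Prod>b\<in>B - {b}. P b)" using B that by (simp add: prod.remove)
    then have "opoly ?p f b = opoly (\<Prod>b\<in>B - {b}. P b) f (opoly (P b) f b)"
      using opoly_mult[OF f subspace_span] that span_base by metis
    then show ?thesis
      using P(2)[OF span_base[OF that]] lin_on_0[OF opoly_lin[OF f subspace_span] subspace_span] by simp
  qed
  moreover have "opoly ?p f u = 0" if "u \<in> ?U" for u
  proof -
    note l = opoly_lin[OF f subspace_span, of ?p]
    have "subspace {u \<in> ?U. opoly ?p f u = 0}"
      using lin_on_0[OF l subspace_span] lin_onD[OF l]
      by (auto simp: subspace_def span_zero span_add span_scale)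
    moreover have "B \<subseteq> {u \<in> ?U. opoly ?p f u = 0}"
      using z by (auto simp: span_base)
    ultimately have "?U \<subseteq> {u \<in> ?U. opoly ?p f u = 0}"
      by (intro span_minimal)
    with that show ?thesis by blast
  qed
  ultimately show ?thesis using that by blast
qed

lemma finite_eigenvalues:
  assumes B: "finite B" and f: "lin_on (span B) (span B) f"
  shows "finite {r. \<exists>u\<in>span B. u \<noteq> 0 \<and> f u = r *s u}"
proof -
  obtain p where p: "p \<noteq> 0" "\<And>u. u \<in> span B \<Longrightarrow> opoly p f u = 0"
    using annihilating_poly[OF assms] by blast
  have "{r. \<exists>u\<in>span B. u \<noteq> 0 \<and> f u = r *s u} \<subseteq> {r. poly p r = 0}"
    using opoly_eigen[OF f _ _ subspace_span, of _ _ p] p(2) by force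
  then show ?thesis using poly_roots_finite[OF p(1)] finite_subset by blast
qed

text \<open>If \<open>[F, E] = E\<^sup>2\<close>, then a polynomial \<open>p\<close> of minimal degree with \<open>p(E) = 0\<close> also has
  \<open>E\<^sup>2 p'(E) = [F, p(E)] = 0\<close>. Comparing degrees, \<open>n x p - x\<^sup>2 p'\<close> is a multiple of \<open>p\<close>,
  which forces \<open>p\<close> to be a monomial.\<close>

lemma nilpotent_of_commutator_square:
  assumes B: "finite B" and E: "lin_on (span B) (span B) E" and F: "lin_on (span B) (span B) F"
    and EF: "\<And>u. u \<in> span B \<Longrightarrow> F (E u) = E (F u) + E (E u)"
  obtains K where "\<And>u. u \<in> span B \<Longrightarrow> (E ^^ K) u = 0"
proof -
  let ?U = "span B"
  define ann where "ann p \<longleftrightarrow> (\<forall>u\<in>?U. opoly p E u = 0)" for p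
  obtain p0 where "p0 \<noteq> 0" "ann p0"
    using annihilating_poly[OF B E] unfolding ann_def by metis
  then obtain p where p: "p \<noteq> 0" "ann p" and min: "\<And>q. q \<noteq> 0 \<Longrightarrow> ann q \<Longrightarrow> degree p \<le> degree q"
    using ex_has_least_nat[of "\<lambda>p. p \<noteq> 0 \<and> ann p" p0 degree] by blast
  have EU: "E u \<in> ?U" "F u \<in> ?U" if "u \<in> ?U" for u
    using lin_onD(1)[OF E] lin_onD(1)[OF F] that by auto
  have comm: "F (opoly q E u) = opoly q E (F u) + opoly ([:0,0,1:] * pderiv q) E u" if "u \<in> ?U" for q u
    using that
  proof (induction q arbitrary: u)
    case 0
    then show ?case using lin_on_0[OF F subspace_span] by simp
  next
    case (pCons a q)
    note Eu = EU(1)[OF pCons(3)] and Fu = EU(2)[OF pCons(3)]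
    have in1: "opoly q E (E u) \<in> ?U" by (rule opoly_in[OF E subspace_span Eu])
    have "F (opoly (pCons a q) E u) = a *s F u + F (opoly q E (E u))"
      using lin_onD[OF F] in1 pCons(3) by (simp add: opoly_pCons span_scale)
    also have "\<dots> = a *s F u + (opoly q E (F (E u)) + opoly ([:0,0,1:] * pderiv q) E (E u))"
      using pCons.IH[OF Eu] by simp
    also have "opoly q E (F (E u)) = opoly q E (E (F u)) + opoly q E (E (E u))"
      using EF[OF pCons(3)] lin_onD(2)[OF opoly_lin[OF E subspace_span, of q]] EU Eu Fu by simp
    finally show ?case
      by (simp add: opoly_pCons pderiv_pCons opoly_add algebra_simps)
  qed
  define K where "K = degree p"
  define r where "r = smult (of_nat K) (pCons 0 p) - [:0,0,1:] * pderiv p"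
  have cr: "coeff r j = (if j = 0 then 0 else (of_nat K - of_nat j + 1) * coeff p (j - 1))" for j
    by (cases j; cases "j - 1") (auto simp: r_def coeff_pderiv algebra_simps)
  have "ann r"
    unfolding ann_def
  proof
    fix u assume u: "u \<in> ?U"
    have "opoly ([:0,0,1:] * pderiv p) E u = F (opoly p E u) - opoly p E (F u)"
      using comm[OF u, of p] by simp
    also have "\<dots> = 0" using p(2) EU u lin_on_0[OF F subspace_span] by (simp add: ann_def)
    finally show "opoly r E u = 0"
      using p(2) EU u by (simp add: r_def opoly_diff opoly_smult opoly_pCons ann_def)
  qed
  define k where "k = coeff r K / lead_coeff p"
  have "r = smult k p"
  proof (rule ccontr)
    assume ne: "r \<noteq> smult k p"
    have "ann (r - smult k p)"
      using \<open>ann r\<close> p(2) by (simp add: ann_def opoly_diff opoly_smult)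
    then have "K \<le> degree (r - smult k p)" using min ne K_def by simp
    moreover have "coeff (r - smult k p) j = 0" if "j \<ge> K" for j
      using that p(1) cr[of j] coeff_eq_0[of p "j-1"] coeff_eq_0[of p j]
      by (cases "j = K"; cases "j = Suc K") (auto simp: k_def K_def)
    ultimately show False
      using ne leading_coeff_0_iff[of "r - smult k p"] by (metis eq_iff_diff_eq_0)
  qed
  then have rk: "coeff r j = k * coeff p j" for j by simp
  have "k = 0"
  proof (rule ccontr)
    assume "k \<noteq> 0"
    have "coeff p j = 0" for j
    proof (induction j)
      case 0
      then show ?case using rk[of 0] cr[of 0] \<open>k \<noteq> 0\<close> by simp
    next
      case (Suc j)
      then show ?case using rk[of "Suc j"] cr[of "Suc j"] \<open>k \<noteq> 0\<close> by simp
    qed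
    then show False using p(1) by (simp add: poly_eq_iff)
  qed
  then have pz: "coeff p j = 0" if "j < K" for j
    using rk[of "Suc j"] cr[of "Suc j"] that
    by (auto simp: of_nat_diff[symmetric] simp del: of_nat_diff)
  have "(E ^^ K) u = 0" if "u \<in> ?U" for u
  proof -
    have "0 = (\<Sum>i\<le>K. coeff p i *s (E ^^ i) u)" using p(2) that by (simp add: ann_def opoly_def K_def)
    also have "\<dots> = (\<Sum>i\<in>{K}. coeff p i *s (E ^^ i) u)"
      by (rule sum.mono_neutral_right) (use pz in \<open>auto simp: nat_less_le\<close>)
    finally show ?thesis using p(1) by (simp add: K_def)
  qed
  then show ?thesis using that by blast
qed

end

subsection \<open>Linear systems with parameter\<close>

text \<open>The action of the matrix is cut off outside \<open>J\<close>, so that the span of the indicators of the elements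
  of \<open>J\<close> is invariant.\<close>

definition mat_op :: "'i set \<Rightarrow> ('i \<Rightarrow> 'i \<Rightarrow> complex) \<Rightarrow> ('i \<Rightarrow> complex) \<Rightarrow> 'i \<Rightarrow> complex" where
  "mat_op J c g i = (if i \<in> J then \<Sum>j\<in>J. c i j * g j else 0)"

interpretation fn: cvs "\<lambda>c f. (\<lambda>i::'i. c * (f i :: complex))"
  by unfold_locales (auto simp: fun_eq_iff algebra_simps)

lemma fn_span_indicators:
  assumes J: "finite J"
  shows "fn.span ((\<lambda>j i. if i = j then 1 else 0) ` J) = {g. \<forall>i. i \<notin> J \<longrightarrow> g i = 0}" (is "fn.span ?S = ?U")
proof
  have "fn.subspace ?U" by (auto simp: fn.subspace_def)
  then show "fn.span ?S \<subseteq> ?U" by (intro fn.span_minimal) auto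
  show "?U \<subseteq> fn.span ?S"
  proof
    fix g assume g: "g \<in> ?U"
    have "g = (\<Sum>j\<in>J. (\<lambda>i. g j * (if i = j then 1 else 0)))"
    proof
      fix i
      have "(\<Sum>j\<in>J. (\<lambda>i. g j * (if i = j then 1 else 0))) i = (\<Sum>j\<in>J. g j * (if i = j then 1 else 0))"
        by (induction J rule: infinite_finite_induct) auto
      also have "\<dots> = (\<Sum>j\<in>J. if i = j then g j else 0)" by (rule sum.cong) auto
      also have "\<dots> = g i" using J g by (simp add: sum.delta')
      finally show "g i = (\<Sum>j\<in>J. (\<lambda>i. g j * (if i = j then 1 else 0))) i" by simp
    qed
    moreover have "(\<lambda>i. g j * (if i = j then 1 else 0)) \<in> fn.span ?S" if "j \<in> J" for j
      using that by (intro fn.span_scale fn.span_base) auto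
    ultimately show "g \<in> fn.span ?S"
      using fn.span_sum[of J "\<lambda>j i. g j * (if i = j then 1 else 0)" ?S] by simp
  qed
qed

text \<open>The polynomial \<open>q\<close> annihilates the matrix \<open>c\<close>, so \<open>q(s) = q(s) - q(c)\<close> is a left multiple of
  \<open>s - c\<close>. The coefficients of that multiple do not depend on \<open>s\<close>, \<open>g\<close> and \<open>r\<close>.\<close>

lemma solve_linear_system:
  assumes J: "finite J"
  shows "\<exists>q::complex poly. q \<noteq> 0 \<and> (\<exists>P::'i \<Rightarrow> 'i \<Rightarrow> complex poly. \<forall>s g r.
     (\<forall>i\<in>J. s * g i = (\<Sum>j\<in>J. c i j * g j) + r i) \<longrightarrow>
     (\<forall>i\<in>J. poly q s * g i = (\<Sum>j\<in>J. poly (P i j) s * r j)))"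
proof -
  let ?op = "mat_op J c"
  let ?B = "(\<lambda>j i. if i = j then 1 else (0::complex)) ` J"
  note sp = fn_span_indicators[OF J]
  have lin: "fn.lin_on (fn.span ?B) (fn.span ?B) ?op"
    unfolding fn.lin_on_def sp
    by (auto simp: mat_op_def fun_eq_iff algebra_simps sum.distrib sum_distrib_left)
  obtain q where q: "q \<noteq> 0" "\<And>u. u \<in> fn.span ?B \<Longrightarrow> fn.opoly q ?op u = 0"
    using fn.annihilating_poly[OF finite_imageI[OF J] lin] by blast
  have *: "\<exists>P::'i \<Rightarrow> 'i \<Rightarrow> complex poly. \<forall>s g r. (\<forall>i. i \<notin> J \<longrightarrow> g i = 0) \<longrightarrow>
     (\<forall>i\<in>J. s * g i = ?op g i + r i) \<longrightarrow>
     (\<forall>i\<in>J. poly p s * g i = fn.opoly p ?op g i + (\<Sum>j\<in>J. poly (P i j) s * r j))" for p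
  proof (induction p)
    case 0
    show ?case by (rule exI[of _ "\<lambda>_ _. 0"]) (simp add: fn.opoly_0)
  next
    case (pCons a p)
    then obtain P where P: "\<And>s g r. (\<forall>i. i \<notin> J \<longrightarrow> g i = 0) \<Longrightarrow>
     (\<forall>i\<in>J. s * g i = ?op g i + r i) \<Longrightarrow>
     (\<forall>i\<in>J. poly p s * g i = fn.opoly p ?op g i + (\<Sum>j\<in>J. poly (P i j) s * r j))" by blast
    define P' where "P' i k = (\<Sum>j\<in>J. P i j * [:c j k:]) + (if i = k then p else 0)" for i k
    show ?case
    proof (intro exI[of _ P'] allI impI ballI)
      fix s g r i
      assume g: "\<forall>i. i \<notin> J \<longrightarrow> g i = 0" and e: "\<forall>i\<in>J. s * g i = ?op g i + r i" and i: "i \<in> J"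
      have e': "\<forall>i\<in>J. s * ?op g i = ?op (?op g) i + ?op r i"
      proof
        fix i assume "i \<in> J"
        have "s * ?op g i = (\<Sum>j\<in>J. c i j * (s * g j))"
          using \<open>i \<in> J\<close> by (simp add: mat_op_def sum_distrib_left mult_ac)
        also have "\<dots> = (\<Sum>j\<in>J. c i j * (?op g j + r j))"
          by (rule sum.cong) (use e in auto)
        also have "\<dots> = ?op (?op g) i + ?op r i"
        proof -
          have "?op (?op g) i = (\<Sum>j\<in>J. c i j * ?op g j)"
            using \<open>i \<in> J\<close> by (simp add: mat_op_def[of J c "?op g"])
          moreover have "?op r i = (\<Sum>j\<in>J. c i j * r j)" using \<open>i \<in> J\<close> by (simp add: mat_op_def)
          ultimately show ?thesis by (simp add: algebra_simps sum.distrib)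
        qed
        finally show "s * ?op g i = ?op (?op g) i + ?op r i" .
      qed
      have "\<forall>i. i \<notin> J \<longrightarrow> ?op g i = 0" by (simp add: mat_op_def)
      from P[OF this e'] i
      have ih: "poly p s * ?op g i = fn.opoly p ?op (?op g) i + (\<Sum>j\<in>J. poly (P i j) s * ?op r j)"
        by blast
      have s1: "(\<Sum>k\<in>J. poly (P' i k) s * r k) = (\<Sum>j\<in>J. poly (P i j) s * ?op r j) + poly p s * r i"
      proof -
        have "(\<Sum>k\<in>J. poly (P' i k) s * r k)
            = (\<Sum>k\<in>J. \<Sum>j\<in>J. poly (P i j) s * (c j k * r k)) + (\<Sum>k\<in>J. (if i = k then poly p s * r k else 0))"
          unfolding sum.distrib[symmetric]
          by (rule sum.cong) (auto simp: P'_def poly_sum sum_distrib_right sum_distrib_left algebra_simps)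
        also have "(\<Sum>k\<in>J. \<Sum>j\<in>J. poly (P i j) s * (c j k * r k)) = (\<Sum>j\<in>J. poly (P i j) s * ?op r j)"
          by (subst sum.swap) (simp add: mat_op_def sum_distrib_left)
        finally show ?thesis using i J by (simp add: sum.delta')
      qed
      have "poly (pCons a p) s * g i = a * g i + poly p s * (s * g i)" by (simp add: algebra_simps)
      also have "\<dots> = a * g i + poly p s * ?op g i + poly p s * r i"
        using e i by (simp add: algebra_simps)
      also have "\<dots> = fn.opoly (pCons a p) ?op g i + (\<Sum>k\<in>J. poly (P' i k) s * r k)"
        by (simp add: fn.opoly_pCons ih s1)
      finally show "poly (pCons a p) s * g i = fn.opoly (pCons a p) ?op g i + (\<Sum>k\<in>J. poly (P' i k) s * r k)" .
    qed
  qed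
  obtain P where P: "\<And>s g r. (\<forall>i. i \<notin> J \<longrightarrow> g i = 0) \<Longrightarrow>
     (\<forall>i\<in>J. s * g i = ?op g i + r i) \<Longrightarrow>
     (\<forall>i\<in>J. poly q s * g i = fn.opoly q ?op g i + (\<Sum>j\<in>J. poly (P i j) s * r j))"
    using *[of q] by blast
  have "\<forall>i\<in>J. poly q s * g i = (\<Sum>j\<in>J. poly (P i j) s * r j)"
    if e: "\<forall>i\<in>J. s * g i = (\<Sum>j\<in>J. c i j * g j) + r i" for s g r
  proof -
    define g' where "g' i = (if i \<in> J then g i else 0)" for i
    have 1: "\<forall>i. i \<notin> J \<longrightarrow> g' i = 0" by (simp add: g'_def)
    have 2: "\<forall>i\<in>J. s * g' i = ?op g' i + r i"
    proof
      fix i assume "i \<in> J"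
      moreover have "(\<Sum>j\<in>J. c i j * g' j) = (\<Sum>j\<in>J. c i j * g j)"
        by (rule sum.cong) (auto simp: g'_def)
      ultimately show "s * g' i = ?op g' i + r i" using e by (simp add: mat_op_def g'_def)
    qed
    have "fn.opoly q ?op g' = 0" by (rule q(2)) (use 1 sp in auto)
    with P[OF 1 2] have "\<forall>i\<in>J. poly q s * g' i = (\<Sum>j\<in>J. poly (P i j) s * r j)" by simp
    then show ?thesis by (auto simp: g'_def)
  qed
  with q(1) show ?thesis by blast
qed

subsection \<open>Polynomial functions with values in a vector space\<close>

context cvs
begin

text \<open>With this inductive form the closure properties hold by rule induction; coefficients are only
  introduced in \<open>vpoly_normal_form\<close>.\<close>

inductive vpoly :: "(complex \<Rightarrow> 'v) \<Rightarrow> bool" where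
  const: "vpoly (\<lambda>z. x)"
| add: "vpoly f \<Longrightarrow> vpoly g \<Longrightarrow> vpoly (\<lambda>z. f z + g z)"
| mult: "vpoly f \<Longrightarrow> vpoly (\<lambda>z. z *s f z)"

lemma vpoly_smult: "vpoly f \<Longrightarrow> vpoly (\<lambda>z. c *s f z)"
proof (induction rule: vpoly.induct)
  case (const x)
  then show ?case by (rule vpoly.const)
next
  case (add f g)
  then show ?case by (simp add: scale_right_distrib vpoly.add)
next
  case (mult f)
  from vpoly.mult[OF mult(2)] show ?case by (simp add: mult.commute)
qed

lemma vpoly_poly_scale: "vpoly f \<Longrightarrow> vpoly (\<lambda>z. poly p z *s f z)"
proof (induction p)
  case 0
  then show ?case using vpoly.const[of 0] by simp
next
  case (pCons a p)
  from vpoly.add[OF vpoly_smult[OF pCons(3), of a] vpoly.mult[OF pCons(2)[OF pCons(3)]]]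
  show ?case by (simp add: scale_left_distrib)
qed

lemma vpoly_diff: "vpoly f \<Longrightarrow> vpoly g \<Longrightarrow> vpoly (\<lambda>z. f z - g z)"
  using vpoly.add[OF _ vpoly_smult[of g "-1"]] by simp

lemma vpoly_sum: "(\<And>i. i \<in> I \<Longrightarrow> vpoly (f i)) \<Longrightarrow> vpoly (\<lambda>z. \<Sum>i\<in>I. f i z)"
  by (induction I rule: infinite_finite_induct) (auto intro: vpoly.add vpoly.const)

lemma vpoly_shift: "vpoly f \<Longrightarrow> vpoly (\<lambda>z. f (z + a))"
proof (induction rule: vpoly.induct)
  case (mult f)
  from vpoly_poly_scale[OF mult(2), of "[:a, 1:]"] show ?case by (simp add: add.commute)
qed (auto intro: vpoly.intros)

lemma vpoly_normal_form:
  assumes "vpoly f" obtains K x where "\<And>z. f z = (\<Sum>j<K. z ^ j *s x j)"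
proof -
  have "\<exists>K x. \<forall>z. f z = (\<Sum>j<K. z ^ j *s x j)"
    using assms
  proof (induction rule: vpoly.induct)
    case (const x)
    show ?case by (rule exI[of _ 1], rule exI[of _ "\<lambda>_. x"]) simp
  next
    case (add f g)
    then obtain K x L y where f: "\<And>z. f z = (\<Sum>j<K. z ^ j *s x j)" and g: "\<And>z. g z = (\<Sum>j<L. z ^ j *s y j)"
      by blast
    let ?M = "max K L"
    let ?x = "\<lambda>j. if j < K then x j else 0" and ?y = "\<lambda>j. if j < L then y j else 0"
    have f': "f z = (\<Sum>j<?M. z ^ j *s ?x j)" for z
      unfolding f by (rule sum.mono_neutral_cong_left) auto
    have g': "g z = (\<Sum>j<?M. z ^ j *s ?y j)" for z
      unfolding g by (rule sum.mono_neutral_cong_left) auto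
    show ?case
      by (rule exI[of _ ?M], rule exI[of _ "\<lambda>j. ?x j + ?y j"])
        (simp only: f' g' scale_right_distrib sum.distrib, simp)
  next
    case (mult f)
    then obtain K x where f: "\<And>z. f z = (\<Sum>j<K. z ^ j *s x j)" by blast
    show ?case
    proof (rule exI[of _ "Suc K"], rule exI[of _ "\<lambda>j. case j of 0 \<Rightarrow> 0 | Suc j \<Rightarrow> x j"], rule allI)
      fix z show "z *s f z = (\<Sum>j<Suc K. z ^ j *s (case j of 0 \<Rightarrow> 0 | Suc j \<Rightarrow> x j))"
        by (subst sum.lessThan_Suc_shift) (simp add: f scale_sum_right)
    qed
  qed
  then show ?thesis using that by blast
qed

text \<open>Induction on the degree: for fixed \<open>z0\<close> in \<open>Z\<close>, the difference quotients of the values are the values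
  of a polynomial function of smaller degree.\<close>

lemma vpoly_coeffs_in:
  assumes U: "subspace U" and Z: "infinite Z" and f: "\<And>z. z \<in> Z \<Longrightarrow> (\<Sum>j<K. z ^ j *s x j) \<in> U"
    and j: "j < K"
  shows "x j \<in> U"
  using Z f j
proof (induction K arbitrary: x j Z)
  case (Suc K)
  have "Z \<noteq> {}" using Suc.prems(1) by auto
  then obtain z0 where z0: "z0 \<in> Z" by blast
  define y where "y i = (\<Sum>j\<in>{i<..K}. z0 ^ (j - Suc i) *s x j)" for i
  have key: "(\<Sum>j<Suc K. z ^ j *s x j) - (\<Sum>j<Suc K. z0 ^ j *s x j) = (z - z0) *s (\<Sum>i<K. z ^ i *s y i)" for z
  proof -
    have pw: "z ^ j - z0 ^ j = (z - z0) * (\<Sum>i<j. z ^ i * z0 ^ (j - Suc i))" for j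
      using power_diff_sumr2[of z j z0] by (simp add: mult.commute)
    have "(\<Sum>j<Suc K. z ^ j *s x j) - (\<Sum>j<Suc K. z0 ^ j *s x j) = (\<Sum>j<Suc K. (z ^ j - z0 ^ j) *s x j)"
      by (simp add: sum_subtractf[symmetric] scale_left_diff_distrib)
    also have "\<dots> = (z - z0) *s (\<Sum>j<Suc K. \<Sum>i<j. z ^ i *s (z0 ^ (j - Suc i) *s x j))"
      by (simp only: pw scale_sum_right scale_sum_left scale_scale[symmetric])
    also have "(\<Sum>j<Suc K. \<Sum>i<j. z ^ i *s (z0 ^ (j - Suc i) *s x j))
        = (\<Sum>i<K. \<Sum>j\<in>{i<..K}. z ^ i *s (z0 ^ (j - Suc i) *s x j))"
      unfolding sum.Sigma[OF finite_lessThan ballI[OF finite_lessThan]]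
        sum.Sigma[OF finite_lessThan ballI[OF finite_greaterThanAtMost]]
      by (rule sum.reindex_bij_witness[of _ "\<lambda>(i,j). (j,i)" "\<lambda>(i,j). (j,i)"]) auto
    finally show ?thesis by (simp add: y_def scale_sum_right)
  qed
  have yU: "y i \<in> U" if "i < K" for i
  proof (rule Suc.IH[of "Z - {z0}" y])
    show "infinite (Z - {z0})" using Suc.prems(1) by simp
    show "i < K" by fact
    fix z assume z: "z \<in> Z - {z0}"
    have "(z - z0) *s (\<Sum>i<K. z ^ i *s y i) \<in> U"
      unfolding key[symmetric] using z z0 Suc.prems(2) by (intro subspace_diff[OF U]) auto
    from subspace_scale[OF U this, of "inverse (z - z0)"] z
    show "(\<Sum>i<K. z ^ i *s y i) \<in> U" by simp
  qed
  have xU: "x (Suc i) \<in> U" if "i < K" for i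
  proof (cases "Suc i < K")
    case True
    have split: "{i<..K} = insert (Suc i) {Suc i<..K}" using that by auto
    have "y i = x (Suc i) + (\<Sum>j\<in>{Suc i<..K}. z0 ^ (j - Suc i) *s x j)"
      by (simp add: y_def split)
    also have "(\<Sum>j\<in>{Suc i<..K}. z0 ^ (j - Suc i) *s x j) = z0 *s y (Suc i)"
      unfolding y_def scale_sum_right
      by (rule sum.cong) (auto simp: Suc_diff_Suc power_Suc[symmetric] simp del: power_Suc)
    finally have "x (Suc i) = y i - z0 *s y (Suc i)" by simp
    then show ?thesis using yU that True U by (simp add: subspace_diff subspace_scale)
  next
    case False
    then have "{i<..K} = {Suc i}" using that by auto
    then have "y i = x (Suc i)" by (simp add: y_def)
    then show ?thesis using yU[OF that] by simp
  qed
  have x0: "x 0 \<in> U"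
  proof -
    have "x 0 = (\<Sum>j<Suc K. z0 ^ j *s x j) - (\<Sum>j<K. z0 ^ Suc j *s x (Suc j))"
      by (subst sum.lessThan_Suc_shift) simp
    also have "\<dots> \<in> U"
    proof (rule subspace_diff[OF U Suc.prems(2)[OF z0]])
      show "(\<Sum>j<K. z0 ^ Suc j *s x (Suc j)) \<in> U"
        using xU by (intro subspace_sum[OF U] subspace_scale[OF U]) auto
    qed
    finally show ?thesis .
  qed
  show ?case using x0 xU Suc.prems(3) by (cases j) auto
qed simp

lemma vpoly_in_subspace:
  assumes f: "vpoly f" and U: "subspace U" and Z: "infinite Z" "\<And>z. z \<in> Z \<Longrightarrow> f z \<in> U"
  shows "f z \<in> U"
proof -
  obtain K x where fx: "\<And>z. f z = (\<Sum>j<K. z ^ j *s x j)" using vpoly_normal_form[OF f] by blast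
  have "x j \<in> U" if "j < K" for j
    by (rule vpoly_coeffs_in[OF U Z(1) _ that]) (use Z(2) fx in metis)
  then show ?thesis unfolding fx by (intro subspace_sum subspace_scale U) auto
qed

lemma vpoly_eq:
  assumes "vpoly f" "vpoly g" "infinite Z" "\<And>z. z \<in> Z \<Longrightarrow> f z = g z"
  shows "f z = g z"
  using vpoly_in_subspace[OF vpoly_diff[OF assms(1,2)] subspace_single_0 assms(3), of z] assms(4) by simp

text \<open>The coefficients of \<open>f\<close> lie in \<open>U\<close>, so that \<open>T z\<close> can be applied to them one by one.\<close>

lemma vpoly_family:
  assumes f: "vpoly f" "\<And>z. f z \<in> U" and U: "subspace U"
    and T: "\<And>z. lin_on U W (T z)" "\<And>u. u \<in> U \<Longrightarrow> vpoly (\<lambda>z. T z u)"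
  shows "vpoly (\<lambda>z. T z (f z))"
proof -
  obtain K x where fx: "\<And>z. f z = (\<Sum>j<K. z ^ j *s x j)" using vpoly_normal_form[OF f(1)] by blast
  have x: "x j \<in> U" if "j < K" for j
    by (rule vpoly_coeffs_in[OF U infinite_UNIV_char_0 _ that]) (use f(2) fx in metis)
  have "T z (f z) = (\<Sum>j<K. z ^ j *s T z (x j))" for z
  proof -
    have "T z (f z) = (\<Sum>j<K. T z (z ^ j *s x j))"
      unfolding fx by (rule lin_on_sum[OF T(1) U]) (use x U in \<open>auto intro: subspace_scale\<close>)
    also have "\<dots> = (\<Sum>j<K. z ^ j *s T z (x j))"
      by (rule sum.cong) (use x lin_onD(3)[OF T(1)] in auto)
    finally show ?thesis .
  qed
  moreover have "vpoly (\<lambda>z. z ^ j *s T z (x j))" if "j < K" for j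
    using vpoly_poly_scale[OF T(2)[OF x[OF that]], of "monom 1 j"] by (simp add: poly_monom)
  ultimately show ?thesis
    using vpoly_sum[of "{..<K}" "\<lambda>j z. z ^ j *s T z (x j)"] by simp
qed

lemma infinite_progression: "infinite {z::complex. \<exists>n::nat. n \<ge> N \<and> z = a + 2 * of_nat n}"
proof -
  have "inj (\<lambda>n. a + 2 * of_nat n :: complex)" by (auto simp: inj_def)
  then have "infinite ((\<lambda>n. a + 2 * of_nat n :: complex) ` {N..})"
    by (simp add: finite_image_iff inj_on_subset infinite_Ici)
  moreover have "(\<lambda>n. a + 2 * of_nat n :: complex) ` {N..} = {z. \<exists>n::nat. n \<ge> N \<and> z = a + 2 * of_nat n}"
    by auto
  ultimately show ?thesis by simp
qed

lemma vpoly_eq_progression: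
  assumes "vpoly f" "vpoly g" "\<And>n::nat. n \<ge> N \<Longrightarrow> f (a + 2 * of_nat n) = g (a + 2 * of_nat n)"
  shows "f z = g z"
  by (rule vpoly_eq[OF assms(1,2) infinite_progression[of N a]]) (use assms(3) in auto)

lemma vpoly_root:
  assumes f: "vpoly f" and r: "f a = 0"
  obtains g where "vpoly g" "\<And>z. f z = (z - a) *s g z"
proof -
  have "\<exists>g. vpoly g \<and> (\<forall>z. f z - f a = (z - a) *s g z)"
    using f
  proof (induction rule: vpoly.induct)
    case (const x)
    show ?case by (rule exI[of _ "\<lambda>_. 0"]) (auto intro: vpoly.const)
  next
    case (add f1 f2)
    then obtain g1 g2 where "vpoly g1" "\<forall>z. f1 z - f1 a = (z - a) *s g1 z"
      "vpoly g2" "\<forall>z. f2 z - f2 a = (z - a) *s g2 z" by blast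
    then show ?case
      by (intro exI[of _ "\<lambda>z. g1 z + g2 z"])
        (auto intro: vpoly.add simp: scale_right_distrib add_diff_add)
  next
    case (mult f1)
    then obtain g1 where g: "vpoly g1" "\<forall>z. f1 z - f1 a = (z - a) *s g1 z" by blast
    have "z *s f1 z - a *s f1 a = (z - a) *s (z *s g1 z + f1 a)" for z
    proof -
      have "z *s f1 z - a *s f1 a = z *s (f1 z - f1 a) + (z - a) *s f1 a"
        by (simp add: scale_right_diff_distrib scale_left_diff_distrib)
      then show ?thesis using g(2) by (simp add: scale_right_distrib mult.commute)
    qed
    then show ?case using g(1) by (intro exI[of _ "\<lambda>z. z *s g1 z + f1 a"]) (auto intro: vpoly.intros)
  qed
  then show ?thesis using r that by auto
qed

end

text \<open>The falling factorial \<open>z (z - 2) \<dots> (z - 2 k + 2)\<close>: differences with step \<open>2\<close> act on these polynomials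
  as the derivative acts on powers.\<close>

definition fall :: "nat \<Rightarrow> complex poly" where
  "fall k = (\<Prod>i<k. [:- (2 * of_nat i), 1:])"

lemma fall_shift: "poly (fall (Suc k)) (z + 2) = (z + 2) * poly (fall k) z"
  by (simp add: fall_def poly_prod prod.lessThan_Suc_shift algebra_simps del: prod.lessThan_Suc)

lemma fall_difference: "poly (fall (Suc k)) (z + 2) - poly (fall (Suc k)) z = 2 * of_nat (Suc k) * poly (fall k) z"
proof -
  have "poly (fall (Suc k)) z = poly (fall k) z * (z - 2 * of_nat k)" by (simp add: fall_def algebra_simps)
  then show ?thesis by (simp only: fall_shift) (simp add: algebra_simps)
qed

text \<open>Repeated division by \<open>z, z - 2, z - 4, \<dots>\<close> expands \<open>p\<close> in falling factorials, as in Newton's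
  interpolation formula.\<close>

lemma poly_antidifference: "\<exists>a::complex poly. \<forall>z. poly a (z + 2) - poly a z = poly p z"
proof -
  have "\<exists>a::complex poly. \<forall>z. poly a (z + 2) - poly a z = poly p z * poly (fall k) z" for k
  proof (induction "degree p" arbitrary: p k rule: less_induct)
    case less
    let ?c = "2 * of_nat k :: complex"
    let ?b = "smult (poly p ?c / (2 * of_nat (Suc k))) (fall (Suc k))"
    have b: "poly ?b (z + 2) - poly ?b z = poly p ?c * poly (fall k) z" for z
    proof -
      have nz: "2 * of_nat (Suc k) \<noteq> (0::complex)" by (simp del: of_nat_Suc)
      have "poly ?b (z + 2) - poly ?b z = poly p ?c / (2 * of_nat (Suc k)) *
          (poly (fall (Suc k)) (z + 2) - poly (fall (Suc k)) z)"
        by (simp add: right_diff_distrib del: of_nat_Suc)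
      then show ?thesis using nz by (simp add: fall_difference del: of_nat_Suc)
    qed
    show ?case
    proof (cases "degree p = 0")
      case True
      then have "poly p z = poly p ?c" for z by (metis degree_eq_zeroE poly_pCons poly_0 mult_zero_right)
      then show ?thesis using b by metis
    next
      case False
      let ?s = "synthetic_div p ?c"
      have "degree ?s < degree p" using False by (simp add: degree_synthetic_div)
      then obtain a where a: "\<forall>z. poly a (z + 2) - poly a z = poly ?s z * poly (fall (Suc k)) z"
        using less by blast
      have p: "poly p z = (z - ?c) * poly ?s z + poly p ?c" for z
      proof -
        have "poly ([:- ?c, 1:] * ?s + [:poly p ?c:]) z = poly p z" by (simp only: synthetic_div_correct')
        then show ?thesis by (simp add: algebra_simps)
      qed
      have f: "poly (fall (Suc k)) z = poly (fall k) z * (z - ?c)" for z by (simp add: fall_def algebra_simps)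
      have "poly (a + ?b) (z + 2) - poly (a + ?b) z = poly p z * poly (fall k) z" for z
      proof -
        have "poly (a + ?b) (z + 2) - poly (a + ?b) z
            = (poly a (z + 2) - poly a z) + (poly ?b (z + 2) - poly ?b z)"
          unfolding poly_add by (rule add_diff_add)
        also have "\<dots> = poly ?s z * (poly (fall k) z * (z - ?c)) + poly p ?c * poly (fall k) z"
          by (simp only: a b f)
        also have "\<dots> = poly p z * poly (fall k) z"
          by (subst p) (simp add: algebra_simps)
        finally show ?thesis .
      qed
      then show ?thesis by blast
    qed
  qed
  from this[of 0] show ?thesis by (simp add: fall_def)
qed

context cvs
begin

text \<open>On the progression, \<open>g\<close> differs by a constant from every polynomial function with the differences \<open>f\<close>.\<close>

lemma vpoly_antidifference:
  assumes f: "vpoly f" and g: "\<And>n::nat. g (Suc n) = g n + f (a + 2 * of_nat n)"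
  obtains F where "vpoly F" "\<And>n. F (a + 2 * of_nat n) = g n"
proof -
  obtain K x where fx: "\<And>z. f z = (\<Sum>j<K. z ^ j *s x j)" using vpoly_normal_form[OF f] by blast
  have "\<exists>p::complex poly. \<forall>z. poly p (z + 2) - poly p z = z ^ j" for j
    using poly_antidifference[of "monom 1 j"] by (simp add: poly_monom)
  then obtain P :: "nat \<Rightarrow> complex poly" where P: "\<And>j z. poly (P j) (z + 2) - poly (P j) z = z ^ j"
    by metis
  define G where "G z = (\<Sum>j<K. poly (P j) z *s x j)" for z
  define F where "F z = G z + (g 0 - G a)" for z
  have G: "vpoly G" unfolding G_def by (intro vpoly_sum vpoly_poly_scale vpoly.const)
  have "vpoly F" unfolding F_def by (intro vpoly.add[OF G] vpoly.const)
  moreover have "F (a + 2 * of_nat n) = g n" for n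
  proof (induction n)
    case 0
    then show ?case by (simp add: F_def)
  next
    case (Suc n)
    let ?z = "a + 2 * of_nat n"
    have e: "a + 2 * of_nat (Suc n) = ?z + 2" by simp
    have "F (?z + 2) = F ?z + f ?z"
      unfolding F_def G_def fx P[symmetric] by (simp add: scale_left_diff_distrib sum_subtractf)
    then show ?case by (simp only: e g Suc)
  qed
  ultimately show ?thesis using that by blast
qed

end

subsection \<open>A system for two unknown functions\<close>

text \<open>The functions \<open>g\<close>, \<open>s g\<close> and \<open>s\<^sup>2 g\<close> together satisfy a system of the form treated in
  \<open>solve_linear_system\<close>, whose matrix is the companion matrix \<open>c\<close>.\<close>

lemma solve_cubic_system:
  fixes J :: "'i set" and M0 M1 M2 :: "'i \<Rightarrow> 'i \<Rightarrow> complex"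
  assumes J: "finite J"
  shows "\<exists>q::complex poly. q \<noteq> 0 \<and> (\<exists>P::'i \<Rightarrow> 'i \<Rightarrow> complex poly. \<forall>s g r.
     (\<forall>i\<in>J. s ^ 3 * g i = (\<Sum>k\<in>J. (M0 i k + s * M1 i k + s ^ 2 * M2 i k) * g k) + r i) \<longrightarrow>
     (\<forall>i\<in>J. poly q s * g i = (\<Sum>j\<in>J. poly (P i j) s * r j)))"
proof -
  let ?J = "J \<times> {..<3::nat}"
  define c :: "'i \<times> nat \<Rightarrow> 'i \<times> nat \<Rightarrow> complex" where
    "c = (\<lambda>(i,a) (k,b). if a = 2 then (if b = 0 then M0 i k else if b = 1 then M1 i k else M2 i k)
        else if k = i \<and> b = Suc a then 1 else 0)"
  have fin: "finite ?J" using J by simp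
  have ex3: "{..<3::nat} = {0,1,2}" by auto
  from solve_linear_system[OF fin, of c] obtain q P where q: "q \<noteq> 0"
    and P: "\<And>s g r. (\<forall>i\<in>?J. s * g i = (\<Sum>j\<in>?J. c i j * g j) + r i) \<Longrightarrow>
     (\<forall>i\<in>?J. poly q s * g i = (\<Sum>j\<in>?J. poly (P i j) s * r j))" by blast
  have "\<forall>i\<in>J. poly q s * g i = (\<Sum>j\<in>J. poly (P (i,0) (j,2)) s * r j)"
    if e: "\<forall>i\<in>J. s ^ 3 * g i = (\<Sum>k\<in>J. (M0 i k + s * M1 i k + s ^ 2 * M2 i k) * g k) + r i" for s g r
  proof
    fix i assume i: "i \<in> J"
    define g' :: "'i \<times> nat \<Rightarrow> complex" where "g' = (\<lambda>(k,a). s ^ a * g k)"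
    define r' :: "'i \<times> nat \<Rightarrow> complex" where "r' = (\<lambda>(k,a). if a = 2 then r k else 0)"
    have "\<forall>i\<in>?J. s * g' i = (\<Sum>j\<in>?J. c i j * g' j) + r' i"
    proof
      fix x assume "x \<in> ?J"
      then obtain k a where x: "x = (k,a)" "k \<in> J" "a < 3" by auto
      show "s * g' x = (\<Sum>j\<in>?J. c x j * g' j) + r' x"
      proof (cases "a = 2")
        case True
        have "(\<Sum>j\<in>?J. c x j * g' j) = (\<Sum>j\<in>J. \<Sum>b<3. c x (j,b) * g' (j,b))"
          by (simp add: sum.cartesian_product)
        also have "\<dots> = (\<Sum>j\<in>J. (M0 k j + s * M1 k j + s ^ 2 * M2 k j) * g j)"
          by (rule sum.cong) (auto simp: x True c_def g'_def ex3 algebra_simps)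
        finally have 1: "(\<Sum>j\<in>?J. c x j * g' j) = (\<Sum>j\<in>J. (M0 k j + s * M1 k j + s ^ 2 * M2 k j) * g j)" .
        have "s * g' x = s ^ 3 * g k" by (simp add: g'_def x True power3_eq_cube power2_eq_square)
        also have "\<dots> = (\<Sum>j\<in>J. (M0 k j + s * M1 k j + s ^ 2 * M2 k j) * g j) + r k" using e x(2) by blast
        finally show ?thesis unfolding 1 by (simp add: r'_def x True)
      next
        case False
        have "(\<Sum>j\<in>?J. c x j * g' j) = (\<Sum>j\<in>?J. if j = (k, Suc a) then g' j else 0)"
          by (rule sum.cong) (use False x in \<open>auto simp: c_def split: if_splits\<close>)
        also have "\<dots> = g' (k, Suc a)" using x False fin by (subst sum.delta) auto
        finally show ?thesis using x False by (simp add: g'_def r'_def)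
      qed
    qed
    from P[OF this] i have "poly q s * g' (i,0) = (\<Sum>j\<in>?J. poly (P (i,0) j) s * r' j)" by simp
    also have "\<dots> = (\<Sum>j\<in>J. \<Sum>b<3. poly (P (i,0) (j,b)) s * r' (j,b))"
      by (simp add: sum.cartesian_product)
    also have "\<dots> = (\<Sum>j\<in>J. poly (P (i,0) (j,2)) s * r j)"
      by (rule sum.cong) (auto simp: r'_def ex3)
    finally show "poly q s * g i = (\<Sum>j\<in>J. poly (P (i,0) (j,2)) s * r j)" by (simp add: g'_def)
  qed
  with q show ?thesis by (intro exI[of _ q] conjI exI[of _ "\<lambda>i j. P (i,0) (j,2)"]) auto
qed

text \<open>For large \<open>s\<close> the two equations read \<open>u - v = O(1/s)\<close> (from the second) and \<open>u + v = O(1/s)\<close>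
  (from the first plus \<open>s\<close> times the second). Their sum and their
  difference express \<open>2 s\<^sup>3 u\<close> and \<open>2 s\<^sup>3 v\<close> through lower powers of \<open>s\<close>, which is the form of the
  preceding lemma.\<close>

lemma solve_pair_system:
  fixes J :: "'i set" and c1 c2 d k1 k2 e :: "'i \<Rightarrow> 'i \<Rightarrow> complex"
  assumes J: "finite J"
  shows "\<exists>q::complex poly. q \<noteq> 0 \<and> (\<exists>P Q::'i \<Rightarrow> 'i \<Rightarrow> complex poly. \<forall>s u v r1 r2.
     (\<forall>i\<in>J. (s^4 - 4 * s^3 + 5 * s^2 - 2 * s) * u i + (2 * s^2 - 4 * s + 2) * (\<Sum>j\<in>J. c1 i j * u j) + (\<Sum>j\<in>J. c2 i j * u j)
        = (s^4 + 4 * s^3 + 5 * s^2 + 2 * s) * v i + (2 * s^2 + 4 * s + 2) * (\<Sum>j\<in>J. k1 i j * v j) + (\<Sum>j\<in>J. k2 i j * v j) + r1 i) \<longrightarrow>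
     (\<forall>i\<in>J. - (s^3 - 3 * s^2 + 2 * s) * u i - 3 * s * (\<Sum>j\<in>J. c1 i j * u j) - (\<Sum>j\<in>J. d i j * u j)
        = - (s^3 + 3 * s^2 + 2 * s) * v i - 3 * (s + 2) * (\<Sum>j\<in>J. k1 i j * v j) - (\<Sum>j\<in>J. e i j * v j) + r2 i) \<longrightarrow>
     (\<forall>i\<in>J. poly q s * v i = (\<Sum>j\<in>J. poly (P i j) s * r1 j + poly (Q i j) s * r2 j)))"
proof -
  let ?J = "J \<times> (UNIV :: bool set)"
  define one :: "'i \<Rightarrow> 'i \<Rightarrow> complex" where "one i k = (if i = k then 1 else 0)" for i k
  \<comment> \<open>The index \<open>(k, True)\<close> stands for the unknown \<open>v k\<close> and \<open>(k, False)\<close> for \<open>u k\<close>.\<close>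
  define M0 M1 M2 :: "'i \<times> bool \<Rightarrow> 'i \<times> bool \<Rightarrow> complex" where
    "M0 = (\<lambda>(i,t) (k,t'). 1/2 * (if t then (if t' then - 8 * k1 i k - k2 i k - e i k else 2 * c1 i k + c2 i k + d i k)
       else (if t' then 4 * k1 i k - k2 i k + e i k else 2 * c1 i k + c2 i k - d i k)))"
    and "M1 = (\<lambda>(i,t) (k,t'). 1/2 * (if t then (if t' then - 4 * one i k - k1 i k + e i k else - c1 i k - d i k)
       else (if t' then 5 * k1 i k + e i k else - 4 * one i k - 7 * c1 i k - d i k)))"
    and "M2 = (\<lambda>(i,t) (k,t'). 1/2 * (if t then (if t' then - 6 * one i k + k1 i k else - c1 i k)
       else (if t' then k1 i k else 6 * one i k - c1 i k)))"
  have fin: "finite ?J" using J by simp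
  have half: "y = 1/2 * a + 1/2 * b + -1/2 * r" if "2 * y = a + b - r" for y a b r :: complex
  proof -
    have "y = 1/2 * (2 * y)" by simp
    then show ?thesis unfolding that by (simp add: algebra_simps)
  qed
  from solve_cubic_system[OF fin, of M0 M1 M2] obtain q P where q: "q \<noteq> 0"
    and P: "\<And>s g r. (\<forall>i\<in>?J. s ^ 3 * g i = (\<Sum>k\<in>?J. (M0 i k + s * M1 i k + s ^ 2 * M2 i k) * g k) + r i) \<Longrightarrow>
     (\<forall>i\<in>?J. poly q s * g i = (\<Sum>j\<in>?J. poly (P i j) s * r j))" by blast
  define P1 where "P1 i j = smult (-1/2) (P (i,True) (j,True) + P (i,True) (j,False))" for i j
  define P2 where "P2 i j = smult (-1/2) ([:-1,1:] * P (i,True) (j,True) + [:1,1:] * P (i,True) (j,False))" for i j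
  have "\<forall>i\<in>J. poly q s * v i = (\<Sum>j\<in>J. poly (P1 i j) s * r1 j + poly (P2 i j) s * r2 j)"
    if e1: "\<forall>i\<in>J. (s^4 - 4 * s^3 + 5 * s^2 - 2 * s) * u i + (2 * s^2 - 4 * s + 2) * (\<Sum>j\<in>J. c1 i j * u j) + (\<Sum>j\<in>J. c2 i j * u j)
        = (s^4 + 4 * s^3 + 5 * s^2 + 2 * s) * v i + (2 * s^2 + 4 * s + 2) * (\<Sum>j\<in>J. k1 i j * v j) + (\<Sum>j\<in>J. k2 i j * v j) + r1 i"
    and e2: "\<forall>i\<in>J. - (s^3 - 3 * s^2 + 2 * s) * u i - 3 * s * (\<Sum>j\<in>J. c1 i j * u j) - (\<Sum>j\<in>J. d i j * u j)
        = - (s^3 + 3 * s^2 + 2 * s) * v i - 3 * (s + 2) * (\<Sum>j\<in>J. k1 i j * v j) - (\<Sum>j\<in>J. e i j * v j) + r2 i"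
    for s u v r1 r2
  proof
    fix i assume i: "i \<in> J"
    define g :: "'i \<times> bool \<Rightarrow> complex" where "g = (\<lambda>(k,t). if t then v k else u k)"
    define r :: "'i \<times> bool \<Rightarrow> complex" where
      "r = (\<lambda>(k,t). -1/2 * (if t then r1 k + (s - 1) * r2 k else r1 k + (s + 1) * r2 k))"
    have "\<forall>x\<in>?J. s ^ 3 * g x = (\<Sum>y\<in>?J. (M0 x y + s * M1 x y + s ^ 2 * M2 x y) * g y) + r x"
    proof
      fix x assume "x \<in> ?J"
      then obtain k t where x: "x = (k,t)" "k \<in> J" by auto
      define cu cv where "cu = (\<Sum>j\<in>J. c1 k j * u j)" and "cv = (\<Sum>j\<in>J. k1 k j * v j)"
      define c2u k2v du ev where "c2u = (\<Sum>j\<in>J. c2 k j * u j)" and "k2v = (\<Sum>j\<in>J. k2 k j * v j)"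
        and "du = (\<Sum>j\<in>J. d k j * u j)" and "ev = (\<Sum>j\<in>J. e k j * v j)"
      have ou: "(\<Sum>j\<in>J. one k j * w j) = w k" for w :: "'i \<Rightarrow> complex"
        using x J by (simp add: one_def if_distrib[of "\<lambda>x. x * _"] sum.delta' cong: if_cong)
      note f1 = e1[rule_format, OF x(2), folded cu_def cv_def c2u_def k2v_def]
      note f2 = e2[rule_format, OF x(2), folded cu_def cv_def du_def ev_def]
      have sp: "(\<Sum>y\<in>?J. (M0 x y + s * M1 x y + s ^ 2 * M2 x y) * g y) =
         (\<Sum>j\<in>J. (M0 x (j,True) + s * M1 x (j,True) + s ^ 2 * M2 x (j,True)) * v j) +
         (\<Sum>j\<in>J. (M0 x (j,False) + s * M1 x (j,False) + s ^ 2 * M2 x (j,False)) * u j)"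
      proof -
        have "(\<Sum>y\<in>?J. (M0 x y + s * M1 x y + s ^ 2 * M2 x y) * g y) =
          (\<Sum>j\<in>J. \<Sum>t\<in>UNIV. (M0 x (j,t) + s * M1 x (j,t) + s ^ 2 * M2 x (j,t)) * g (j,t))"
          by (simp add: sum.cartesian_product)
        then show ?thesis by (simp add: UNIV_bool g_def sum.distrib add.commute)
      qed
      show "s ^ 3 * g x = (\<Sum>y\<in>?J. (M0 x y + s * M1 x y + s ^ 2 * M2 x y) * g y) + r x"
      proof (cases t)
        case True
        have a: "(\<Sum>j\<in>J. (M0 x (j,True) + s * M1 x (j,True) + s ^ 2 * M2 x (j,True)) * v j) =
          1/2 * ((- 8 - s + s^2) * cv - k2v + (s - 1) * ev + (- 4 * s - 6 * s^2) * (\<Sum>j\<in>J. one k j * v j))"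
          unfolding cv_def k2v_def ev_def sum_distrib_left sum.distrib[symmetric] sum_subtractf[symmetric]
          by (rule sum.cong) (auto simp: x True M0_def M1_def M2_def field_simps)
        have b: "(\<Sum>j\<in>J. (M0 x (j,False) + s * M1 x (j,False) + s ^ 2 * M2 x (j,False)) * u j) =
          1/2 * ((2 - s - s^2) * cu + c2u + (1 - s) * du)"
          unfolding cu_def c2u_def du_def sum_distrib_left sum.distrib[symmetric] sum_subtractf[symmetric]
          by (rule sum.cong) (auto simp: x True M0_def M1_def M2_def field_simps)
        have "2 * (s ^ 3 * v k) = (- 8 - s + s^2) * cv - k2v + (s - 1) * ev + (- 4 * s - 6 * s^2) * v k
           + ((2 - s - s^2) * cu + c2u + (1 - s) * du) - (r1 k + (s - 1) * r2 k)"
          using f1 f2 by algebra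
        from half[OF this] show ?thesis unfolding sp a b ou by (simp only: g_def r_def x True prod.case if_True)
      next
        case False
        have a: "(\<Sum>j\<in>J. (M0 x (j,True) + s * M1 x (j,True) + s ^ 2 * M2 x (j,True)) * v j) =
          1/2 * ((4 + 5 * s + s^2) * cv - k2v + (s + 1) * ev)"
          unfolding cv_def k2v_def ev_def sum_distrib_left sum.distrib[symmetric] sum_subtractf[symmetric]
          by (rule sum.cong) (auto simp: x False M0_def M1_def M2_def field_simps)
        have b: "(\<Sum>j\<in>J. (M0 x (j,False) + s * M1 x (j,False) + s ^ 2 * M2 x (j,False)) * u j) =
          1/2 * ((2 - 7 * s - s^2) * cu + c2u - (1 + s) * du + (- 4 * s + 6 * s^2) * (\<Sum>j\<in>J. one k j * u j))"
          unfolding cu_def c2u_def du_def sum_distrib_left sum.distrib[symmetric] sum_subtractf[symmetric]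
          by (rule sum.cong) (auto simp: x False M0_def M1_def M2_def field_simps)
        have "2 * (s ^ 3 * u k) = (4 + 5 * s + s^2) * cv - k2v + (s + 1) * ev
           + ((2 - 7 * s - s^2) * cu + c2u - (1 + s) * du + (- 4 * s + 6 * s^2) * u k) - (r1 k + (s + 1) * r2 k)"
          using f1 f2 by algebra
        from half[OF this] show ?thesis unfolding sp a b ou by (simp only: g_def r_def x False prod.case if_False)
      qed
    qed
    from P[OF this] i have "poly q s * g (i,True) = (\<Sum>y\<in>?J. poly (P (i,True) y) s * r y)" by simp
    also have "\<dots> = (\<Sum>j\<in>J. \<Sum>t\<in>UNIV. poly (P (i,True) (j,t)) s * r (j,t))"
      by (simp add: sum.cartesian_product)
    also have "\<dots> = (\<Sum>j\<in>J. poly (P1 i j) s * r1 j + poly (P2 i j) s * r2 j)"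
      by (rule sum.cong) (auto simp: r_def UNIV_bool P1_def P2_def field_simps)
    finally show "poly q s * v i = (\<Sum>j\<in>J. poly (P1 i j) s * r1 j + poly (P2 i j) s * r2 j)"
      by (simp add: g_def)
  qed
  with q show ?thesis by (intro exI[of _ q] conjI exI[of _ P1] exI[of _ P2]) blast+
qed

context cvs
begin

text \<open>The same system for families of vectors: \<open>C\<close> and \<open>D\<close> act on the values, the matrices \<open>c\<close>
  and \<open>d\<close> on the index set.\<close>

lemma solve_pair_system_vec:
  fixes X :: "'x set" and c c2 d :: "'x \<Rightarrow> 'x \<Rightarrow> complex"
  assumes X: "finite X" and B: "finite B" "independent B"
    and C: "lin_on (span B) (span B) C" and D: "lin_on (span B) (span B) D"
  shows "\<exists>q::complex poly. q \<noteq> 0 \<and> (\<exists>R1 R2::'x \<Rightarrow> 'x \<Rightarrow> complex \<Rightarrow> 'v \<Rightarrow> 'v.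
     (\<forall>x y s. lin_on (span B) (span B) (R1 x y s) \<and> lin_on (span B) (span B) (R2 x y s)) \<and>
     (\<forall>x y. \<forall>w\<in>span B. vpoly (\<lambda>s. R1 x y s w) \<and> vpoly (\<lambda>s. R2 x y s w)) \<and>
     (\<forall>s u v r1 r2. (\<forall>x\<in>X. u x \<in> span B \<and> v x \<in> span B \<and> r1 x \<in> span B \<and> r2 x \<in> span B) \<longrightarrow>
     (\<forall>x\<in>X. (s^4 - 4 * s^3 + 5 * s^2 - 2 * s) *s u x + (2 * s^2 - 4 * s + 2) *s (\<Sum>y\<in>X. c x y *s u y) + (\<Sum>y\<in>X. c2 x y *s u y)
        = (s^4 + 4 * s^3 + 5 * s^2 + 2 * s) *s v x + (2 * s^2 + 4 * s + 2) *s C (v x) + C (C (v x)) + r1 x) \<longrightarrow>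
     (\<forall>x\<in>X. (- (s^3 - 3 * s^2 + 2 * s)) *s u x - (3 * s) *s (\<Sum>y\<in>X. c x y *s u y) - (\<Sum>y\<in>X. d x y *s u y)
        = (- (s^3 + 3 * s^2 + 2 * s)) *s v x - (3 * (s + 2)) *s C (v x) - D (v x) + r2 x) \<longrightarrow>
     (\<forall>x\<in>X. poly q s *s v x = (\<Sum>y\<in>X. R1 x y s (r1 y) + R2 x y s (r2 y)))))"
proof -
  let ?F = "span B" and ?J = "X \<times> B"
  define crd where "crd b w = representation B w b" for b w
  have crd_add: "crd b (w + w') = crd b w + crd b w'" if "w \<in> ?F" "w' \<in> ?F" for b w w'
    using that B by (simp add: crd_def representation_add)
  have crd_scale: "crd b (a *s w) = a * crd b w" if "w \<in> ?F" for b a w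
    using that B by (simp add: crd_def representation_scale)
  have crd_diff: "crd b (w - w') = crd b w - crd b w'" if "w \<in> ?F" "w' \<in> ?F" for b w w'
    using that B by (simp add: crd_def representation_diff)
  have crd_sum: "crd b (\<Sum>i\<in>I. f i) = (\<Sum>i\<in>I. crd b (f i))" if "\<And>i. i \<in> I \<Longrightarrow> f i \<in> ?F" for b I and f :: "'i \<Rightarrow> 'v"
    using that B by (simp add: crd_def representation_sum)
  have crd_sum': "crd b (\<Sum>i\<in>I. f i) = (\<Sum>i\<in>I. crd b (f i))" if "\<And>i. i \<in> I \<Longrightarrow> f i \<in> ?F" for b I and f :: "'x \<Rightarrow> 'v"
    using that B by (simp add: crd_def representation_sum)
  have expand: "w = (\<Sum>b\<in>B. crd b w *s b)" if "w \<in> ?F" for w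
    using sum_representation_eq[OF B(2) that B(1) order_refl] by (simp add: crd_def)
  have crd_op: "crd b (A w) = (\<Sum>b'\<in>B. crd b (A b') * crd b' w)"
    if A: "lin_on ?F ?F A" and w: "w \<in> ?F" for A b w
  proof -
    have "A w = (\<Sum>b'\<in>B. A (crd b' w *s b'))"
      by (subst (1) expand[OF w], rule lin_on_sum[OF A subspace_span]) (auto intro: span_scale span_base)
    also have "\<dots> = (\<Sum>b'\<in>B. crd b' w *s A b')"
      by (rule sum.cong) (auto simp: lin_onD(3)[OF A] span_base)
    finally have "crd b (A w) = (\<Sum>b'\<in>B. crd b (crd b' w *s A b'))"
      using lin_onD(1)[OF A] B by (simp add: crd_def representation_sum span_scale span_base)
    also have "\<dots> = (\<Sum>b'\<in>B. crd b (A b') * crd b' w)"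
      by (rule sum.cong) (use lin_onD(1)[OF A] in \<open>auto simp: crd_scale span_base\<close>)
    finally show ?thesis .
  qed
  have CC: "lin_on ?F ?F (\<lambda>w. C (C w))"
    using lin_onD[OF C] by (auto simp: lin_on_def)
  \<comment> \<open>In coordinates the index set is \<open>X \<times> B\<close>. Matrices on \<open>X\<close> act on the first component,
    operators on the values act on the second one.\<close>
  define rm :: "('x \<Rightarrow> 'x \<Rightarrow> complex) \<Rightarrow> 'x \<times> 'v \<Rightarrow> 'x \<times> 'v \<Rightarrow> complex" where
    "rm m = (\<lambda>(x,b) (y,b'). if b = b' then m x y else 0)" for m
  define lm :: "('v \<Rightarrow> 'v) \<Rightarrow> 'x \<times> 'v \<Rightarrow> 'x \<times> 'v \<Rightarrow> complex" where
    "lm A = (\<lambda>(x,b) (y,b'). if x = y then crd b (A b') else 0)" for A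
  have rm: "(\<Sum>j\<in>?J. rm m (x,b) j * (case j of (y,b') \<Rightarrow> crd b' (u y))) = crd b (\<Sum>y\<in>X. m x y *s u y)"
    if "x \<in> X" "b \<in> B" "\<forall>x\<in>X. u x \<in> ?F" for m x b u
  proof -
    have "(\<Sum>j\<in>?J. rm m (x,b) j * (case j of (y,b') \<Rightarrow> crd b' (u y)))
        = (\<Sum>y\<in>X. \<Sum>b'\<in>B. (if b = b' then m x y * crd b' (u y) else 0))"
      unfolding sum.cartesian_product by (rule sum.cong) (auto simp: rm_def)
    also have "\<dots> = (\<Sum>y\<in>X. m x y * crd b (u y))" using that B by (simp add: sum.delta')
    also have "\<dots> = crd b (\<Sum>y\<in>X. m x y *s u y)"
      using that by (simp add: crd_sum' crd_scale span_scale)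
    finally show ?thesis .
  qed
  have lm: "(\<Sum>j\<in>?J. lm A (x,b) j * (case j of (y,b') \<Rightarrow> crd b' (u y))) = crd b (A (u x))"
    if "x \<in> X" "b \<in> B" "\<forall>x\<in>X. u x \<in> ?F" "lin_on ?F ?F A" for A x b u
  proof -
    have "(\<Sum>j\<in>?J. lm A (x,b) j * (case j of (y,b') \<Rightarrow> crd b' (u y)))
        = (\<Sum>y\<in>X. \<Sum>b'\<in>B. if x = y then crd b (A b') * crd b' (u y) else 0)"
      unfolding sum.cartesian_product by (rule sum.cong) (auto simp: lm_def)
    also have "\<dots> = (\<Sum>y\<in>X. if x = y then \<Sum>b'\<in>B. crd b (A b') * crd b' (u y) else 0)"
      by (rule sum.cong) auto
    also have "\<dots> = (\<Sum>b'\<in>B. crd b (A b') * crd b' (u x))" using that X by (simp add: sum.delta')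
    finally show ?thesis using crd_op[OF that(4)] that by simp
  qed
  have finJ: "finite ?J" using X B by simp
  from solve_pair_system[OF finJ, of "rm c" "rm c2" "lm C" "lm (\<lambda>w. C (C w))" "rm d" "lm D"]
  obtain q P Q where q: "q \<noteq> 0" and PQ: "\<And>s u v r1 r2.
     \<forall>i\<in>?J. (s^4 - 4 * s^3 + 5 * s^2 - 2 * s) * u i + (2 * s^2 - 4 * s + 2) * (\<Sum>j\<in>?J. rm c i j * u j) + (\<Sum>j\<in>?J. rm c2 i j * u j)
        = (s^4 + 4 * s^3 + 5 * s^2 + 2 * s) * v i + (2 * s^2 + 4 * s + 2) * (\<Sum>j\<in>?J. lm C i j * v j) + (\<Sum>j\<in>?J. lm (\<lambda>w. C (C w)) i j * v j) + r1 i \<Longrightarrow>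
     \<forall>i\<in>?J. - (s^3 - 3 * s^2 + 2 * s) * u i - 3 * s * (\<Sum>j\<in>?J. rm c i j * u j) - (\<Sum>j\<in>?J. rm d i j * u j)
        = - (s^3 + 3 * s^2 + 2 * s) * v i - 3 * (s + 2) * (\<Sum>j\<in>?J. lm C i j * v j) - (\<Sum>j\<in>?J. lm D i j * v j) + r2 i \<Longrightarrow>
     \<forall>i\<in>?J. poly q s * v i = (\<Sum>j\<in>?J. poly (P i j) s * r1 j + poly (Q i j) s * r2 j)"
    by blast
  define R where "R P x y s w = (\<Sum>b\<in>B. (\<Sum>b'\<in>B. poly (P (x,b) (y,b')) s * crd b' w) *s b)"
    for P :: "'x \<times> 'v \<Rightarrow> 'x \<times> 'v \<Rightarrow> complex poly" and x y s w
  have R_lin: "lin_on ?F ?F (R P x y s)" for P x y s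
    unfolding lin_on_def
  proof (intro conjI ballI allI)
    show "R P x y s w \<in> ?F" for w
      unfolding R_def by (rule span_sum, rule span_scale, rule span_base)
    show "R P x y s (w + w') = R P x y s w + R P x y s w'" if "w \<in> ?F" "w' \<in> ?F" for w w'
      using that by (simp add: R_def crd_add sum.distrib scale_left_distrib distrib_left)
    show "R P x y s (a *s w) = a *s R P x y s w" if "w \<in> ?F" for a w
      using that by (simp add: R_def crd_scale scale_sum_right sum_distrib_left mult.left_commute)
  qed
  have R_vpoly: "vpoly (\<lambda>s. R P x y s w)" for P x y w
  proof -
    have "R P x y s w = (\<Sum>b\<in>B. poly (\<Sum>b'\<in>B. smult (crd b' w) (P (x,b) (y,b'))) s *s b)" for s
      by (simp add: R_def poly_sum mult.commute)
    then show ?thesis by (simp only:) (intro vpoly_sum vpoly_poly_scale vpoly.const)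
  qed
  have "\<forall>x\<in>X. poly q s *s v x = (\<Sum>y\<in>X. R P x y s (r1 y) + R Q x y s (r2 y))"
    if mem: "\<forall>x\<in>X. u x \<in> span B \<and> v x \<in> span B \<and> r1 x \<in> span B \<and> r2 x \<in> span B"
      and e1: "\<forall>x\<in>X. (s^4 - 4 * s^3 + 5 * s^2 - 2 * s) *s u x + (2 * s^2 - 4 * s + 2) *s (\<Sum>y\<in>X. c x y *s u y) + (\<Sum>y\<in>X. c2 x y *s u y)
        = (s^4 + 4 * s^3 + 5 * s^2 + 2 * s) *s v x + (2 * s^2 + 4 * s + 2) *s C (v x) + C (C (v x)) + r1 x"
      and e2: "\<forall>x\<in>X. (- (s^3 - 3 * s^2 + 2 * s)) *s u x - (3 * s) *s (\<Sum>y\<in>X. c x y *s u y) - (\<Sum>y\<in>X. d x y *s u y)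
        = (- (s^3 + 3 * s^2 + 2 * s)) *s v x - (3 * (s + 2)) *s C (v x) - D (v x) + r2 x"
    for s u v r1 r2
  proof
    fix x assume x: "x \<in> X"
    define cu where "cu w = (\<lambda>(y,b'). crd b' (w y))" for w :: "'x \<Rightarrow> 'v"
    have mu: "\<forall>x\<in>X. u x \<in> ?F" "\<forall>x\<in>X. v x \<in> ?F" "\<forall>x\<in>X. r1 x \<in> ?F" "\<forall>x\<in>X. r2 x \<in> ?F" using mem by auto
    have sumF: "(\<Sum>y\<in>X. m x y *s u y) \<in> ?F" for m :: "'x \<Rightarrow> 'x \<Rightarrow> complex" and x
      using mu by (intro span_sum span_scale) auto
    have opF: "C (v x) \<in> ?F" "C (C (v x)) \<in> ?F" "D (v x) \<in> ?F" if "x \<in> X" for x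
      using mu that lin_onD(1)[OF C] lin_onD(1)[OF D] by auto
    note mm = rm[OF _ _ mu(1), folded cu_def] lm[OF _ _ mu(2) C, folded cu_def]
      lm[OF _ _ mu(2) CC, folded cu_def] lm[OF _ _ mu(2) D, folded cu_def]
    have 1: "\<forall>i\<in>?J. (s^4 - 4 * s^3 + 5 * s^2 - 2 * s) * cu u i + (2 * s^2 - 4 * s + 2) * (\<Sum>j\<in>?J. rm c i j * cu u j) + (\<Sum>j\<in>?J. rm c2 i j * cu u j)
        = (s^4 + 4 * s^3 + 5 * s^2 + 2 * s) * cu v i + (2 * s^2 + 4 * s + 2) * (\<Sum>j\<in>?J. lm C i j * cu v j) + (\<Sum>j\<in>?J. lm (\<lambda>w. C (C w)) i j * cu v j) + cu r1 i"
    proof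
      fix i assume "i \<in> ?J"
      then obtain y b where i: "i = (y,b)" "y \<in> X" "b \<in> B" by auto
      note f = e1[rule_format, OF i(2), THEN arg_cong[of _ _ "crd b"]]
      show "(s^4 - 4 * s^3 + 5 * s^2 - 2 * s) * cu u i + (2 * s^2 - 4 * s + 2) * (\<Sum>j\<in>?J. rm c i j * cu u j) + (\<Sum>j\<in>?J. rm c2 i j * cu u j)
        = (s^4 + 4 * s^3 + 5 * s^2 + 2 * s) * cu v i + (2 * s^2 + 4 * s + 2) * (\<Sum>j\<in>?J. lm C i j * cu v j) + (\<Sum>j\<in>?J. lm (\<lambda>w. C (C w)) i j * cu v j) + cu r1 i"
        unfolding i(1) mm[OF i(2,3)]
        using f i mu opF[OF i(2)] sumF by (simp add: crd_add crd_scale span_add span_scale cu_def)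
    qed
    have 2: "\<forall>i\<in>?J. - (s^3 - 3 * s^2 + 2 * s) * cu u i - 3 * s * (\<Sum>j\<in>?J. rm c i j * cu u j) - (\<Sum>j\<in>?J. rm d i j * cu u j)
        = - (s^3 + 3 * s^2 + 2 * s) * cu v i - 3 * (s + 2) * (\<Sum>j\<in>?J. lm C i j * cu v j) - (\<Sum>j\<in>?J. lm D i j * cu v j) + cu r2 i"
    proof
      fix i assume "i \<in> ?J"
      then obtain y b where i: "i = (y,b)" "y \<in> X" "b \<in> B" by auto
      note f = e2[rule_format, OF i(2), THEN arg_cong[of _ _ "crd b"]]
      show "- (s^3 - 3 * s^2 + 2 * s) * cu u i - 3 * s * (\<Sum>j\<in>?J. rm c i j * cu u j) - (\<Sum>j\<in>?J. rm d i j * cu u j)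
        = - (s^3 + 3 * s^2 + 2 * s) * cu v i - 3 * (s + 2) * (\<Sum>j\<in>?J. lm C i j * cu v j) - (\<Sum>j\<in>?J. lm D i j * cu v j) + cu r2 i"
        unfolding i(1) mm[OF i(2,3)]
        using f i mu opF[OF i(2)] sumF
        by (simp only: crd_add crd_diff crd_scale span_add span_diff span_scale cu_def prod.case)
    qed
    note key = PQ[OF 1 2]
    have "poly q s *s v x = (\<Sum>b\<in>B. (poly q s * crd b (v x)) *s b)"
      by (subst (1) expand[of "v x"]) (use mu x in \<open>auto simp: scale_sum_right\<close>)
    also have "\<dots> = (\<Sum>b\<in>B. (\<Sum>y\<in>X. \<Sum>b'\<in>B. poly (P (x,b) (y,b')) s * crd b' (r1 y) + poly (Q (x,b) (y,b')) s * crd b' (r2 y)) *s b)"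
    proof (rule sum.cong, rule refl)
      fix b assume "b \<in> B"
      with key x have "poly q s * cu v (x,b) = (\<Sum>j\<in>?J. poly (P (x,b) j) s * cu r1 j + poly (Q (x,b) j) s * cu r2 j)"
        by blast
      then show "(poly q s * crd b (v x)) *s b = (\<Sum>y\<in>X. \<Sum>b'\<in>B. poly (P (x,b) (y,b')) s * crd b' (r1 y) + poly (Q (x,b) (y,b')) s * crd b' (r2 y)) *s b"
        by (simp add: cu_def sum.cartesian_product split_def)
    qed
    also have "\<dots> = (\<Sum>y\<in>X. R P x y s (r1 y) + R Q x y s (r2 y))"
      unfolding R_def sum.distrib[symmetric] scale_left_distrib[symmetric] scale_sum_left
      by (rule sum.swap)
    finally show "poly q s *s v x = (\<Sum>y\<in>X. R P x y s (r1 y) + R Q x y s (r2 y))" .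
  qed
  note main = this
  show ?thesis
  proof (rule exI[of _ q], rule conjI, rule q, rule exI[of _ "R P"], rule exI[of _ "R Q"],
      intro conjI allI ballI)
    fix s u v r1 r2
    show "(\<forall>x\<in>X. u x \<in> span B \<and> v x \<in> span B \<and> r1 x \<in> span B \<and> r2 x \<in> span B) \<longrightarrow>
     (\<forall>x\<in>X. (s^4 - 4 * s^3 + 5 * s^2 - 2 * s) *s u x + (2 * s^2 - 4 * s + 2) *s (\<Sum>y\<in>X. c x y *s u y) + (\<Sum>y\<in>X. c2 x y *s u y)
        = (s^4 + 4 * s^3 + 5 * s^2 + 2 * s) *s v x + (2 * s^2 + 4 * s + 2) *s C (v x) + C (C (v x)) + r1 x) \<longrightarrow>
     (\<forall>x\<in>X. (- (s^3 - 3 * s^2 + 2 * s)) *s u x - (3 * s) *s (\<Sum>y\<in>X. c x y *s u y) - (\<Sum>y\<in>X. d x y *s u y)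
        = (- (s^3 + 3 * s^2 + 2 * s)) *s v x - (3 * (s + 2)) *s C (v x) - D (v x) + r2 x) \<longrightarrow>
     (\<forall>x\<in>X. poly q s *s v x = (\<Sum>y\<in>X. R P x y s (r1 y) + R Q x y s (r2 y)))"
      by (intro impI) (rule main)
  qed (use R_lin R_vpoly in auto)
qed

end

section \<open>Actions of the superalgebra by operators\<close>

definition lin_ext :: "(complex \<Rightarrow> 'v \<Rightarrow> 'v) \<Rightarrow> (bms_basis \<Rightarrow> 'v \<Rightarrow> 'v) \<Rightarrow> bms \<Rightarrow> 'v \<Rightarrow> 'v::ab_group_add" where
  "lin_ext sc A u v = (\<Sum>\<beta>\<in>Poly_Mapping.keys u. sc (Poly_Mapping.lookup u \<beta>) (A \<beta> v))"

text \<open>Twice the degree, so that the degree of \<open>Q\<^sub>r\<close> becomes an integer.\<close>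

fun deg2 :: "bms_basis \<Rightarrow> int" where
  "deg2 (bmsL k) = 2 * k"
| "deg2 (bmsI k) = 2 * k"
| "deg2 (bmsQ k) = 2 * k + 1"
| "deg2 _ = 0"

lemma deg2_bracket: "\<beta> \<in> Poly_Mapping.keys (bms_basis_bracket x y) \<Longrightarrow> deg2 \<beta> = deg2 x + deg2 y"
  by (cases x; cases y)
    (auto simp: in_keys_iff lookup_add lookup_minus lookup_uminus lookup_single when_def split: if_splits)

context cvs
begin

lemma lin_ext_superset:
  assumes "finite S" "Poly_Mapping.keys u \<subseteq> S"
  shows "lin_ext scale A u v = (\<Sum>\<beta>\<in>S. Poly_Mapping.lookup u \<beta> *s A \<beta> v)"
  unfolding lin_ext_def
  by (rule sum.mono_neutral_left) (use assms in \<open>auto simp: in_keys_iff\<close>)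

lemma lin_ext_0 [simp]: "lin_ext scale A 0 v = 0"
  by (simp add: lin_ext_def)

lemma lin_ext_single [simp]: "lin_ext scale A (Poly_Mapping.single \<beta> c) v = c *s A \<beta> v"
  by (simp add: lin_ext_def)

lemma lin_ext_add [simp]: "lin_ext scale A (u + w) v = lin_ext scale A u v + lin_ext scale A w v"
proof -
  let ?S = "Poly_Mapping.keys u \<union> Poly_Mapping.keys w"
  show ?thesis
    by (simp add: lin_ext_superset[of ?S] Poly_Mapping.keys_add lookup_add scale_left_distrib sum.distrib)
qed

lemma lin_ext_neg [simp]: "lin_ext scale A (- u) v = - lin_ext scale A u v"
  by (simp add: lin_ext_def sum_negf)

lemma lin_ext_if: "lin_ext scale A (if b then u else w) v = (if b then lin_ext scale A u v else lin_ext scale A w v)"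
  by simp

end

text \<open>A module is regarded as a family of operators, one for each basis vector. The signs in the
  relations depend only on these basis vectors.\<close>

locale bms_ops = cvs scale for scale :: "complex \<Rightarrow> 'v::ab_group_add \<Rightarrow> 'v" (infixr "*s" 75) +
  fixes A :: "bms_basis \<Rightarrow> 'v \<Rightarrow> 'v"
  assumes A_lin: "lin_on UNIV UNIV (A x)"
    and A_bracket: "A x (A y v) = parity_sign (bms_parity x) (bms_parity y) *s A y (A x v)
      + lin_ext scale A (bms_basis_bracket x y) v"
begin

lemma A_add [simp]: "A x (u + v) = A x u + A x v"
  and A_scale [simp]: "A x (c *s v) = c *s A x v"
  using lin_onD[OF A_lin[of x]] by auto

lemma A_0 [simp]: "A x 0 = 0" using A_scale[of x 0 0] by simp

lemma A_neg [simp]: "A x (- v) = - A x v" using A_scale[of x "-1" v] by simp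

lemma A_diff [simp]: "A x (u - v) = A x u - A x v" using A_add[of x u "-v"] by simp

lemma LL: "A (bmsL m) (A (bmsL n) v) = A (bmsL n) (A (bmsL m) v) + of_int (m - n) *s A (bmsL (m + n)) v
    + (if m + n = 0 then (of_int (m ^ 3 - m) / 12) *s A bmsC1 v else 0)"
  using A_bracket[of "bmsL m" "bmsL n" v] by (simp add: parity_sign_def lin_ext_if)

lemma LI: "A (bmsL m) (A (bmsI n) v) = A (bmsI n) (A (bmsL m) v) + of_int (m - n) *s A (bmsI (m + n)) v
    + (if m + n = 0 then (of_int (m ^ 3 - m) / 12) *s A bmsC2 v else 0)"
  using A_bracket[of "bmsL m" "bmsI n" v] by (simp add: parity_sign_def lin_ext_if)

lemma LQ: "A (bmsL m) (A (bmsQ k) v) = A (bmsQ k) (A (bmsL m) v)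
    + (of_int m / 2 - (of_int k + 1/2)) *s A (bmsQ (m + k)) v"
  using A_bracket[of "bmsL m" "bmsQ k" v] by (simp add: parity_sign_def)

lemma QQ: "A (bmsQ k) (A (bmsQ l) v) = - A (bmsQ l) (A (bmsQ k) v) + 2 *s A (bmsI (k + l + 1)) v
    + (if k + l + 1 = 0 then (((of_int k + 1/2) ^ 2 - 1/4) / 3) *s A bmsC2 v else 0)"
  using A_bracket[of "bmsQ k" "bmsQ l" v] by (simp add: parity_sign_def lin_ext_if)

lemma II: "A (bmsI m) (A (bmsI n) v) = A (bmsI n) (A (bmsI m) v)"
  using A_bracket[of "bmsI m" "bmsI n" v] by (simp add: parity_sign_def)

lemma C1_central: "A bmsC1 (A x v) = A x (A bmsC1 v)"
  using A_bracket[of bmsC1 x v] by (cases x) (simp_all add: parity_sign_def)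

lemma L0_A: "A (bmsL 0) (A x v) = A x (A (bmsL 0) v) - (of_int (deg2 x) / 2) *s A x v"
proof (cases x)
  case (bmsQ k)
  have "of_int (deg2 (bmsQ k)) / 2 = (of_int k + 1/2 :: complex)" by (simp add: field_simps)
  moreover have "of_int 0 / 2 - (of_int k + 1/2) = - (of_int k + 1/2 :: complex)" by simp
  ultimately show ?thesis using LQ[of 0 k v] bmsQ by (simp only: scale_minus_left add_0) simp
next
  case (bmsL k)
  then show ?thesis using LL[of 0 k v] by simp
next
  case (bmsI k)
  then show ?thesis using LI[of 0 k v] by simp
qed (use A_bracket[of "bmsL 0" x v] in \<open>simp_all add: parity_sign_def\<close>)

text \<open>The sign makes \<open>L\<^sub>k\<close> raise the weight by \<open>k\<close>.\<close>

definition wt :: "complex \<Rightarrow> 'v set" where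
  "wt s = {v. A (bmsL 0) v = (- s) *s v}"

lemma wt_subspace: "subspace (wt s)"
  by (auto simp: wt_def subspace_def scale_right_distrib mult.commute)

lemma A_wt: "v \<in> wt s \<Longrightarrow> A x v \<in> wt (s + of_int (deg2 x) / 2)"
  by (simp add: wt_def L0_A scale_left_distrib scale_left_diff_distrib algebra_simps)

text \<open>The bracket of \<open>L\<^sub>1\<close> and \<open>x\<close> is \<open>upc x\<close> times \<open>up x\<close>.\<close>

fun up :: "bms_basis \<Rightarrow> bms_basis" where
  "up (bmsL k) = bmsL (k + 1)"
| "up (bmsI k) = bmsI (k + 1)"
| "up (bmsQ k) = bmsQ (k + 1)"
| "up c = c"

fun upc :: "bms_basis \<Rightarrow> complex" where
  "upc (bmsL k) = of_int (1 - k)"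
| "upc (bmsI k) = of_int (1 - k)"
| "upc (bmsQ k) = of_int (- k)"
| "upc c = 0"

lemma L1_A: "A (bmsL 1) (A x v) = A x (A (bmsL 1) v) + upc x *s A (up x) v"
proof (cases x)
  case (bmsL k)
  then show ?thesis using LL[of 1 k v] by (simp add: add.commute)
next
  case (bmsI k)
  then show ?thesis using LI[of 1 k v] by (simp add: add.commute)
next
  case (bmsQ k)
  then show ?thesis using LQ[of 1 k v] by (simp add: add.commute)
next
  case bmsC1
  then show ?thesis using A_bracket[of "bmsL 1" x v] by (simp add: parity_sign_def)
next
  case bmsC2
  then show ?thesis using A_bracket[of "bmsL 1" x v] by (simp add: parity_sign_def)
qed

end

section \<open>Identifying the weight spaces through \<open>L\<^sub>1\<close>\<close>

text \<open>The elements from which finitely many brackets with \<open>L\<^sub>1\<close> lead to \<open>0\<close>. These are the ones that will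
  depend polynomially on the weight.\<close>

fun low :: "bms_basis \<Rightarrow> bool" where
  "low (bmsL k) \<longleftrightarrow> k \<le> 1"
| "low (bmsI k) \<longleftrightarrow> k \<le> 1"
| "low (bmsQ k) \<longleftrightarrow> k \<le> 0"
| "low _ \<longleftrightarrow> True"

lemma low_aux: "k \<le> 1 \<Longrightarrow> j \<le> 0 \<Longrightarrow> complex_of_int k \<noteq> complex_of_int j * 2 + 1 \<Longrightarrow> k + j \<le> 0"
  by (cases "k = 1 \<and> j = 0") auto

lemma low_bracket:
  "low x \<Longrightarrow> low y \<Longrightarrow> \<beta> \<in> Poly_Mapping.keys (bms_basis_bracket x y) \<Longrightarrow> low \<beta>"
  by (cases x; cases y)
    (auto simp: in_keys_iff lookup_add lookup_minus lookup_uminus lookup_single when_def split: if_splits dest: low_aux)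

text \<open>The weight spaces under consideration have the weights \<open>l + h/2\<close> with integers \<open>h \<ge> 0\<close>. The integer
  \<open>h\<close> is called the position. According to its parity, the space at position \<open>h\<close> is identified by
  \<open>tau h\<close>, a power of \<open>L\<^sub>1\<close>, with the space \<open>F h\<close> at position \<open>0\<close> or \<open>1\<close>.\<close>

locale bms_gauge = bms_ops +
  fixes l :: complex
  assumes fin0: "\<exists>B. finite B \<and> span B = wt l"
    and fin1: "\<exists>B. finite B \<and> span B = wt (l + 1/2)"
    and bij0: "\<And>h::int. h \<ge> 0 \<Longrightarrow> bij_betw (A (bmsL 1)) (wt (l + of_int h / 2)) (wt (l + of_int h / 2 + 1))"
begin

definition F :: "int \<Rightarrow> 'a set" where
  "F p = wt (l + of_int (p mod 2) / 2)"

definition tau :: "int \<Rightarrow> 'a \<Rightarrow> 'a" where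
  "tau h v = (A (bmsL 1) ^^ nat (h div 2)) v"

lemma F_subspace: "subspace (F p)"
  by (simp add: F_def wt_subspace)

lemma F_cong: "p mod 2 = p' mod 2 \<Longrightarrow> F p = F p'"
  by (simp add: F_def)

lemma F_basis:
  obtains B where "finite B" "independent B" "span B = F p"
proof -
  have "\<exists>B. finite B \<and> span B = F p"
    using fin0 fin1 by (cases "p mod 2 = 0") (auto simp: F_def)
  then obtain B where B: "finite B" "span B = F p" by blast
  obtain B' where B': "B' \<subseteq> F p" "independent B'" "F p \<subseteq> span B'"
    using maximal_independent_subset[of "F p"] by blast
  have "finite B'" using independent_span_bound[OF B(1) B'(2)] B'(1) B(2) by auto
  moreover have "span B' = F p" using B' F_subspace by (simp add: span_minimal subset_antisym)
  ultimately show ?thesis using that B'(2) by blast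
qed

lemma tau_Suc: "h \<ge> 0 \<Longrightarrow> tau (h + 2) v = A (bmsL 1) (tau h v)"
proof -
  assume "h \<ge> 0"
  then have "nat ((h + 2) div 2) = Suc (nat (h div 2))" by simp
  then show ?thesis by (simp only: tau_def funpow.simps comp_def)
qed

lemma tau_bij: "h \<ge> 0 \<Longrightarrow> bij_betw (tau h) (F h) (wt (l + of_int h / 2))"
proof (induction "nat h" arbitrary: h rule: less_induct)
  case less
  show ?case
  proof (cases "h < 2")
    case True
    then have "h div 2 = 0" "h mod 2 = h" using less.prems by auto
    then show ?thesis by (simp add: tau_def[abs_def] F_def bij_betw_def inj_on_def)
  next
    case False
    define k where "k = h - 2"
    have k: "h = k + 2" "k \<ge> 0" using False by (auto simp: k_def)
    have "bij_betw (tau k) (F k) (wt (l + of_int k / 2))" using less.hyps[of k] k by auto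
    from bij_betw_trans[OF this bij0[OF k(2)]]
    have "bij_betw (A (bmsL 1) \<circ> tau k) (F k) (wt (l + of_int k / 2 + 1))" .
    moreover have "A (bmsL 1) \<circ> tau k = tau h" using tau_Suc[OF k(2)] k(1) by auto
    moreover have "F h = F k" by (rule F_cong) (simp add: k)
    moreover have "l + of_int h / 2 = l + of_int k / 2 + 1" by (simp add: k add_divide_distrib)
    ultimately show ?thesis by metis
  qed
qed

lemma tau_in: "h \<ge> 0 \<Longrightarrow> h mod 2 = p mod 2 \<Longrightarrow> w \<in> F p \<Longrightarrow> tau h w \<in> wt (l + of_int h / 2)"
  using bij_betwE[OF tau_bij[of h]] F_cong[of h p] by blast

lemma tau_inj:
  assumes "h \<ge> 0" "h mod 2 = p mod 2" "u \<in> F p" "w \<in> F p" "tau h u = tau h w"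
  shows "u = w"
  using bij_betw_imp_inj_on[OF tau_bij[OF assms(1)]] assms F_cong[OF assms(2)] by (simp add: inj_on_def)

lemma tau_add [simp]: "tau h (u + v) = tau h u + tau h v"
proof -
  have "(A (bmsL 1) ^^ n) (u + v) = (A (bmsL 1) ^^ n) u + (A (bmsL 1) ^^ n) v" for n
    by (induction n) auto
  then show ?thesis by (simp add: tau_def)
qed

lemma tau_scale [simp]: "tau h (c *s v) = c *s tau h v"
proof -
  have "(A (bmsL 1) ^^ n) (c *s v) = c *s (A (bmsL 1) ^^ n) v" for n
    by (induction n) auto
  then show ?thesis by (simp add: tau_def)
qed

lemma tau_0 [simp]: "tau h 0 = 0" using tau_scale[of h 0 0] by simp

lemma tau_neg [simp]: "tau h (- v) = - tau h v" using tau_scale[of h "-1" v] by simp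

lemma tau_diff [simp]: "tau h (u - v) = tau h u - tau h v" using tau_add[of h u "-v"] by simp

lemma tau_sum: "tau h (\<Sum>i\<in>I. f i) = (\<Sum>i\<in>I. tau h (f i))"
  by (induction I rule: infinite_finite_induct) auto

definition untau :: "int \<Rightarrow> 'a \<Rightarrow> 'a" where
  "untau h v = (THE w. w \<in> F h \<and> tau h w = v)"

lemma untau:
  assumes "h \<ge> 0" "v \<in> wt (l + of_int h / 2)" "h mod 2 = p mod 2"
  shows "untau h v \<in> F p" "tau h (untau h v) = v"
proof -
  have "v \<in> tau h ` F h" using bij_betw_imp_surj_on[OF tau_bij[OF assms(1)]] assms(2) by simp
  then obtain w where w: "w \<in> F h" "tau h w = v" by blast
  have "\<exists>!w. w \<in> F h \<and> tau h w = v"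
    by (rule ex1I[of _ w]) (use w inj_onD[OF bij_betw_imp_inj_on[OF tau_bij[OF assms(1)]]] in auto)
  from theI'[OF this, folded untau_def] F_cong[OF assms(3)]
  show "untau h v \<in> F p" "tau h (untau h v) = v" by simp_all
qed

text \<open>The value \<open>f h\<close> is the vector that corresponds to \<open>x w\<close>, where \<open>w\<close> is placed at position \<open>h\<close>. The
  condition concerns the positions for which both \<open>h\<close> and the target \<open>h + deg2 x\<close> are nonnegative.\<close>

definition gauged :: "bms_basis \<Rightarrow> int \<Rightarrow> 'a \<Rightarrow> (complex \<Rightarrow> 'a) \<Rightarrow> bool" where
  "gauged x p w f \<longleftrightarrow> vpoly f \<and> (\<forall>h. h mod 2 = p mod 2 \<longrightarrow> 0 \<le> h \<longrightarrow> 0 \<le> h + deg2 x \<longrightarrow>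
     f (of_int h) \<in> F (p + deg2 x) \<and> tau (h + deg2 x) (f (of_int h)) = A x (tau h w))"

lemma A_tau_wt: "h mod 2 = p mod 2 \<Longrightarrow> 0 \<le> h \<Longrightarrow> w \<in> F p \<Longrightarrow> A x (tau h w) \<in> wt (l + of_int (h + deg2 x) / 2)"
  using A_wt[OF tau_in[of h p w], of x] by (simp add: add_divide_distrib algebra_simps)

lemma mod2_add: "(h::int) mod 2 = p mod 2 \<Longrightarrow> (h + d) mod 2 = (p + d) mod 2"
  by (metis mod_add_left_eq)

lemma deg2_up: "upc x \<noteq> 0 \<Longrightarrow> deg2 (up x) = deg2 x + 2"
  by (cases x) auto

lemma low_up: "low x \<Longrightarrow> upc x \<noteq> 0 \<Longrightarrow> low (up x)"
  by (cases x) auto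

text \<open>As \<open>L\<^sub>1\<close> is the identity in this identification, \<open>[L\<^sub>1, x]\<close> is the difference of the values of
  \<open>x\<close> at the positions \<open>h\<close> and \<open>h + 2\<close>. If this difference is polynomial in \<open>h\<close>, then so is \<open>x\<close>.\<close>

lemma gauged_step:
  assumes w: "w \<in> F p" and f: "upc x \<noteq> 0 \<Longrightarrow> gauged (up x) p w f"
  shows "\<exists>g. gauged x p w g"
proof -
  let ?d = "deg2 x"
  have ex: "p mod 2 + 2 * int (nat \<bar>?d\<bar>) + ?d \<ge> 0" by simp
  \<comment> \<open>\<open>p mod 2 + 2 m0\<close> is the first position at which both conditions of \<open>gauged\<close> hold.\<close>
  define m0 where "m0 = (LEAST m::nat. p mod 2 + 2 * int m + ?d \<ge> 0)"
  have m0: "p mod 2 + 2 * int m0 + ?d \<ge> 0" unfolding m0_def by (rule LeastI) (rule ex)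
  have m0_le: "m0 \<le> m" if "p mod 2 + 2 * int m + ?d \<ge> 0" for m
    unfolding m0_def by (rule Least_le) (rule that)
  define h where "h n = p mod 2 + 2 * int m0 + 2 * int n" for n
  have h: "h n mod 2 = p mod 2" "0 \<le> h n" "0 \<le> h n + ?d" "h (Suc n) = h n + 2" for n
    using m0 by (auto simp: h_def)
  define g where "g n = untau (h n + ?d) (A x (tau (h n) w))" for n
  have g: "g n \<in> F (p + ?d)" "tau (h n + ?d) (g n) = A x (tau (h n) w)" for n
    unfolding g_def
    by (rule untau[OF h(3) A_tau_wt[OF h(1,2) w] mod2_add[OF h(1)]])+
  define f' where "f' z = (if upc x = 0 then 0 else (- upc x) *s f z)" for z
  have f': "vpoly f'"
    using f vpoly_smult[of f "- upc x"] vpoly.const[of 0]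
    by (cases "upc x = 0") (auto simp: f'_def[abs_def] gauged_def)
  have "g (Suc n) = g n + f' (of_int (h 0) + 2 * of_nat n)" for n
  proof -
    have hn: "complex_of_int (h 0) + 2 * of_nat n = of_int (h n)" by (simp add: h_def)
    have fn: "f' (of_int (h n)) \<in> F (p + ?d) \<and>
       tau (h n + ?d + 2) (f' (of_int (h n))) = (- upc x) *s A (up x) (tau (h n) w)"
    proof (cases "upc x = 0")
      case True
      then show ?thesis using subspace_0[OF F_subspace] by (simp add: f'_def)
    next
      case False
      have d: "deg2 (up x) = ?d + 2" by (rule deg2_up[OF False])
      have F: "F (p + (?d + 2)) = F (p + ?d)" by (rule F_cong) presburger
      have "0 \<le> h n + (?d + 2)" using h(3)[of n] by simp
      with f[OF False] h(1,2)[of n]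
      have "f (of_int (h n)) \<in> F (p + ?d)" "tau (h n + (?d + 2)) (f (of_int (h n))) = A (up x) (tau (h n) w)"
        unfolding gauged_def d F by blast+
      then show ?thesis using False subspace_scale[OF F_subspace] subspace_neg[OF F_subspace]
        by (simp add: f'_def add.assoc)
    qed
    have "tau (h (Suc n) + ?d) (g (Suc n)) = A x (tau (h (Suc n)) w)" by (rule g(2))
    also have "\<dots> = A x (A (bmsL 1) (tau (h n) w))" by (simp only: h(4) tau_Suc[OF h(2)])
    also have "\<dots> = A (bmsL 1) (A x (tau (h n) w)) + (- upc x) *s A (up x) (tau (h n) w)"
      by (simp add: L1_A)
    also have "\<dots> = tau (h n + ?d + 2) (g n) + tau (h n + ?d + 2) (f' (of_int (h n)))"
      using fn unfolding g(2)[symmetric] tau_Suc[OF h(3)] by simp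
    also have "\<dots> = tau (h (Suc n) + ?d) (g n + f' (of_int (h n)))"
      by (simp add: h(4) algebra_simps)
    finally have "g (Suc n) = g n + f' (of_int (h n))"
      by (intro tau_inj[OF h(3) mod2_add[OF h(1)] g(1)])
        (use g(1) fn subspace_add[OF F_subspace] in auto)
    then show ?thesis by (simp only: hn)
  qed
  from vpoly_antidifference[OF f' this] obtain G where G: "vpoly G"
    "\<And>n. G (of_int (h 0) + 2 * of_nat n) = g n" by blast
  have "gauged x p w G"
    unfolding gauged_def
  proof (intro conjI allI impI G(1))
    fix k assume k: "k mod 2 = p mod 2" "0 \<le> k" "0 \<le> k + ?d"
    define m where "m = nat (k div 2)"
    have km: "k = p mod 2 + 2 * int m" using k mod_mult_div_eq[of k 2] by (simp add: m_def)
    then have "m0 \<le> m" using k(3) by (intro m0_le) simp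
    then obtain n where n: "m = m0 + n" using le_Suc_ex by blast
    have "k = h n" by (simp add: km n h_def)
    moreover have "complex_of_int (h 0) + 2 * of_nat n = of_int (h n)" by (simp add: h_def)
    ultimately have "G (of_int k) = g n" using G(2)[of n] by simp
    then show "G (of_int k) \<in> F (p + ?d)" "tau (k + ?d) (G (of_int k)) = A x (tau k w)"
      using g \<open>k = h n\<close> by auto
  qed
  then show ?thesis by blast
qed

lemma gauged_exists:
  assumes "low x" "w \<in> F p" shows "\<exists>f. gauged x p w f"
proof -
  define depth where "depth x = (case x of bmsL k \<Rightarrow> nat (1 - k) | bmsI k \<Rightarrow> nat (1 - k) | bmsQ k \<Rightarrow> nat (- k) | _ \<Rightarrow> 0)" for x
  show ?thesis
    using assms
  proof (induction "depth x" arbitrary: x rule: less_induct)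
    case less
    have "\<exists>f. gauged (up x) p w f" if "upc x \<noteq> 0"
    proof (rule less.hyps)
      show "depth (up x) < depth x" using that less.prems(1) by (cases x) (auto simp: depth_def)
      show "low (up x)" using low_up[OF less.prems(1) that] .
    qed (rule less.prems)
    then show ?case using gauged_step[OF less.prems(2)] by blast
  qed
qed

lemma infinite_positions: "infinite {z::complex. \<exists>h. N \<le> h \<and> h mod 2 = p mod 2 \<and> z = of_int h}"
proof
  assume fin: "finite {z::complex. \<exists>h. N \<le> h \<and> h mod 2 = p mod 2 \<and> z = of_int h}"
  have "{z::complex. \<exists>n::nat. n \<ge> 0 \<and> z = of_int (p mod 2 + 2 * \<bar>N\<bar>) + 2 * of_nat n}
      \<subseteq> {z. \<exists>h. N \<le> h \<and> h mod 2 = p mod 2 \<and> z = of_int h}" (is "?S \<subseteq> _")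
  proof
    fix z assume "z \<in> ?S"
    then obtain n :: nat where "z = of_int (p mod 2 + 2 * \<bar>N\<bar>) + 2 * of_nat n" by blast
    then have "z = of_int (p mod 2 + 2 * \<bar>N\<bar> + 2 * int n)" by simp
    moreover have "N \<le> p mod 2 + 2 * \<bar>N\<bar> + 2 * int n" using pos_mod_sign[of 2 p] by linarith
    moreover have "(p mod 2 + 2 * \<bar>N\<bar> + 2 * int n) mod 2 = p mod 2" by presburger
    ultimately show "z \<in> {z. \<exists>h. N \<le> h \<and> h mod 2 = p mod 2 \<and> z = of_int h}" by blast
  qed
  with fin infinite_progression show False using finite_subset by blast
qed

lemma gauged_eqI:
  assumes f: "gauged x p w f" and g: "vpoly g"
    and eq: "\<And>h. h mod 2 = p mod 2 \<Longrightarrow> N \<le> h \<Longrightarrow> 0 \<le> h \<Longrightarrow> 0 \<le> h + deg2 x \<Longrightarrow>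
      g (of_int h) \<in> F (p + deg2 x) \<and> tau (h + deg2 x) (g (of_int h)) = A x (tau h w)"
  shows "f z = g z"
proof (rule vpoly_eq[OF _ g infinite_positions[of "max N (max 0 (- deg2 x))" p]])
  show "vpoly f" using f by (simp add: gauged_def)
  fix z :: complex assume "z \<in> {z. \<exists>h. max N (max 0 (- deg2 x)) \<le> h \<and> h mod 2 = p mod 2 \<and> z = of_int h}"
  then obtain h where h: "N \<le> h" "0 \<le> h" "0 \<le> h + deg2 x" "h mod 2 = p mod 2" "z = of_int h" by auto
  from f h have "f (of_int h) \<in> F (p + deg2 x)" "tau (h + deg2 x) (f (of_int h)) = A x (tau h w)"
    unfolding gauged_def by blast+
  then show "f z = g z"
    using eq[OF h(4,1,2,3)] tau_inj[OF h(3) mod2_add[OF h(4)]] h(5) by metis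
qed

text \<open>The operator \<open>x\<close> at the complex position \<open>z\<close>, as a map from \<open>F p\<close> to \<open>F (p + deg2 x)\<close>.\<close>

definition T :: "bms_basis \<Rightarrow> int \<Rightarrow> complex \<Rightarrow> 'a \<Rightarrow> 'a" where
  "T x p z w = (SOME f. gauged x p w f) z"

lemma T_gauged: "low x \<Longrightarrow> w \<in> F p \<Longrightarrow> gauged x p w (\<lambda>z. T x p z w)"
  unfolding T_def using someI_ex[OF gauged_exists[of x w p]] by simp

lemma T_vpoly: "low x \<Longrightarrow> w \<in> F p \<Longrightarrow> vpoly (\<lambda>z. T x p z w)"
  using T_gauged by (auto simp: gauged_def)

lemma T_tau:
  assumes "low x" "w \<in> F p" "h mod 2 = p mod 2" "0 \<le> h" "0 \<le> h + deg2 x"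
  shows "tau (h + deg2 x) (T x p (of_int h) w) = A x (tau h w)"
  using T_gauged[OF assms(1,2)] assms(3-) by (auto simp: gauged_def)

lemma T_in:
  assumes "low x" "w \<in> F p" shows "T x p z w \<in> F (p + deg2 x)"
proof (rule vpoly_in_subspace[OF T_vpoly[OF assms] F_subspace infinite_positions[of "max 0 (- deg2 x)" p]])
  fix z :: complex assume "z \<in> {z. \<exists>h. max 0 (- deg2 x) \<le> h \<and> h mod 2 = p mod 2 \<and> z = of_int h}"
  then obtain h where h: "0 \<le> h" "0 \<le> h + deg2 x" "h mod 2 = p mod 2" "z = of_int h" by auto
  with T_gauged[OF assms] show "T x p z w \<in> F (p + deg2 x)" by (auto simp: gauged_def)
qed

lemma T_eqI:
  assumes x: "low x" and w: "w \<in> F p" and g: "vpoly g" "\<And>z. g z \<in> F (p + deg2 x)"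
    and eq: "\<And>h. h mod 2 = p mod 2 \<Longrightarrow> N \<le> h \<Longrightarrow> 0 \<le> h \<Longrightarrow> 0 \<le> h + deg2 x \<Longrightarrow>
      tau (h + deg2 x) (g (of_int h)) = A x (tau h w)"
  shows "T x p z w = g z"
  by (rule gauged_eqI[OF T_gauged[OF x w] g(1), of N]) (use g(2) eq in auto)

lemma T_cong:
  assumes "p mod 2 = p' mod 2" shows "T x p = T x p'"
proof -
  have "F (p + d) = F (p' + d)" for d by (rule F_cong) (rule mod2_add[OF assms])
  then have "gauged x p w = gauged x p' w" for w
    unfolding gauged_def using assms by simp
  then show ?thesis by (simp add: T_def fun_eq_iff)
qed

lemma T_lin:
  assumes x: "low x" shows "lin_on (F p) (F (p + deg2 x)) (T x p z)"
  unfolding lin_on_def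
proof (intro conjI ballI allI)
  fix u v c assume u: "u \<in> F p" and v: "v \<in> F p"
  show "T x p z u \<in> F (p + deg2 x)" by (rule T_in[OF x u])
  show "T x p z (u + v) = T x p z u + T x p z v"
    by (rule T_eqI[where N = 0])
      (auto intro!: x subspace_add[OF F_subspace] u v vpoly.add T_vpoly T_in simp: T_tau[OF x u] T_tau[OF x v])
next
  fix c u assume u: "u \<in> F p"
  show "T x p z (c *s u) = c *s T x p z u"
    by (rule T_eqI[where N = 0])
      (auto intro!: x subspace_scale[OF F_subspace] u vpoly_smult T_vpoly T_in simp: T_tau[OF x u])
qed

lemma T_shift:
  assumes x: "low x" and w: "w \<in> F p"
  shows "T x p (z + 2) w = T x p z w - upc x *s T (up x) p z w"
proof -
  have up: "upc x = 0 \<or> low (up x)" using low_up[OF x] by blast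
  have F2: "F (p + deg2 (up x)) = F (p + deg2 x)" if "upc x \<noteq> 0"
    by (rule F_cong) (use deg2_up[OF that] in presburger)
  let ?g = "\<lambda>z. T x p (z - 2) w - upc x *s T (up x) p (z - 2) w"
  have "T x p (z + 2) w = ?g (z + 2)"
  proof (rule T_eqI[OF x w, where N = "2 + \<bar>deg2 x\<bar>"])
    have "vpoly (\<lambda>z. upc x *s T (up x) p z w)"
      using up T_vpoly[of "up x", OF _ w] vpoly_smult vpoly.const[of 0] by (cases "upc x = 0") auto
    from vpoly_diff[OF T_vpoly[OF x w] this] show "vpoly ?g"
      using vpoly_shift[of "\<lambda>z. T x p z w - upc x *s T (up x) p z w" "-2"] by simp
    show "?g z \<in> F (p + deg2 x)" for z
      using up T_in[OF x w] T_in[of "up x", OF _ w] F2 subspace_0[OF F_subspace]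
      by (intro subspace_diff[OF F_subspace]) (cases "upc x = 0"; auto intro: subspace_scale[OF F_subspace])+
    fix h assume h: "h mod 2 = p mod 2" "2 + \<bar>deg2 x\<bar> \<le> h" "0 \<le> h" "0 \<le> h + deg2 x"
    define k where "k = h - 2"
    have k: "h = k + 2" "k mod 2 = p mod 2" "0 \<le> k" "0 \<le> k + deg2 x" using h by (auto simp: k_def)
    have "tau (h + deg2 x) (?g (of_int h)) = tau ((k + deg2 x) + 2) (T x p (of_int k) w)
        - upc x *s tau ((k + deg2 x) + 2) (T (up x) p (of_int k) w)"
      by (simp add: k(1) algebra_simps)
    also have "tau ((k + deg2 x) + 2) (T x p (of_int k) w) = A (bmsL 1) (A x (tau k w))"
      by (simp only: tau_Suc[OF k(4)] T_tau[OF x w k(2,3,4)])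
    also have "upc x *s tau ((k + deg2 x) + 2) (T (up x) p (of_int k) w) = upc x *s A (up x) (tau k w)"
    proof (cases "upc x = 0")
      case False
      have "0 \<le> k + deg2 (up x)" using k deg2_up[OF False] by simp
      from T_tau[OF low_up[OF x False] w k(2,3) this] show ?thesis
        by (simp add: deg2_up[OF False] add.assoc)
    qed simp
    also have "A (bmsL 1) (A x (tau k w)) - upc x *s A (up x) (tau k w) = A x (tau h w)"
      by (simp add: k(1) tau_Suc[OF k(3)] L1_A)
    finally show "tau (h + deg2 x) (?g (of_int h)) = A x (tau h w)" .
  qed
  then show ?thesis by simp
qed

lemma T_L1: "w \<in> F p \<Longrightarrow> T (bmsL 1) p z w = w"
  by (rule T_eqI[where N = 0]) (auto intro: vpoly.const simp: F_cong[of "p + 2" p] tau_Suc)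

lemma T_L0: "w \<in> F p \<Longrightarrow> T (bmsL 0) p z w = (- (l + z / 2)) *s w"
proof (rule T_eqI[where N = 0 and g = "\<lambda>z. (- (l + z / 2)) *s w"])
  assume w: "w \<in> F p"
  show "vpoly (\<lambda>z. (- (l + z / 2)) *s w)"
    using vpoly_poly_scale[OF vpoly.const[of w], of "[:- l, - 1/2:]"] by (simp add: algebra_simps)
  show "(- (l + z / 2)) *s w \<in> F (p + deg2 (bmsL 0))" for z
    using w subspace_scale[OF F_subspace, of w p] by (simp del: scale_minus_left)
  fix h assume "h mod 2 = p mod 2" "0 \<le> h"
  from tau_in[OF this(2,1) w]
  show "tau (h + deg2 (bmsL 0)) ((- (l + of_int h / 2)) *s w) = A (bmsL 0) (tau h w)"
    by (simp add: wt_def del: scale_minus_left)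
qed auto

text \<open>Both sides are polynomial in \<open>z\<close>, and at the large integral positions the relation is the one between
  the operators \<open>A x\<close> and \<open>A y\<close>.\<close>

lemma T_bracket:
  assumes x: "low x" and y: "low y" and w: "w \<in> F p"
  shows "T x (p + deg2 y) (z + of_int (deg2 y)) (T y p z w) =
    parity_sign (bms_parity x) (bms_parity y) *s T y (p + deg2 x) (z + of_int (deg2 x)) (T x p z w)
    + (\<Sum>\<beta>\<in>Poly_Mapping.keys (bms_basis_bracket x y).
        Poly_Mapping.lookup (bms_basis_bracket x y) \<beta> *s T \<beta> p z w)"
    (is "?l z = ?s *s ?r z + ?k z")
proof -
  let ?K = "Poly_Mapping.keys (bms_basis_bracket x y)"
  let ?d = "deg2 x" and ?e = "deg2 y"
  have low: "low \<beta>" "deg2 \<beta> = ?d + ?e" if "\<beta> \<in> ?K" for \<beta>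
    using low_bracket[OF x y that] deg2_bracket[OF that] by auto
  have vp: "vpoly (\<lambda>z. T a (p + deg2 b) (z + of_int (deg2 b)) (T b p z w))" if ab: "low a" "low b" for a b
    by (rule vpoly_family[where U = "F (p + deg2 b)" and W = "F (p + deg2 b + deg2 a)"])
      (use ab w in \<open>auto intro: T_vpoly T_in F_subspace T_lin vpoly_shift[OF T_vpoly]\<close>)
  show ?thesis
  proof (rule vpoly_eq[OF _ _ infinite_positions[of "\<bar>?d\<bar> + \<bar>?e\<bar>" p]])
    show "vpoly ?l" by (rule vp[OF x y])
    show "vpoly (\<lambda>z. ?s *s ?r z + ?k z)"
      by (intro vpoly.add vpoly_smult vp[OF y x] vpoly_sum T_vpoly low w)
    fix z :: complex assume "z \<in> {z. \<exists>h. \<bar>?d\<bar> + \<bar>?e\<bar> \<le> h \<and> h mod 2 = p mod 2 \<and> z = of_int h}"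
    then obtain h where h: "\<bar>?d\<bar> + \<bar>?e\<bar> \<le> h" "h mod 2 = p mod 2" "z = of_int h" by auto
    have two: "tau (h + (?d + ?e)) (T a (p + deg2 b) (z + of_int (deg2 b)) (T b p z w)) = A a (A b (tau h w))"
      if ab: "low a" "low b" "deg2 a + deg2 b = ?d + ?e" "0 \<le> h + deg2 b" for a b
    proof -
      have "tau (h + deg2 b + deg2 a) (T a (p + deg2 b) (of_int (h + deg2 b)) (T b p z w)) = A a (tau (h + deg2 b) (T b p z w))"
        using h ab by (intro T_tau T_in w mod2_add) auto
      also have "tau (h + deg2 b) (T b p z w) = A b (tau h w)"
        unfolding h(3) using h ab by (intro T_tau w) auto
      finally show ?thesis using ab(3) h(3) by (simp add: add.assoc add.commute[of "deg2 b"])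
    qed
    have "tau (h + (?d + ?e)) (?s *s ?r z + ?k z) = ?s *s A y (A x (tau h w)) +
       (\<Sum>\<beta>\<in>?K. Poly_Mapping.lookup (bms_basis_bracket x y) \<beta> *s A \<beta> (tau h w))"
    proof -
      have "tau (h + (?d + ?e)) (T \<beta> p z w) = A \<beta> (tau h w)" if "\<beta> \<in> ?K" for \<beta>
        using T_tau[OF low(1)[OF that] w h(2)] low(2)[OF that] h by simp
      then show ?thesis using two[OF y x] h by (simp add: tau_sum add.commute)
    qed
    also have "\<dots> = A x (A y (tau h w))"
      using A_bracket[of x y "tau h w"] by (simp add: lin_ext_def)
    also have "\<dots> = tau (h + (?d + ?e)) (?l z)" using two[OF x y] h by simp
    finally have eq: "tau (h + (?d + ?e)) (?l z) = tau (h + (?d + ?e)) (?s *s ?r z + ?k z)" by simp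
    have Fl: "?l z \<in> F (p + (?d + ?e))" using T_in[OF x T_in[OF y w]] by (simp add: add.assoc add.commute[of ?e])
    have Fr: "?s *s ?r z + ?k z \<in> F (p + (?d + ?e))"
      using T_in[OF y T_in[OF x w]] T_in[OF low(1) w] low(2)
      by (intro subspace_add[OF F_subspace] subspace_scale[OF F_subspace] subspace_sum[OF F_subspace])
        (auto simp: add.assoc)
    show "?l z = ?s *s ?r z + ?k z"
      by (rule tau_inj[OF _ mod2_add[OF h(2)] Fl Fr eq]) (use h in auto)
  qed
qed

end

context cvs
begin

lemma vpoly_affine: "vpoly f \<Longrightarrow> vpoly (\<lambda>z. f (a + z / 2))"
proof (induction rule: vpoly.induct)
  case (mult f)
  from vpoly_poly_scale[OF mult(2), of "[:a, 1/2:]"] show ?case by simp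
qed (auto intro: vpoly.intros)

lemma vpoly_poly: "vpoly (\<lambda>z. poly p z *s x)"
  by (rule vpoly_poly_scale[OF vpoly.const])

lemma vpoly_eq_by_steps:
  assumes f: "vpoly f" and g: "vpoly g" and 0: "f 0 = g 0"
    and step: "\<And>z. f (z + 2) - f z = g (z + 2) - g z"
  shows "f z = g z"
proof (rule vpoly_eq_progression[OF f g, of 0 0])
  fix n :: nat
  show "f (0 + 2 * of_nat n) = g (0 + 2 * of_nat n)"
  proof (induction n)
    case (Suc n)
    let ?z = "2 * of_nat n :: complex"
    have e: "0 + 2 * of_nat (Suc n) = ?z + 2" by simp
    have "f ?z = g ?z" using Suc by simp
    with step[of ?z] show ?case unfolding e by simp
  qed (simp add: 0)
qed

end

context bms_gauge
begin

lemma F_even [simp]: "F (p + 2 * k) = F p"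
  by (rule F_cong) simp

lemma F_even' [simp]: "F (p - 2) = F p" "F (p + 2) = F p" "F (p - 4) = F p" "F (p + 4) = F p"
  using F_even[of p "-1"] F_even[of p 1] F_even[of p "-2"] F_even[of p 2] by simp_all

lemma T_lin_even: "low x \<Longrightarrow> deg2 x = 2 * k \<Longrightarrow> lin_on (F p) (F p) (T x p z)"
  using T_lin[of x p z] by simp

text \<open>The constant terms of \<open>L\<^sub>-\<^sub>1\<close> and \<open>L\<^sub>-\<^sub>2\<close> as polynomials in the weight \<open>s = l + z/2\<close>. Since \<open>L\<^sub>1\<close> is the
  identity, \<open>Cop\<close> is the Casimir operator of the Lie algebra spanned by \<open>L\<^sub>-\<^sub>1\<close>, \<open>L\<^sub>0\<close> and \<open>L\<^sub>1\<close>.\<close>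

definition Cop :: "int \<Rightarrow> 'a \<Rightarrow> 'a" where
  "Cop p w = T (bmsL (-1)) p 0 w - (l ^ 2 - l) *s w"

definition Dop :: "int \<Rightarrow> 'a \<Rightarrow> 'a" where
  "Dop p w = - T (bmsL (-2)) p 0 w - (l ^ 3 - 3 * l ^ 2 + 2 * l) *s w - (3 * l) *s Cop p w"

lemma lin_on_comb:
  assumes "lin_on U U f" "lin_on U U g" "subspace U"
  shows "lin_on U U (\<lambda>w. a *s f w + b *s g w)"
  using lin_onD[OF assms(1)] lin_onD[OF assms(2)] assms(3)
  unfolding lin_on_def by (auto simp: subspace_def scale_right_distrib algebra_simps)

lemma lin_on_id: "lin_on U U (\<lambda>w. w)"
  by (simp add: lin_on_def)

lemma Cop_lin: "lin_on (F p) (F p) (Cop p)"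
proof -
  have "lin_on (F p) (F p) (\<lambda>w. 1 *s T (bmsL (-1)) p 0 w + (- (l ^ 2 - l)) *s w)"
    by (rule lin_on_comb[OF T_lin_even[of _ "-1"] lin_on_id F_subspace]) auto
  then show ?thesis by (simp add: Cop_def[abs_def] del: minus_diff_eq)
qed

lemma Dop_lin: "lin_on (F p) (F p) (Dop p)"
proof -
  have "lin_on (F p) (F p) (\<lambda>w. 1 *s ((-1) *s T (bmsL (-2)) p 0 w + (- (l ^ 3 - 3 * l ^ 2 + 2 * l)) *s w) + (- (3 * l)) *s Cop p w)"
    by (rule lin_on_comb[OF lin_on_comb[OF T_lin_even[of _ "-2"] lin_on_id F_subspace] Cop_lin F_subspace]) auto
  moreover have "(\<lambda>w. 1 *s ((-1) *s T (bmsL (-2)) p 0 w + (- (l ^ 3 - 3 * l ^ 2 + 2 * l)) *s w) + (- (3 * l)) *s Cop p w) = Dop p"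
    by (rule ext) (simp only: Dop_def scale_minus_left scale_one, simp)
  ultimately show ?thesis by simp
qed

text \<open>Both sides are polynomial with the same value at \<open>z = 0\<close>, and \<open>[L\<^sub>1, L\<^sub>-\<^sub>1] = 2 L\<^sub>0\<close> determines their
  differences. In the same way \<open>[L\<^sub>1, L\<^sub>-\<^sub>2] = 3 L\<^sub>-\<^sub>1\<close> determines \<open>L\<^sub>-\<^sub>2\<close> below.\<close>

lemma T_Lm1:
  assumes w: "w \<in> F p"
  shows "T (bmsL (-1)) p z w = ((l + z / 2) ^ 2 - (l + z / 2)) *s w + Cop p w"
proof (rule vpoly_eq_by_steps[where f = "\<lambda>z. T (bmsL (-1)) p z w"
      and g = "\<lambda>z. ((l + z / 2) ^ 2 - (l + z / 2)) *s w + Cop p w"])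
  show "vpoly (\<lambda>z. T (bmsL (-1)) p z w)" by (rule T_vpoly) (use w in auto)
  show "vpoly (\<lambda>z. ((l + z / 2) ^ 2 - (l + z / 2)) *s w + Cop p w)"
  proof -
    define S where "S = [:l, 1/2:]"
    have S: "poly S z = l + z / 2" for z by (simp add: S_def)
    from vpoly.add[OF vpoly_poly[of "S ^ 2 - S" w] vpoly.const[of "Cop p w"]]
    show ?thesis by (simp only: poly_diff poly_power S)
  qed
  fix z
  let ?s = "l + z / 2"
  have s: "l + (z + 2) / 2 = ?s + 1" by (simp add: add_divide_distrib)
  have "T (bmsL (-1)) p (z + 2) w - T (bmsL (-1)) p z w = (2 * ?s) *s w"
    using T_shift[of "bmsL (-1)" w p z] w by (simp add: T_L0 scale_minus_left[symmetric] del: scale_minus_left)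
  also have "2 * ?s = ((?s + 1) ^ 2 - (?s + 1)) - (?s ^ 2 - ?s)"
  proof -
    have "2 * s = ((s + 1) ^ 2 - (s + 1)) - (s ^ 2 - s)" for s :: complex
      by (simp add: power2_eq_square algebra_simps)
    then show ?thesis .
  qed
  finally show "T (bmsL (-1)) p (z + 2) w - T (bmsL (-1)) p z w =
    (((l + (z + 2) / 2) ^ 2 - (l + (z + 2) / 2)) *s w + Cop p w) - ((?s ^ 2 - ?s) *s w + Cop p w)"
    unfolding s by (simp only: add_diff_cancel_right scale_left_diff_distrib)
qed (simp add: Cop_def)

lemma T_Lm2:
  assumes w: "w \<in> F p"
  shows "T (bmsL (-2)) p z w = (- ((l + z / 2) ^ 3 - 3 * (l + z / 2) ^ 2 + 2 * (l + z / 2))) *s w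
    - (3 * (l + z / 2)) *s Cop p w - Dop p w"
proof (rule vpoly_eq_by_steps[where f = "\<lambda>z. T (bmsL (-2)) p z w"
      and g = "\<lambda>z. (- ((l + z / 2) ^ 3 - 3 * (l + z / 2) ^ 2 + 2 * (l + z / 2))) *s w
    - (3 * (l + z / 2)) *s Cop p w - Dop p w"])
  show "vpoly (\<lambda>z. T (bmsL (-2)) p z w)" by (rule T_vpoly) (use w in auto)
  show "vpoly (\<lambda>z. (- ((l + z / 2) ^ 3 - 3 * (l + z / 2) ^ 2 + 2 * (l + z / 2))) *s w
    - (3 * (l + z / 2)) *s Cop p w - Dop p w)"
  proof -
    define S where "S = [:l, 1/2:]"
    have S: "poly S z = l + z / 2" for z by (simp add: S_def)
    from vpoly_diff[OF vpoly_diff[OF vpoly_poly[of "- (S ^ 3 - 3 * S ^ 2 + 2 * S)" w]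
      vpoly_poly[of "3 * S" "Cop p w"]] vpoly.const[of "Dop p w"]]
    show ?thesis by (simp only: poly_diff poly_add poly_mult poly_minus poly_power poly_numeral S)
  qed
  fix z
  let ?s = "l + z / 2"
  have s: "l + (z + 2) / 2 = ?s + 1" by (simp add: add_divide_distrib)
  have "T (bmsL (-2)) p (z + 2) w - T (bmsL (-2)) p z w = (- 3) *s T (bmsL (-1)) p z w"
    using T_shift[of "bmsL (-2)" w p z] w by simp
  also have "\<dots> = (- 3 * (?s ^ 2 - ?s)) *s w - 3 *s Cop p w"
    by (simp add: T_Lm1[OF w] scale_right_distrib del: scale_minus_left) (simp add: algebra_simps)
  also have "- 3 * (?s ^ 2 - ?s) = - ((?s + 1) ^ 3 - 3 * (?s + 1) ^ 2 + 2 * (?s + 1)) - - (?s ^ 3 - 3 * ?s ^ 2 + 2 * ?s)"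
  proof -
    have "- 3 * (s ^ 2 - s) = - ((s + 1) ^ 3 - 3 * (s + 1) ^ 2 + 2 * (s + 1)) - - (s ^ 3 - 3 * s ^ 2 + 2 * s)" for s :: complex
      by (simp add: power2_eq_square power3_eq_cube algebra_simps)
    then show ?thesis .
  qed
  finally have "T (bmsL (-2)) p (z + 2) w - T (bmsL (-2)) p z w =
     (- ((?s + 1) ^ 3 - 3 * (?s + 1) ^ 2 + 2 * (?s + 1)) - - (?s ^ 3 - 3 * ?s ^ 2 + 2 * ?s)) *s w - 3 *s Cop p w" .
  moreover have "(3 * (?s + 1)) *s Cop p w = (3 * ?s) *s Cop p w + 3 *s Cop p w"
    by (simp add: distrib_left scale_left_distrib)
  ultimately show "T (bmsL (-2)) p (z + 2) w - T (bmsL (-2)) p z w =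
    ((- ((l + (z + 2) / 2) ^ 3 - 3 * (l + (z + 2) / 2) ^ 2 + 2 * (l + (z + 2) / 2))) *s w
      - (3 * (l + (z + 2) / 2)) *s Cop p w - Dop p w)
    - ((- (?s ^ 3 - 3 * ?s ^ 2 + 2 * ?s)) *s w - (3 * ?s) *s Cop p w - Dop p w)"
    unfolding s by (simp only: scale_left_diff_distrib) simp
qed (simp only: Dop_def scale_minus_left div_0 add_0_right, simp)

lemma T_Lm1_twice:
  assumes w: "w \<in> F p"
  shows "T (bmsL (-1)) p z (T (bmsL (-1)) p y w) =
    (((l + z / 2) ^ 2 - (l + z / 2)) * ((l + y / 2) ^ 2 - (l + y / 2))) *s w
    + (((l + z / 2) ^ 2 - (l + z / 2)) + ((l + y / 2) ^ 2 - (l + y / 2))) *s Cop p w + Cop p (Cop p w)"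
proof -
  let ?a = "(l + z / 2) ^ 2 - (l + z / 2)" and ?b = "(l + y / 2) ^ 2 - (l + y / 2)"
  have C: "Cop p w \<in> F p" using lin_onD(1)[OF Cop_lin w] .
  have in1: "T (bmsL (-1)) p y w \<in> F p" using T_in[of "bmsL (-1)" w p] w by simp
  have "Cop p (T (bmsL (-1)) p y w) = ?b *s Cop p w + Cop p (Cop p w)"
    unfolding T_Lm1[OF w]
    using lin_onD[OF Cop_lin] w C subspace_scale[OF F_subspace] by simp
  then show ?thesis
    unfolding T_Lm1[OF in1] unfolding T_Lm1[OF w]
    by (simp only: scale_right_distrib scale_left_distrib scale_scale add.assoc)
qed

subsection \<open>The operator \<open>L\<^sub>2\<close> is rational\<close>

text \<open>The operator \<open>L\<^sub>2\<close> in the identification. The brackets of \<open>L\<^sub>1\<close> with \<open>L\<^sub>2, L\<^sub>3, \<dots>\<close> do not end, so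
  that it is only given at integral positions.\<close>

definition b2 :: "int \<Rightarrow> 'a \<Rightarrow> 'a" where
  "b2 h w = untau (h + 4) (A (bmsL 2) (tau h w))"

lemma b2:
  assumes "h mod 2 = p mod 2" "0 \<le> h" "w \<in> F p"
  shows "b2 h w \<in> F p" "tau (h + 4) (b2 h w) = A (bmsL 2) (tau h w)"
proof -
  have "A (bmsL 2) (tau h w) \<in> wt (l + of_int (h + 4) / 2)"
    using A_tau_wt[OF assms, of "bmsL 2"] by simp
  moreover have "(h + 4) mod 2 = p mod 2" using assms(1) by presburger
  ultimately show "b2 h w \<in> F p" "tau (h + 4) (b2 h w) = A (bmsL 2) (tau h w)"
    using untau[of "h + 4" _ p] assms(2) by (auto simp: b2_def)
qed

lemma b2_eqI:
  assumes "h mod 2 = p mod 2" "0 \<le> h" "w \<in> F p" "v \<in> F p" "tau (h + 4) v = A (bmsL 2) (tau h w)"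
  shows "b2 h w = v"
proof (rule tau_inj[of "h + 4" p])
  show "(h + 4) mod 2 = p mod 2" using assms(1) by presburger
qed (use assms b2[OF assms(1-3)] in auto)

lemma b2_lin: "h mod 2 = p mod 2 \<Longrightarrow> 0 \<le> h \<Longrightarrow> lin_on (F p) (F p) (b2 h)"
  unfolding lin_on_def
  by (intro conjI ballI allI)
    (auto intro!: b2 b2_eqI[of h p] simp: b2 subspace_add[OF F_subspace] subspace_scale[OF F_subspace])

text \<open>The bracket \<open>[L\<^sub>2, y]\<close> at the complex position \<open>z\<close>.\<close>

definition brk2 :: "bms_basis \<Rightarrow> int \<Rightarrow> complex \<Rightarrow> 'a \<Rightarrow> 'a" where
  "brk2 y p z w = (\<Sum>\<beta>\<in>Poly_Mapping.keys (bms_basis_bracket (bmsL 2) y).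
     Poly_Mapping.lookup (bms_basis_bracket (bmsL 2) y) \<beta> *s T \<beta> p z w)"

lemma brk2_in:
  assumes "\<And>\<beta>. \<beta> \<in> Poly_Mapping.keys (bms_basis_bracket (bmsL 2) y) \<Longrightarrow> low \<beta>" "w \<in> F p"
  shows "brk2 y p z w \<in> F (p + deg2 y)" "vpoly (\<lambda>z. brk2 y p z w)"
proof -
  have "T \<beta> p z w \<in> F (p + deg2 y)" if "\<beta> \<in> Poly_Mapping.keys (bms_basis_bracket (bmsL 2) y)" for \<beta>
    using T_in[OF assms(1)[OF that] assms(2), of z] F_even[of "p + deg2 y" 2] deg2_bracket[OF that]
    by (simp add: algebra_simps)
  then show "brk2 y p z w \<in> F (p + deg2 y)"
    unfolding brk2_def by (intro subspace_sum[OF F_subspace] subspace_scale[OF F_subspace])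
  show "vpoly (\<lambda>z. brk2 y p z w)"
    unfolding brk2_def by (intro vpoly_sum vpoly_smult T_vpoly assms)
qed

lemma b2_bracket:
  assumes y: "low y" "\<And>\<beta>. \<beta> \<in> Poly_Mapping.keys (bms_basis_bracket (bmsL 2) y) \<Longrightarrow> low \<beta>"
    and w: "w \<in> F p" and h: "h mod 2 = p mod 2" "0 \<le> h" "0 \<le> h + deg2 y"
  shows "b2 (h + deg2 y) (T y p (of_int h) w) =
     T y p (of_int h + 4) (b2 h w) + brk2 y p (of_int h) w"
proof (rule b2_eqI[of _ "p + deg2 y"])
  show "(h + deg2 y) mod 2 = (p + deg2 y) mod 2" by (rule mod2_add[OF h(1)])
  show "T y p (of_int h) w \<in> F (p + deg2 y)" by (rule T_in[OF y(1) w])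
  show "T y p (of_int h + 4) (b2 h w) + brk2 y p (of_int h) w \<in> F (p + deg2 y)"
    by (intro subspace_add[OF F_subspace] T_in y(1) b2 h w brk2_in y(2))
  have k: "tau (h + deg2 y + 4) (T \<beta> p (of_int h) w) = A \<beta> (tau h w)"
    if b: "\<beta> \<in> Poly_Mapping.keys (bms_basis_bracket (bmsL 2) y)" for \<beta>
    using T_tau[OF y(2)[OF b] w h(1,2)] deg2_bracket[OF b] h(3) by (simp add: algebra_simps)
  have "tau (h + 4 + deg2 y) (T y p (of_int (h + 4)) (b2 h w)) = A y (tau (h + 4) (b2 h w))"
    using h by (intro T_tau y b2 w) (auto, presburger)
  then have "tau (h + deg2 y + 4) (T y p (of_int h + 4) (b2 h w)) = A y (A (bmsL 2) (tau h w))"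
    using b2(2)[OF h(1,2) w] by (simp add: algebra_simps)
  moreover have "tau (h + deg2 y + 4) (brk2 y p (of_int h) w) = lin_ext scale A (bms_basis_bracket (bmsL 2) y) (tau h w)"
    unfolding brk2_def lin_ext_def tau_sum by (rule sum.cong) (auto simp: k)
  ultimately show "tau (h + deg2 y + 4) (T y p (of_int h + 4) (b2 h w) + brk2 y p (of_int h) w)
      = A (bmsL 2) (tau (h + deg2 y) (T y p (of_int h) w))"
    using A_bracket[of "bmsL 2" y "tau h w"] T_tau[OF y(1) w h] by (simp add: parity_sign_def)
qed (use h in auto)

lemma brk2_Lm1: "w \<in> F p \<Longrightarrow> brk2 (bmsL (-1)) p z w = 3 *s w"
  by (simp add: brk2_def T_L1)

lemma brk2_low:
  "\<beta> \<in> Poly_Mapping.keys (bms_basis_bracket (bmsL 2) (bmsL k)) \<Longrightarrow> k \<le> - 1 \<Longrightarrow> low \<beta>"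
  "\<beta> \<in> Poly_Mapping.keys (bms_basis_bracket (bmsL 2) (bmsI k)) \<Longrightarrow> k \<le> - 1 \<Longrightarrow> low \<beta>"
  "\<beta> \<in> Poly_Mapping.keys (bms_basis_bracket (bmsL 2) (bmsQ k)) \<Longrightarrow> k \<le> - 2 \<Longrightarrow> low \<beta>"
  by (auto simp: in_keys_iff lookup_add lookup_minus lookup_uminus lookup_single when_def split: if_splits)

lemma brk2_L_in:
  assumes "k \<le> -1" "w \<in> F p"
  shows "brk2 (bmsL k) p z w \<in> F p" "vpoly (\<lambda>z. brk2 (bmsL k) p z w)"
proof -
  have "brk2 (bmsL k) p z w \<in> F (p + deg2 (bmsL k))" "vpoly (\<lambda>z. brk2 (bmsL k) p z w)"
    by (rule brk2_in, erule brk2_low(1), rule assms, rule assms)+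
  then show "brk2 (bmsL k) p z w \<in> F p" "vpoly (\<lambda>z. brk2 (bmsL k) p z w)" by simp_all
qed

lemma b2_L:
  assumes "k \<le> -1" "w \<in> F p" "h mod 2 = p mod 2" "0 \<le> h" "0 \<le> h + 2 * k"
  shows "b2 (h + 2 * k) (T (bmsL k) p (of_int h) w) = T (bmsL k) p (of_int h + 4) (b2 h w) + brk2 (bmsL k) p (of_int h) w"
proof -
  have "b2 (h + deg2 (bmsL k)) (T (bmsL k) p (of_int h) w) = T (bmsL k) p (of_int h + 4) (b2 h w) + brk2 (bmsL k) p (of_int h) w"
    by (rule b2_bracket) (use assms brk2_low(1)[of _ k] in auto)
  then show ?thesis by simp
qed

text \<open>Writing \<open>u\<close> and \<open>v\<close> for \<open>L\<^sub>2\<close> at \<open>s - 2\<close> and at \<open>s\<close>, the commutators of \<open>L\<^sub>2\<close> with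
  \<open>L\<^sub>-\<^sub>1\<close> (used twice) and with \<open>L\<^sub>-\<^sub>2\<close> are the two equations of the linear system solved above.\<close>

lemma b2_rational_at:
  "\<exists>q::complex poly. q \<noteq> 0 \<and> (\<forall>w\<in>F p. \<exists>f. vpoly f \<and>
     (\<forall>h. h mod 2 = p mod 2 \<longrightarrow> 4 \<le> h \<longrightarrow> f (of_int h) = poly q (of_int h) *s b2 h w))"
proof -
  obtain B where B: "finite B" "independent B" "span B = F p" using F_basis by blast
  let ?C = "Cop p" and ?D = "Dop p"
  define crd where "crd b w = representation B w b" for b w
  have expand: "w = (\<Sum>b\<in>B. crd b w *s b)" if "w \<in> F p" for w
    using sum_representation_eq[OF B(2) _ B(1) order_refl, of w] that B(3) by (simp add: crd_def)
  have BF: "b \<in> F p" if "b \<in> B" for b using that B(3) span_base by blast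
  note CF = lin_onD(1)[OF Cop_lin] and DF = lin_onD(1)[OF Dop_lin]
  have C: "lin_on (span B) (span B) ?C" and D: "lin_on (span B) (span B) ?D"
    using Cop_lin Dop_lin B(3) by auto
  from solve_pair_system_vec[OF B(1) B(1,2) C D, of "\<lambda>x y. crd y (?C x)" "\<lambda>x y. crd y (?C (?C x))" "\<lambda>x y. crd y (?D x)"]
  obtain q R1 R2 where q: "q \<noteq> 0"
    and R_lin: "\<forall>x y s. lin_on (F p) (F p) (R1 x y s) \<and> lin_on (F p) (F p) (R2 x y s)"
    and R_vpoly: "\<forall>x y. \<forall>w\<in>F p. vpoly (\<lambda>s. R1 x y s w) \<and> vpoly (\<lambda>s. R2 x y s w)"
    and main: "\<forall>s u v r1 r2. (\<forall>x\<in>B. u x \<in> F p \<and> v x \<in> F p \<and> r1 x \<in> F p \<and> r2 x \<in> F p) \<longrightarrow>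
     (\<forall>x\<in>B. (s^4 - 4 * s^3 + 5 * s^2 - 2 * s) *s u x + (2 * s^2 - 4 * s + 2) *s (\<Sum>y\<in>B. crd y (?C x) *s u y) + (\<Sum>y\<in>B. crd y (?C (?C x)) *s u y)
        = (s^4 + 4 * s^3 + 5 * s^2 + 2 * s) *s v x + (2 * s^2 + 4 * s + 2) *s ?C (v x) + ?C (?C (v x)) + r1 x) \<longrightarrow>
     (\<forall>x\<in>B. (- (s^3 - 3 * s^2 + 2 * s)) *s u x - (3 * s) *s (\<Sum>y\<in>B. crd y (?C x) *s u y) - (\<Sum>y\<in>B. crd y (?D x) *s u y)
        = (- (s^3 + 3 * s^2 + 2 * s)) *s v x - (3 * (s + 2)) *s ?C (v x) - ?D (v x) + r2 x) \<longrightarrow>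
     (\<forall>x\<in>B. poly q s *s v x = (\<Sum>y\<in>B. R1 x y s (r1 y) + R2 x y s (r2 y)))"
    unfolding B(3) by (elim exE conjE) (rule that)
  have Rl: "lin_on (F p) (F p) (R1 x y s)" "lin_on (F p) (F p) (R2 x y s)" for x y s
    using R_lin by auto
  have Rv: "vpoly (\<lambda>s. R1 x y s w)" "vpoly (\<lambda>s. R2 x y s w)" if "w \<in> F p" for x y w
    using R_vpoly that by auto
  define r1 where "r1 z x = 3 *s T (bmsL (-1)) p (z + 2) x + 3 *s T (bmsL (-1)) p z x" for z x
  define r2 where "r2 z x = brk2 (bmsL (-2)) p z x" for z x
  have r1: "r1 z x \<in> F p" "vpoly (\<lambda>z. r1 z x)" if "x \<in> F p" for z x
  proof -
    have t: "T (bmsL (-1)) p z x \<in> F p" for z using T_in[of "bmsL (-1)" x p z] that by simp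
    then show "r1 z x \<in> F p" unfolding r1_def
      by (intro subspace_add[OF F_subspace] subspace_scale[OF F_subspace])
    show "vpoly (\<lambda>z. r1 z x)" unfolding r1_def
      using T_vpoly[of "bmsL (-1)" x p] that by (intro vpoly.add vpoly_smult vpoly_shift) auto
  qed
  have r2: "r2 z x \<in> F p" "vpoly (\<lambda>z. r2 z x)" if "x \<in> F p" for z x
    unfolding r2_def using brk2_L_in[of "-2" x p] that by auto
  have rel: "poly q (l + of_int h / 2) *s b2 h x =
      (\<Sum>y\<in>B. R1 x y (l + of_int h / 2) (r1 (of_int h) y) + R2 x y (l + of_int h / 2) (r2 (of_int h) y))"
    if h: "h mod 2 = p mod 2" "4 \<le> h" and x: "x \<in> B" for h x
  proof -
    let ?s = "l + of_int h / 2"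
    let ?u = "b2 (h - 4)" and ?v = "b2 h"
    have h4: "(h - 4) mod 2 = p mod 2" "(h - 2) mod 2 = p mod 2" using h(1) by presburger+
    note ulin = b2_lin[OF h4(1)]
    have h0: "0 \<le> h - 4" "0 \<le> h - 2" "0 \<le> h" using h by auto
    have sp: "?u w = (\<Sum>y\<in>B. crd y w *s ?u y)" if "w \<in> F p" for w
    proof -
      have "?u w = (\<Sum>y\<in>B. ?u (crd y w *s y))"
        by (subst (1) expand[OF that], rule lin_on_sum[OF ulin[OF h0(1)] F_subspace])
          (auto intro: subspace_scale[OF F_subspace] BF)
      also have "\<dots> = (\<Sum>y\<in>B. crd y w *s ?u y)"
        by (rule sum.cong) (auto simp: lin_onD(3)[OF ulin[OF h0(1)]] BF)
      finally show ?thesis .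
    qed
    have s: "l + (of_int h + 2) / 2 = ?s + 1" "l + (of_int h + 4) / 2 = ?s + 2"
      "l + (of_int h - 2) / 2 = ?s - 1"
      by (simp_all add: add_divide_distrib diff_divide_distrib)
    \<comment> \<open>\<open>L\<^sub>2 L\<^sub>-\<^sub>1\<^sup>2 = L\<^sub>-\<^sub>1\<^sup>2 L\<^sub>2 + 3 L\<^sub>-\<^sub>1 L\<^sub>1 + 3 L\<^sub>1 L\<^sub>-\<^sub>1\<close>, where \<open>L\<^sub>-\<^sub>1\<^sup>2\<close> lowers the position from \<open>h\<close> to
      \<open>h - 4\<close>\<close>
    have e1: "((?s ^ 4 - 4 * ?s ^ 3 + 5 * ?s ^ 2 - 2 * ?s) *s ?u x + (2 * ?s ^ 2 - 4 * ?s + 2) *s ?u (?C x) + ?u (?C (?C x))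
        = (?s ^ 4 + 4 * ?s ^ 3 + 5 * ?s ^ 2 + 2 * ?s) *s ?v x + (2 * ?s ^ 2 + 4 * ?s + 2) *s ?C (?v x) + ?C (?C (?v x)) + r1 (of_int h) x)"
      if xB: "x \<in> B" for x
    proof -
      note x = BF[OF xB]
      let ?t = "T (bmsL (-1)) p"
      have tF: "?t z w \<in> F p" if "w \<in> F p" for z w using T_in[of "bmsL (-1)" w p z] that by simp
      have 1: "b2 (h - 2) (?t (of_int h) w) = ?t (of_int h + 4) (?v w) + 3 *s w" if "w \<in> F p" for w
        using b2_L[of "-1" w p h] that h h0 by (simp add: brk2_Lm1)
      have 2: "?u (?t (of_int h - 2) w) = ?t (of_int h + 2) (b2 (h - 2) w) + 3 *s w" if "w \<in> F p" for w
        using b2_L[of "-1" w p "h - 2"] that h4 h0 add.commute[of 2 "complex_of_int h"]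
        by (simp add: brk2_Lm1)
      have vF: "?v x \<in> F p" by (rule b2[OF h(1) h0(3) x])
      have "?u (?t (of_int h - 2) (?t (of_int h) x)) =
          ?t (of_int h + 2) (?t (of_int h + 4) (?v x) + 3 *s x) + 3 *s ?t (of_int h) x"
        using 2[OF tF[OF x]] 1[OF x] by simp
      also have "?t (of_int h + 2) (?t (of_int h + 4) (?v x) + 3 *s x) =
          ?t (of_int h + 2) (?t (of_int h + 4) (?v x)) + 3 *s ?t (of_int h + 2) x"
        using lin_onD[OF T_lin_even[of "bmsL (-1)" "-1" p]] tF vF x subspace_scale[OF F_subspace] by simp
      finally have main: "?u (?t (of_int h - 2) (?t (of_int h) x)) =
          ?t (of_int h + 2) (?t (of_int h + 4) (?v x)) + r1 (of_int h) x"
        by (simp add: r1_def add.assoc)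
      have c1: "((s - 1) ^ 2 - (s - 1)) * (s ^ 2 - s) = s ^ 4 - 4 * s ^ 3 + 5 * s ^ 2 - 2 * s"
        "((s - 1) ^ 2 - (s - 1)) + (s ^ 2 - s) = 2 * s ^ 2 - 4 * s + 2"
        "((s + 1) ^ 2 - (s + 1)) * ((s + 2) ^ 2 - (s + 2)) = s ^ 4 + 4 * s ^ 3 + 5 * s ^ 2 + 2 * s"
        "((s + 1) ^ 2 - (s + 1)) + ((s + 2) ^ 2 - (s + 2)) = 2 * s ^ 2 + 4 * s + 2" for s :: complex
        by algebra+
      have l: "?t (of_int h - 2) (?t (of_int h) x) = (?s ^ 4 - 4 * ?s ^ 3 + 5 * ?s ^ 2 - 2 * ?s) *s x
          + (2 * ?s ^ 2 - 4 * ?s + 2) *s ?C x + ?C (?C x)"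
        using T_Lm1_twice[OF x, of "of_int h - 2" "of_int h"] unfolding s c1 .
      have r: "?t (of_int h + 2) (?t (of_int h + 4) (?v x)) = (?s ^ 4 + 4 * ?s ^ 3 + 5 * ?s ^ 2 + 2 * ?s) *s ?v x
          + (2 * ?s ^ 2 + 4 * ?s + 2) *s ?C (?v x) + ?C (?C (?v x))"
        using T_Lm1_twice[OF vF, of "of_int h + 2" "of_int h + 4"] unfolding s c1 .
      have "?u (\<alpha> *s x + \<beta> *s ?C x + ?C (?C x)) = \<alpha> *s ?u x + \<beta> *s ?u (?C x) + ?u (?C (?C x))" for \<alpha> \<beta>
        using lin_onD[OF ulin[OF h0(1)]] x CF subspace_scale[OF F_subspace] subspace_add[OF F_subspace] by simp
      from main[unfolded l r this] show ?thesis .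
    qed
    have e2: "(- (?s ^ 3 - 3 * ?s ^ 2 + 2 * ?s)) *s ?u x - (3 * ?s) *s ?u (?C x) - ?u (?D x)
        = (- (?s ^ 3 + 3 * ?s ^ 2 + 2 * ?s)) *s ?v x - (3 * (?s + 2)) *s ?C (?v x) - ?D (?v x) + r2 (of_int h) x"
      if xB: "x \<in> B" for x
    proof -
      note x = BF[OF xB]
      have vF: "?v x \<in> F p" by (rule b2[OF h(1) h0(3) x])
      have main: "?u (T (bmsL (-2)) p (of_int h) x) = T (bmsL (-2)) p (of_int h + 4) (?v x) + r2 (of_int h) x"
        using b2_L[of "-2" x p h] x h h0 by (simp add: r2_def)
      have c: "- ((s + 2) ^ 3 - 3 * (s + 2) ^ 2 + 2 * (s + 2)) = - (s ^ 3 + 3 * s ^ 2 + 2 * s)" for s :: complex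
        by algebra
      have "?u (\<alpha> *s x - \<beta> *s ?C x - ?D x) = \<alpha> *s ?u x - \<beta> *s ?u (?C x) - ?u (?D x)" for \<alpha> \<beta>
        using lin_onD[OF ulin[OF h0(1)]] lin_on_diff[OF ulin[OF h0(1)] F_subspace] x CF DF
          subspace_scale[OF F_subspace] subspace_diff[OF F_subspace] by simp
      from main[unfolded T_Lm2[OF x] T_Lm2[OF vF] s c this] show ?thesis .
    qed
    have mem: "\<forall>x\<in>B. ?u x \<in> F p \<and> ?v x \<in> F p \<and> r1 (of_int h) x \<in> F p \<and> r2 (of_int h) x \<in> F p"
      using b2(1)[OF h4(1) h0(1)] b2(1)[OF h(1) h0(3)] r1(1) r2(1) BF by blast
    have e1': "\<forall>x\<in>B. (?s^4 - 4 * ?s^3 + 5 * ?s^2 - 2 * ?s) *s ?u x + (2 * ?s^2 - 4 * ?s + 2) *s (\<Sum>y\<in>B. crd y (?C x) *s ?u y) + (\<Sum>y\<in>B. crd y (?C (?C x)) *s ?u y)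
        = (?s^4 + 4 * ?s^3 + 5 * ?s^2 + 2 * ?s) *s ?v x + (2 * ?s^2 + 4 * ?s + 2) *s ?C (?v x) + ?C (?C (?v x)) + r1 (of_int h) x"
    proof
      fix x assume x: "x \<in> B"
      show "(?s^4 - 4 * ?s^3 + 5 * ?s^2 - 2 * ?s) *s ?u x + (2 * ?s^2 - 4 * ?s + 2) *s (\<Sum>y\<in>B. crd y (?C x) *s ?u y) + (\<Sum>y\<in>B. crd y (?C (?C x)) *s ?u y)
        = (?s^4 + 4 * ?s^3 + 5 * ?s^2 + 2 * ?s) *s ?v x + (2 * ?s^2 + 4 * ?s + 2) *s ?C (?v x) + ?C (?C (?v x)) + r1 (of_int h) x"
        unfolding sp[OF CF[OF BF[OF x]], symmetric] sp[OF CF[OF CF[OF BF[OF x]]], symmetric] by (rule e1[OF x])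
    qed
    have e2': "\<forall>x\<in>B. (- (?s^3 - 3 * ?s^2 + 2 * ?s)) *s ?u x - (3 * ?s) *s (\<Sum>y\<in>B. crd y (?C x) *s ?u y) - (\<Sum>y\<in>B. crd y (?D x) *s ?u y)
        = (- (?s^3 + 3 * ?s^2 + 2 * ?s)) *s ?v x - (3 * (?s + 2)) *s ?C (?v x) - ?D (?v x) + r2 (of_int h) x"
    proof
      fix x assume x: "x \<in> B"
      show "(- (?s^3 - 3 * ?s^2 + 2 * ?s)) *s ?u x - (3 * ?s) *s (\<Sum>y\<in>B. crd y (?C x) *s ?u y) - (\<Sum>y\<in>B. crd y (?D x) *s ?u y)
        = (- (?s^3 + 3 * ?s^2 + 2 * ?s)) *s ?v x - (3 * (?s + 2)) *s ?C (?v x) - ?D (?v x) + r2 (of_int h) x"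
        unfolding sp[OF CF[OF BF[OF x]], symmetric] sp[OF DF[OF BF[OF x]], symmetric] by (rule e2[OF x])
    qed
    from main[THEN spec, THEN spec, THEN spec, THEN spec, THEN spec, THEN mp, THEN mp, THEN mp, OF mem e1' e2'] x
    show ?thesis by blast
  qed
  define q' where "q' = pcompose q [:l, 1/2:]"
  have "q' \<noteq> 0" using q by (simp add: q'_def pcompose_eq_0_iff)
  have q'z: "poly q' z = poly q (l + z / 2)" for z by (simp add: q'_def poly_pcompose)
  define f where "f x z = (\<Sum>y\<in>B. R1 x y (l + z / 2) (r1 z y) + R2 x y (l + z / 2) (r2 z y))" for x z
  have fv: "vpoly (f x)" for x
    unfolding f_def
  proof (rule vpoly_sum)
    fix y assume y: "y \<in> B"
    have "vpoly (\<lambda>z. R1 x y (l + z / 2) (r1 z y))"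
      by (rule vpoly_family[OF r1(2)[OF BF[OF y]] r1(1)[OF BF[OF y]] F_subspace Rl(1)])
        (rule vpoly_affine, rule Rv(1))
    moreover have "vpoly (\<lambda>z. R2 x y (l + z / 2) (r2 z y))"
      by (rule vpoly_family[OF r2(2)[OF BF[OF y]] r2(1)[OF BF[OF y]] F_subspace Rl(2)])
        (rule vpoly_affine, rule Rv(2))
    ultimately show "vpoly (\<lambda>z. R1 x y (l + z / 2) (r1 z y) + R2 x y (l + z / 2) (r2 z y))"
      by (rule vpoly.add)
  qed
  have "\<exists>f. vpoly f \<and> (\<forall>h. h mod 2 = p mod 2 \<longrightarrow> 4 \<le> h \<longrightarrow> f (of_int h) = poly q' (of_int h) *s b2 h w)"
    if w: "w \<in> F p" for w
  proof (intro exI conjI allI impI)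
    show "vpoly (\<lambda>z. \<Sum>x\<in>B. crd x w *s f x z)" by (intro vpoly_sum vpoly_smult fv)
    fix h assume h: "h mod 2 = p mod 2" "4 \<le> h"
    then have h0: "0 \<le> h" by simp
    have "b2 h w = (\<Sum>x\<in>B. b2 h (crd x w *s x))"
      by (subst (1) expand[OF w], rule lin_on_sum[OF b2_lin[OF h(1) h0] F_subspace])
        (auto intro: subspace_scale[OF F_subspace] BF)
    also have "\<dots> = (\<Sum>x\<in>B. crd x w *s b2 h x)"
      by (rule sum.cong) (auto simp: lin_onD(3)[OF b2_lin[OF h(1) h0]] BF)
    finally have "poly q' (of_int h) *s b2 h w = (\<Sum>x\<in>B. crd x w *s (poly q' (of_int h) *s b2 h x))"
      by (simp add: scale_sum_right mult.commute)
    also have "\<dots> = (\<Sum>x\<in>B. crd x w *s f x (of_int h))"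
      by (rule sum.cong) (auto simp: q'z rel[OF h] f_def)
    finally show "(\<Sum>x\<in>B. crd x w *s f x (of_int h)) = poly q' (of_int h) *s b2 h w" by simp
  qed
  with \<open>q' \<noteq> 0\<close> show ?thesis by blast
qed

end

subsection \<open>A pole of \<open>L\<^sub>2\<close>\<close>

text \<open>For the comparison of degrees in \<open>denominator_nonconstant\<close>, which involves values of \<open>L\<^sub>2\<close> at two
  different positions.\<close>

lemma shift_coeffs:
  fixes m :: "complex poly"
  assumes "degree m \<le> N"
  shows "coeff (pcompose m [:a, 1:]) N = coeff m N \<and>
    coeff (pcompose m [:a, 1:]) (N - 1) = coeff m (N - 1) + of_nat N * a * coeff m N"
  using assms
proof (induction m arbitrary: N)
  case (pCons b m)
  let ?c = "coeff (pcompose m [:a, 1:])"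
  have e0: "coeff (pcompose (pCons b m) [:a, 1:]) 0 = b + a * ?c 0"
    by (simp add: pcompose_pCons)
  have e1: "coeff (pcompose (pCons b m) [:a, 1:]) (Suc i) = a * ?c (Suc i) + ?c i" for i
    by (simp add: pcompose_pCons)
  show ?case
  proof (cases N)
    case 0
    then have "m = 0" using pCons.prems by (simp split: if_splits)
    then show ?thesis using 0 by (simp add: pcompose_pCons)
  next
    case (Suc n)
    have d: "degree m \<le> n" using pCons.prems Suc by (simp split: if_splits)
    have top: "?c (Suc n) = 0" "coeff m (Suc n) = 0"
      using d by (simp_all add: coeff_eq_0 degree_pcompose)
    note ih = pCons.IH[OF d, THEN conjunct1] pCons.IH[OF d, THEN conjunct2]
    show ?thesis
    proof (cases n)
      case 0
      then show ?thesis using e0 e1[of 0] ih(1) top Suc by simp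
    next
      case n: (Suc k)
      have "?c n = coeff m n" "?c k = coeff m k + of_nat n * a * coeff m n"
        using ih n by simp_all
      then show ?thesis using e1[of n] e1[of k] top Suc n by (simp add: algebra_simps)
    qed
  qed
qed simp

context cvs
begin

lemma eigenvector_exists:
  assumes B: "finite B" and f: "lin_on (span B) (span B) f" and u: "u \<in> span B" "u \<noteq> 0"
  obtains r v where "v \<in> span B" "v \<noteq> 0" "f v = r *s v"
proof -
  obtain p0 where "p0 \<noteq> 0" "opoly p0 f u = 0"
    using annihilating_poly[OF B f] u(1) by metis
  then obtain p where p: "p \<noteq> 0" "opoly p f u = 0"
    and min: "\<And>q. q \<noteq> 0 \<Longrightarrow> opoly q f u = 0 \<Longrightarrow> degree p \<le> degree q"
    using ex_has_least_nat[of "\<lambda>p. p \<noteq> 0 \<and> opoly p f u = 0" p0 degree] by blast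
  have "degree p \<noteq> 0"
  proof
    assume "degree p = 0"
    then obtain c where "p = [:c:]" by (rule degree_eq_zeroE)
    then show False using p u(2) by (auto simp: opoly_pCons)
  qed
  then obtain r where "poly p r = 0"
    using fundamental_theorem_of_algebra[of p] constant_degree[of p] by auto
  then have "[:- r, 1:] dvd p" by (simp only: poly_eq_0_iff_dvd)
  then obtain g where g: "p = [:- r, 1:] * g" by (rule dvdE)
  then have gp: "p = g * [:- r, 1:]" by (simp add: mult.commute)
  have g0: "g \<noteq> 0" using p(1) g by auto
  have "degree p = degree [:- r, 1:] + degree g" unfolding g by (rule degree_mult_eq) (use g0 in auto)
  then have "degree p = degree g + 1" by simp
  then have "opoly g f u \<noteq> 0" using min[OF g0] by auto
  moreover have "opoly [:- r, 1:] f (opoly g f u) = 0"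
    using p(2) unfolding gp opoly_mult[OF f subspace_span u(1)] .
  then have "f (opoly g f u) = r *s opoly g f u" by (simp add: opoly_pCons)
  ultimately show ?thesis using that opoly_in[OF f subspace_span u(1)] by blast
qed

end

context bms_gauge
begin

lemma F_eigenvector:
  assumes f: "lin_on (F p) (F p) f" and u: "u \<in> F p" "u \<noteq> 0"
  obtains r v where "v \<in> F p" "v \<noteq> 0" "f v = r *s v"
proof -
  obtain B where B: "finite B" "span B = F p" using F_basis by blast
  from eigenvector_exists[OF B(1), of f u] assms B(2) that show ?thesis by auto
qed

text \<open>\<open>q\<close> is a common denominator of the matrix entries of \<open>L\<^sub>2\<close>.\<close>

definition denominator :: "complex poly \<Rightarrow> bool" where
  "denominator q \<longleftrightarrow> q \<noteq> 0 \<and> (\<exists>N::int. \<forall>p. \<forall>w\<in>F p. \<exists>f. vpoly f \<and>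
     (\<forall>h. h mod 2 = p mod 2 \<longrightarrow> N \<le> h \<longrightarrow> f (of_int h) = poly q (of_int h) *s b2 h w))"

lemma denominator_exists: "\<exists>q. denominator q"
proof -
  define ok where "ok p q \<longleftrightarrow> q \<noteq> 0 \<and> (\<forall>w\<in>F p. \<exists>f. vpoly f \<and>
     (\<forall>h. h mod 2 = p mod 2 \<longrightarrow> 4 \<le> h \<longrightarrow> f (of_int h) = poly q (of_int h) *s b2 h w))" for p and q :: "complex poly"
  have "\<forall>p. \<exists>q. ok p q" using b2_rational_at unfolding ok_def by blast
  from choice[OF this] obtain Q where Q: "\<And>p. ok p (Q p)" by blast
  then have Q0: "Q p \<noteq> 0" for p by (simp add: ok_def)
  have "\<exists>f. vpoly f \<and> (\<forall>h. h mod 2 = p mod 2 \<longrightarrow> 4 \<le> h \<longrightarrow> f (of_int h) = poly (Q 0 * Q 1) (of_int h) *s b2 h w)"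
    if w: "w \<in> F p" for p w
  proof -
    have Fp: "F p = F (p mod 2)" by (rule F_cong) simp
    have p2: "p mod 2 = 0 \<or> p mod 2 = 1" by presburger
    obtain f where f: "vpoly f"
      "\<And>h. h mod 2 = p mod 2 \<Longrightarrow> 4 \<le> h \<Longrightarrow> f (of_int h) = poly (Q (p mod 2)) (of_int h) *s b2 h w"
    proof -
      have "w \<in> F (p mod 2)" using w Fp by simp
      then obtain f where "vpoly f"
        "\<forall>h. h mod 2 = (p mod 2) mod 2 \<longrightarrow> 4 \<le> h \<longrightarrow> f (of_int h) = poly (Q (p mod 2)) (of_int h) *s b2 h w"
        using Q[of "p mod 2"] unfolding ok_def by blast
      then show thesis by (intro that[of f]) auto
    qed
    have "Q 0 * Q 1 = Q (1 - p mod 2) * Q (p mod 2)" using p2 by auto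
    then have "poly (Q (1 - p mod 2)) (of_int h) *s f (of_int h) = poly (Q 0 * Q 1) (of_int h) *s b2 h w"
      if "h mod 2 = p mod 2" "4 \<le> h" for h
      using f(2)[OF that] by simp
    then show ?thesis using vpoly_poly_scale[OF f(1), of "Q (1 - p mod 2)"] by blast
  qed
  then show ?thesis using Q0 unfolding denominator_def by (intro exI[of _ "Q 0 * Q 1"] conjI exI[of _ 4]) auto
qed

text \<open>If \<open>L\<^sub>2\<close> were polynomial, then so would be its value \<open>m(s)\<close> on an eigenvector \<open>w\<close> of the
  Casimir operator. In \<open>[L\<^sub>2, L\<^sub>-\<^sub>1] w = 3 w\<close> the two highest powers of \<open>s\<close> can only cancel if
  \<open>deg m + 4 = 0\<close>.\<close>

lemma denominator_nonconstant:
  assumes q: "denominator q" and F0: "F p0 \<noteq> {0}"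
  shows "degree q \<noteq> 0"
proof
  assume "degree q = 0"
  then obtain a where qa: "q = [:a:]" by (rule degree_eq_zeroE)
  then have a: "a \<noteq> 0" using q by (simp add: denominator_def)
  let ?p = p0
  obtain u where "u \<in> F ?p" "u \<noteq> 0" using F0 subspace_0[OF F_subspace] by blast
  from F_eigenvector[OF Cop_lin this] obtain c w where w: "w \<in> F ?p" "w \<noteq> 0" "Cop ?p w = c *s w" .
  obtain N f where f: "vpoly f"
    "\<And>h. h mod 2 = ?p mod 2 \<Longrightarrow> N \<le> h \<Longrightarrow> f (of_int h) = a *s b2 h w"
  proof -
    obtain N where N: "\<forall>p. \<forall>w\<in>F p. \<exists>f. vpoly f \<and>
       (\<forall>h. h mod 2 = p mod 2 \<longrightarrow> N \<le> h \<longrightarrow> f (of_int h) = poly q (of_int h) *s b2 h w)"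
      using q unfolding denominator_def by blast
    then obtain f where f: "vpoly f" "\<forall>h. h mod 2 = ?p mod 2 \<longrightarrow> N \<le> h \<longrightarrow> f (of_int h) = poly q (of_int h) *s b2 h w"
      using w(1) by blast
    show thesis by (rule that[OF f(1), of N]) (use f(2) in \<open>auto simp: qa\<close>)
  qed
  define m where "m z = (1 / a) *s f z" for z
  have mv: "vpoly m" unfolding m_def by (rule vpoly_smult[OF f(1)])
  have mb: "m (of_int h) = b2 h w" if "h mod 2 = ?p mod 2" "N \<le> h" for h
    using f(2)[OF that] a by (simp add: m_def)
  have mF: "m z \<in> F ?p" for z
  proof (rule vpoly_in_subspace[OF mv F_subspace infinite_positions[of "max 0 N" ?p]])
    fix z :: complex assume "z \<in> {z. \<exists>h. max 0 N \<le> h \<and> h mod 2 = ?p mod 2 \<and> z = of_int h}"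
    then obtain h where "0 \<le> h" "N \<le> h" "h mod 2 = ?p mod 2" "z = of_int h" by auto
    then show "m z \<in> F ?p" using mb b2(1) w(1) by simp
  qed
  let ?e = "\<lambda>z. (l + z / 2) ^ 2 - (l + z / 2)"
  have eq: "(?e z + c) *s m (z - 2) = ?e (z + 4) *s m z + Cop ?p (m z) + 3 *s w" for z
  proof (rule vpoly_eq[of "\<lambda>z. (?e z + c) *s m (z - 2)" "\<lambda>z. ?e (z + 4) *s m z + Cop ?p (m z) + 3 *s w",
        OF _ _ infinite_positions[of "\<bar>N\<bar> + 2" ?p]])
    define S where "S = [:l, 1/2:]"
    have S: "poly S z = l + z / 2" for z by (simp add: S_def)
    show "vpoly (\<lambda>z. (?e z + c) *s m (z - 2))"
      using vpoly_poly_scale[OF vpoly_shift[OF mv, of "-2"], of "S ^ 2 - S + [:c:]"] by (simp add: S)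
    have "vpoly (\<lambda>z. ?e (z + 4) *s m z)"
      using vpoly_poly_scale[OF mv, of "(S + 2) ^ 2 - (S + 2)"] by (simp add: S add_divide_distrib add.assoc)
    moreover have "vpoly (\<lambda>z. Cop ?p (m z))"
      by (rule vpoly_family[OF mv mF F_subspace Cop_lin]) (rule vpoly.const)
    ultimately show "vpoly (\<lambda>z. ?e (z + 4) *s m z + Cop ?p (m z) + 3 *s w)"
      by (intro vpoly.add vpoly.const)
    fix z :: complex assume "z \<in> {z. \<exists>h. \<bar>N\<bar> + 2 \<le> h \<and> h mod 2 = ?p mod 2 \<and> z = of_int h}"
    then obtain h where h: "\<bar>N\<bar> + 2 \<le> h" "h mod 2 = ?p mod 2" "z = of_int h" by auto
    have h2: "(h - 2) mod 2 = ?p mod 2" using h(2) by presburger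
    have t: "T (bmsL (-1)) ?p z w = (?e z + c) *s w"
      by (simp add: T_Lm1[OF w(1)] w(3) scale_left_distrib)
    have "b2 (h - 2) (T (bmsL (-1)) ?p (of_int h) w) = T (bmsL (-1)) ?p (of_int h + 4) (b2 h w) + 3 *s w"
      using b2_L[of "-1" w ?p h] w(1) h by (simp add: brk2_Lm1)
    moreover have "b2 (h - 2) ((?e z + c) *s w) = (?e z + c) *s b2 (h - 2) w"
      using lin_onD(3)[OF b2_lin[OF h2]] w(1) h(1) by simp
    ultimately show "(?e z + c) *s m (z - 2) = ?e (z + 4) *s m z + Cop ?p (m z) + 3 *s w"
      using mb[OF h(2)] mb[OF h2] h T_Lm1[OF mF, of "z + 4" z] t by simp
  qed
  have "\<exists>K x. \<forall>z. m z = (\<Sum>j<K. z ^ j *s x j)" using vpoly_normal_form[OF mv] by metis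
  then obtain K where "\<exists>x. \<forall>z. m z = (\<Sum>j<K. z ^ j *s x j)"
    and Kmin: "\<And>K'. K' < K \<Longrightarrow> \<not> (\<exists>x. \<forall>z. m z = (\<Sum>j<K'. z ^ j *s x j))"
    using exists_least_iff[of "\<lambda>K. \<exists>x. \<forall>z. m z = (\<Sum>j<K. z ^ j *s x j)"] by blast
  then obtain x where mx: "\<And>z. m z = (\<Sum>j<K. z ^ j *s x j)" by blast
  have "K \<noteq> 0"
  proof
    assume "K = 0"
    then have "m z = 0" for z by (simp add: mx)
    then have "3 *s w = 0" using eq[of 0] lin_on_0[OF Cop_lin F_subspace] by simp
    then show False using w(2) by simp
  qed
  then obtain k where K: "K = Suc k" by (cases K) auto
  have xk: "x k \<noteq> 0"
  proof
    assume "x k = 0"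
    then have "m z = (\<Sum>j<k. z ^ j *s x j)" for z by (simp add: mx K)
    then show False using Kmin[of k] K by blast
  qed
  have xF: "x j \<in> F ?p" if "j < K" for j
    by (rule vpoly_coeffs_in[OF F_subspace infinite_UNIV_char_0 _ that]) (use mF mx in metis)
  obtain B where B: "finite B" "independent B" "span B = F ?p" using F_basis by blast
  obtain b where b: "representation B (x k) b \<noteq> 0"
  proof -
    have "x k = (\<Sum>b\<in>B. representation B (x k) b *s b)"
      using sum_representation_eq[OF B(2) _ B(1) order_refl] xF[of k] B(3) K by simp
    then have "\<exists>b\<in>B. representation B (x k) b \<noteq> 0" using xk
      by (metis (no_types, lifting) scale_zero_left sum.neutral)
    then show thesis using that by blast
  qed
  \<comment> \<open>A coordinate in which the leading coefficient \<open>x k\<close> of \<open>m\<close> does not vanish.\<close>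
  define r where "r w = representation B w b" for w
  have r: "r (u + v) = r u + r v" "r (d *s u) = d * r u" if "u \<in> F ?p" "v \<in> F ?p" for u v d
    using that B by (simp_all add: r_def representation_add representation_scale)
  have rsum: "r (\<Sum>j<K. z ^ j *s y j) = (\<Sum>j<K. z ^ j * r (y j))" if "\<And>j. j < K \<Longrightarrow> y j \<in> F ?p" for y z
  proof -
    have y: "y j \<in> span B" if "j < K" for j using \<open>\<And>j. j < K \<Longrightarrow> y j \<in> F ?p\<close>[OF that] B(3) by simp
    have "representation B (\<Sum>j<K. z ^ j *s y j) = (\<lambda>b. \<Sum>j<K. representation B (z ^ j *s y j) b)"
      by (rule representation_sum[OF B(2)]) (auto intro!: span_scale y)
    also have "\<dots> = (\<lambda>b. \<Sum>j<K. z ^ j * representation B (y j) b)"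
      by (rule ext, rule sum.cong) (auto simp: representation_scale[OF B(2) y])
    finally show ?thesis by (simp add: r_def)
  qed
  define M where "M = (\<Sum>j<K. monom (r (x j)) j)"
  define C where "C = (\<Sum>j<K. monom (r (Cop ?p (x j))) j)"
  have CF: "Cop ?p v \<in> F ?p" if "v \<in> F ?p" for v using lin_onD(1)[OF Cop_lin that] .
  have M: "poly M z = r (m z)" for z
    using rsum[of x z] xF by (simp add: M_def mx poly_sum poly_monom mult.commute)
  have C: "poly C z = r (Cop ?p (m z))" for z
  proof -
    have "Cop ?p (m z) = (\<Sum>j<K. Cop ?p (z ^ j *s x j))"
      unfolding mx by (rule lin_on_sum[OF Cop_lin F_subspace]) (use xF in \<open>auto intro: subspace_scale[OF F_subspace]\<close>)
    also have "\<dots> = (\<Sum>j<K. z ^ j *s Cop ?p (x j))"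
      by (rule sum.cong) (use xF lin_onD(3)[OF Cop_lin] in auto)
    finally show ?thesis
      using rsum[of "\<lambda>j. Cop ?p (x j)" z] xF CF by (simp add: C_def poly_sum poly_monom mult.commute)
  qed
  have cM: "coeff M j = (if j < K then r (x j) else 0)" for j
    by (simp add: M_def coeff_sum)
  have cC: "coeff C j = (if j < K then r (Cop ?p (x j)) else 0)" for j
    by (simp add: C_def coeff_sum)
  have dM: "degree M \<le> k" by (rule degree_le) (simp add: cM K)
  define S where "S = [:l, 1/2:]"
  have S: "poly S z = l + z / 2" for z by (simp add: S_def)
  let ?M' = "pcompose M [:-2, 1:]"
  have "(S ^ 2 - S + [:c:]) * ?M' = ((S + 2) ^ 2 - (S + 2)) * M + C + [:3 * r w:]"
  proof (rule poly_eq_poly_eq_iff[THEN iffD1], rule ext)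
    fix z
    have s4: "l + (z + 4) / 2 = l + z / 2 + 2" by (simp add: add_divide_distrib)
    have "poly ((S ^ 2 - S + [:c:]) * ?M') z = r ((?e z + c) *s m (z - 2))"
      using r(2)[OF mF mF] by (simp add: S poly_pcompose M)
    also have "\<dots> = r (?e (z + 4) *s m z) + r (Cop ?p (m z)) + r (3 *s w)"
      unfolding eq using mF CF w(1) subspace_scale[OF F_subspace] subspace_add[OF F_subspace] by (simp add: r)
    also have "\<dots> = poly (((S + 2) ^ 2 - (S + 2)) * M + C + [:3 * r w:]) z"
      using r(2)[OF mF mF] r(2)[OF w(1) w(1)] unfolding s4 by (simp add: S M C)
    finally show "poly ((S ^ 2 - S + [:c:]) * ?M') z = poly (((S + 2) ^ 2 - (S + 2)) * M + C + [:3 * r w:]) z" .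
  qed
  moreover have "S ^ 2 - S + [:c:] = [:l ^ 2 - l + c, l - 1/2, 1/4:]"
    by (simp add: S_def power2_eq_square field_simps)
  moreover have "(S + 2) ^ 2 - (S + 2) = [:(l + 2) ^ 2 - (l + 2), l + 2 - 1/2, 1/4:]"
    by (simp add: S_def power2_eq_square numeral_poly field_simps)
  ultimately have "coeff ([:l ^ 2 - l + c, l - 1/2, 1/4:] * ?M') (Suc k)
      = coeff ([:(l + 2) ^ 2 - (l + 2), l + 2 - 1/2, 1/4:] * M + C + [:3 * r w:]) (Suc k)"
    by (simp only:)
  moreover have "coeff ([:a0, a1, a2:] * P) (Suc k) = a0 * coeff P (Suc k) + a1 * coeff P k
      + (if k = 0 then 0 else a2 * coeff P (k - 1))" for a0 a1 a2 and P :: "complex poly"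
    by (cases k) simp_all
  moreover have "coeff ?M' (Suc k) = 0" "coeff M (Suc k) = 0" "coeff C (Suc k) = 0"
    using dM degree_pcompose[of M "[:-2,1:]"] by (auto intro!: coeff_eq_0 simp: cC K)
  ultimately have "(l - 1/2) * coeff ?M' k + (if k = 0 then 0 else 1/4 * coeff ?M' (k - 1))
      = (l + 2 - 1/2) * coeff M k + (if k = 0 then 0 else 1/4 * coeff M (k - 1))"
    by (simp only: coeff_add) simp
  moreover have "coeff ?M' k = coeff M k" "coeff ?M' (k - 1) = coeff M (k - 1) + of_nat k * (- 2) * coeff M k"
    using shift_coeffs[OF dM, of "-2"] by blast+
  ultimately have e: "(l - 1/2) * coeff M k + (if k = 0 then 0 else 1/4 * (coeff M (k - 1) + of_nat k * (- 2) * coeff M k))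
      = (l + 2 - 1/2) * coeff M k + (if k = 0 then 0 else 1/4 * coeff M (k - 1))"
    by (simp only:)
  have "(of_nat k / 2 + 2) * coeff M k = 0"
  proof (cases "k = 0")
    case True
    then show ?thesis using e by (simp add: field_simps)
  next
    case False
    have aux: "(n / 2 + 2) * x = 0"
      if "(l - 1/2) * x + 1/4 * (y + n * (- 2) * x) = (l + 2 - 1/2) * x + 1/4 * y" for n x y :: complex
    proof -
      have "(n / 2 + 2) * x = ((l + 2 - 1/2) * x + 1/4 * y) - ((l - 1/2) * x + 1/4 * (y + n * (- 2) * x))"
        by (simp add: algebra_simps)
      then show ?thesis unfolding that by simp
    qed
    show ?thesis
      by (rule aux[where n = "of_nat k" and x = "coeff M k" and y = "coeff M (k - 1)"])
        (use e False in \<open>simp only: if_False\<close>)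
  qed
  moreover have "of_nat k / 2 + 2 \<noteq> (0::complex)"
  proof -
    have "of_nat k / 2 + 2 = (of_nat (k + 4) :: complex) / 2" by simp
    also have "\<dots> \<noteq> 0" by (simp only: divide_eq_0_iff of_nat_eq_0_iff) simp
    finally show ?thesis .
  qed
  moreover have "coeff M k \<noteq> 0" using b by (simp add: cM K r_def)
  ultimately show False by simp
qed

subsection \<open>A highest weight vector\<close>

fun neg :: "bms_basis \<Rightarrow> bool" where
  "neg (bmsL k) \<longleftrightarrow> k \<le> - 1"
| "neg (bmsI k) \<longleftrightarrow> k \<le> - 1"
| "neg (bmsQ k) \<longleftrightarrow> k \<le> - 1"
| "neg _ \<longleftrightarrow> False"

lemma neg_low: "neg y \<Longrightarrow> low y"
  by (cases y) auto

lemma T_bracket_zero: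
  assumes "low x" "low y" "w \<in> F p" "T x p z w = 0"
    and "\<And>\<beta>. \<beta> \<in> Poly_Mapping.keys (bms_basis_bracket x y) \<Longrightarrow> T \<beta> p z w = 0"
  shows "T x (p + deg2 y) (z + of_int (deg2 y)) (T y p z w) = 0"
proof -
  have "T y (p + deg2 x) (z + of_int (deg2 x)) 0 = 0"
    by (rule lin_on_0[OF T_lin[OF assms(2)] F_subspace])
  then show ?thesis using T_bracket[OF assms(1-3), of z] assms(4,5) by simp
qed

text \<open>At a root \<open>\<sigma>\<close> of a denominator \<open>q\<close> of minimal degree the numerator \<open>N\<close> of \<open>L\<^sub>2\<close> does not
  vanish. Clearing denominators in the commutator of \<open>L\<^sub>2\<close> with a lowering operator \<open>y\<close> of
  degree \<open>d\<close> gives \<open>q(\<sigma> + d) y N(\<sigma>) = 0\<close>, and \<open>q(\<sigma> + d) \<noteq> 0\<close> if \<open>\<sigma>\<close> has minimal real part among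
  the roots. The argument uses that \<open>[L\<^sub>2, y]\<close> is polynomial, but
  \<open>[L\<^sub>2, Q\<^sub>-\<^sub>1\<^sub>/\<^sub>2]\<close> is a multiple of \<open>Q\<^sub>3\<^sub>/\<^sub>2\<close>.\<close>

lemma residue_killed:
  assumes F0: "F p0 \<noteq> {0}"
  obtains p z w where "w \<in> F p" "w \<noteq> 0"
    "\<And>y. neg y \<Longrightarrow> y \<noteq> bmsQ (-1) \<Longrightarrow> T y p z w = 0"
proof -
  obtain q0 where "denominator q0" using denominator_exists by blast
  then obtain q where q: "denominator q" and min: "\<And>q'. denominator q' \<Longrightarrow> degree q \<le> degree q'"
    using ex_has_least_nat[of denominator q0 degree] by blast
  have qnz: "q \<noteq> 0" using q by (simp add: denominator_def)
  have "degree q \<noteq> 0" by (rule denominator_nonconstant[OF q F0])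
  then have "\<not> constant (poly q)" using constant_degree[of q] by simp
  then have ne: "{r. poly q r = 0} \<noteq> {}" using fundamental_theorem_of_algebra by blast
  have fin: "finite {r. poly q r = 0}" by (rule poly_roots_finite[OF qnz])
  define \<sigma> where "\<sigma> = arg_min_on Re {r. poly q r = 0}"
  have \<sigma>: "poly q \<sigma> = 0" "\<And>r. poly q r = 0 \<Longrightarrow> Re \<sigma> \<le> Re r"
    using arg_min_if_finite[OF fin ne, of Re] by (force simp: \<sigma>_def not_less)+
  obtain M where "\<forall>p. \<forall>w\<in>F p. \<exists>f. vpoly f \<and>
     (\<forall>h. h mod 2 = p mod 2 \<longrightarrow> M \<le> h \<longrightarrow> f (of_int h) = poly q (of_int h) *s b2 h w)"
    using q unfolding denominator_def by blast
  then obtain N where N: "\<And>p w. w \<in> F p \<Longrightarrow> vpoly (\<lambda>z. N p w z)"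
    "\<And>p w h. w \<in> F p \<Longrightarrow> h mod 2 = p mod 2 \<Longrightarrow> M \<le> h \<Longrightarrow> N p w (of_int h) = poly q (of_int h) *s b2 h w"
    by metis
  have NF: "N p w z \<in> F p" if w: "w \<in> F p" for p w z
  proof (rule vpoly_in_subspace[OF N(1)[OF w] F_subspace infinite_positions[of "max 0 M" p]])
    fix z :: complex assume "z \<in> {z. \<exists>h. max 0 M \<le> h \<and> h mod 2 = p mod 2 \<and> z = of_int h}"
    then obtain h where "0 \<le> h" "M \<le> h" "h mod 2 = p mod 2" "z = of_int h" by auto
    then show "N p w z \<in> F p" using N(2)[OF w] b2(1) w subspace_scale[OF F_subspace] by simp
  qed
  have N_eq: "N p w z = g z" if w: "w \<in> F p" and g: "vpoly g"
    and e: "\<And>h. h mod 2 = p mod 2 \<Longrightarrow> M \<le> h \<Longrightarrow> 0 \<le> h \<Longrightarrow> g (of_int h) = poly q (of_int h) *s b2 h w" for p w g z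
  proof (rule vpoly_eq[OF N(1)[OF w] g infinite_positions[of "max 0 M" p]])
    fix z :: complex assume "z \<in> {z. \<exists>h. max 0 M \<le> h \<and> h mod 2 = p mod 2 \<and> z = of_int h}"
    then obtain h where "0 \<le> h" "M \<le> h" "h mod 2 = p mod 2" "z = of_int h" by auto
    then show "N p w z = g z" using N(2)[OF w] e by simp
  qed
  have N_lin: "lin_on (F p) (F p) (\<lambda>w. N p w z)" for p z
    unfolding lin_on_def
  proof (intro conjI ballI allI)
    fix u v c assume u: "u \<in> F p" and v: "v \<in> F p"
    show "N p u z \<in> F p" by (rule NF[OF u])
    show "N p (u + v) z = N p u z + N p v z"
      by (rule N_eq) (use u v in \<open>auto intro!: vpoly.add N(1) subspace_add[OF F_subspace]
          simp: N(2) lin_onD(2)[OF b2_lin] scale_right_distrib\<close>)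
  next
    fix c u assume u: "u \<in> F p"
    show "N p (c *s u) z = c *s N p u z"
      by (rule N_eq) (use u in \<open>auto intro!: vpoly_smult N(1) subspace_scale[OF F_subspace]
          simp: N(2) lin_onD(3)[OF b2_lin] mult.commute\<close>)
  qed
  have rel: "poly q z *s N (p + deg2 y) (T y p z w) (z + of_int (deg2 y)) =
      poly q (z + of_int (deg2 y)) *s T y p (z + 4) (N p w z)
      + (poly q z * poly q (z + of_int (deg2 y))) *s brk2 y p z w"
    if y: "low y" "\<And>\<beta>. \<beta> \<in> Poly_Mapping.keys (bms_basis_bracket (bmsL 2) y) \<Longrightarrow> low \<beta>" and w: "w \<in> F p" for y p w z
  proof (rule vpoly_eq[OF _ _ infinite_positions[of "\<bar>M\<bar> + \<bar>deg2 y\<bar>" p]])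
    let ?d = "deg2 y"
    have sh: "poly q (z + of_int ?d) = poly (pcompose q [:of_int ?d, 1:]) z" for z
      by (simp add: poly_pcompose add.commute)
    have "vpoly (\<lambda>z. N (p + ?d) (T y p z w) (z + of_int ?d))"
      by (rule vpoly_family[OF T_vpoly[OF y(1) w] T_in[OF y(1) w] F_subspace N_lin])
        (intro vpoly_shift N(1))
    then show "vpoly (\<lambda>z. poly q z *s N (p + ?d) (T y p z w) (z + of_int ?d))" by (rule vpoly_poly_scale)
    have "vpoly (\<lambda>z. T y p (z + 4) (N p w z))"
      by (rule vpoly_family[OF N(1)[OF w] NF[OF w] F_subspace T_lin[OF y(1)]])
        (rule vpoly_shift[OF T_vpoly[OF y(1)]])
    then have "vpoly (\<lambda>z. poly q (z + of_int ?d) *s T y p (z + 4) (N p w z))"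
      unfolding sh by (rule vpoly_poly_scale)
    moreover have "vpoly (\<lambda>z. (poly q z * poly q (z + of_int ?d)) *s brk2 y p z w)"
      unfolding sh poly_mult[symmetric] by (rule vpoly_poly_scale[OF brk2_in(2)[OF y(2) w]])
    ultimately show "vpoly (\<lambda>z. poly q (z + of_int ?d) *s T y p (z + 4) (N p w z)
      + (poly q z * poly q (z + of_int ?d)) *s brk2 y p z w)" by (rule vpoly.add)
    fix z :: complex assume "z \<in> {z. \<exists>h. \<bar>M\<bar> + \<bar>?d\<bar> \<le> h \<and> h mod 2 = p mod 2 \<and> z = of_int h}"
    then obtain h where h: "\<bar>M\<bar> + \<bar>?d\<bar> \<le> h" "h mod 2 = p mod 2" "z = of_int h" by auto
    have "N (p + ?d) (T y p z w) (of_int (h + ?d)) = poly q (of_int (h + ?d)) *s b2 (h + ?d) (T y p z w)"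
      by (rule N(2)[OF T_in[OF y(1) w] mod2_add[OF h(2)]]) (use h in auto)
    also have "b2 (h + ?d) (T y p z w) = T y p (of_int h + 4) (b2 h w) + brk2 y p (of_int h) w"
      unfolding h(3) by (rule b2_bracket[OF y w h(2)]) (use h in auto)
    finally have 1: "N (p + ?d) (T y p z w) (z + of_int ?d) =
        poly q (z + of_int ?d) *s (T y p (z + 4) (b2 h w) + brk2 y p z w)" using h(3) by simp
    have "N p w z = poly q z *s b2 h w" using N(2)[OF w h(2)] h by simp
    moreover have "T y p (z + 4) (poly q z *s b2 h w) = poly q z *s T y p (z + 4) (b2 h w)"
      by (rule lin_onD(3)[OF T_lin[OF y(1)]]) (use b2(1)[OF h(2) _ w] h in auto)
    ultimately show "poly q z *s N (p + ?d) (T y p z w) (z + of_int ?d) =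
        poly q (z + of_int ?d) *s T y p (z + 4) (N p w z) + (poly q z * poly q (z + of_int ?d)) *s brk2 y p z w"
      using 1 by (simp add: scale_right_distrib mult.commute)
  qed
  have "\<exists>p. \<exists>w\<in>F p. N p w \<sigma> \<noteq> 0"
  proof (rule ccontr)
    assume "\<not> (\<exists>p. \<exists>w\<in>F p. N p w \<sigma> \<noteq> 0)"
    then have z: "N p w \<sigma> = 0" if "w \<in> F p" for p w using that by blast
    have "[:- \<sigma>, 1:] dvd q" using \<sigma>(1) by (simp only: poly_eq_0_iff_dvd)
    then obtain q' where q': "q = [:- \<sigma>, 1:] * q'" by (rule dvdE)
    have q'0: "q' \<noteq> 0" using qnz q' by auto
    \<comment> \<open>Positions beyond \<open>M'\<close> are different from \<open>\<sigma>\<close>, so that the factor \<open>z - \<sigma>\<close> can be cancelled.\<close>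
    obtain M' :: int where M': "Re \<sigma> < of_int M'" using ex_less_of_int by blast
    have "\<exists>f. vpoly f \<and> (\<forall>h. h mod 2 = p mod 2 \<longrightarrow> max M M' \<le> h \<longrightarrow> f (of_int h) = poly q' (of_int h) *s b2 h w)"
      if w: "w \<in> F p" for p w
    proof -
      from vpoly_root[OF N(1)[OF w] z[OF w]] obtain g where g: "vpoly g" "\<And>z. N p w z = (z - \<sigma>) *s g z" by blast
      have "g (of_int h) = poly q' (of_int h) *s b2 h w" if h: "h mod 2 = p mod 2" "max M M' \<le> h" for h
      proof -
        have "of_int M' \<le> real_of_int h" using h(2) by simp
        then have "of_int h \<noteq> \<sigma>" using M' by (metis Re_complex_of_real leD of_real_of_int_eq)
        moreover have "(of_int h - \<sigma>) *s g (of_int h) = (of_int h - \<sigma>) *s (poly q' (of_int h) *s b2 h w)"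
          using N(2)[OF w h(1)] h(2) g(2)[of "of_int h"] by (simp add: q' algebra_simps)
        ultimately show ?thesis by (simp only: scale_cancel_left) auto
      qed
      then show ?thesis using g(1) by blast
    qed
    then have "denominator q'" unfolding denominator_def using q'0 by blast
    then have "degree q \<le> degree q'" by (rule min)
    moreover have "degree q = degree [:- \<sigma>, 1:] + degree q'"
      unfolding q' by (rule degree_mult_eq) (use q'0 in auto)
    ultimately show False by simp
  qed
  then obtain p w where w: "w \<in> F p" "N p w \<sigma> \<noteq> 0" by blast
  show thesis
  proof (rule that[of "N p w \<sigma>" p "\<sigma> + 4"])
    show "N p w \<sigma> \<in> F p" by (rule NF[OF w(1)])
    show "N p w \<sigma> \<noteq> 0" by (rule w(2))
    fix y assume y: "neg y" "y \<noteq> bmsQ (-1)"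
    have d: "deg2 y < 0" using y(1) by (cases y) auto
    have kl: "low \<beta>" if "\<beta> \<in> Poly_Mapping.keys (bms_basis_bracket (bmsL 2) y)" for \<beta>
    proof (cases y)
      case (bmsL k)
      then show ?thesis using brk2_low(1)[of \<beta> k] that y by simp
    next
      case (bmsI k)
      then show ?thesis using brk2_low(2)[of \<beta> k] that y by simp
    next
      case (bmsQ k)
      then show ?thesis using brk2_low(3)[of \<beta> k] that y by simp
    qed (use y in auto)
    have "poly q (\<sigma> + of_int (deg2 y)) \<noteq> 0"
    proof
      assume "poly q (\<sigma> + of_int (deg2 y)) = 0"
      then have "Re \<sigma> \<le> Re (\<sigma> + of_int (deg2 y))" by (rule \<sigma>(2))
      with d show False by simp
    qed
    moreover have "poly q (\<sigma> + of_int (deg2 y)) *s T y p (\<sigma> + 4) (N p w \<sigma>) = 0"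
      using rel[OF neg_low[OF y(1)] kl w(1), of \<sigma>] \<sigma>(1) by simp
    ultimately show "T y p (\<sigma> + 4) (N p w \<sigma>) = 0" by simp
  qed
qed

definition hw :: "int \<Rightarrow> complex \<Rightarrow> 'a \<Rightarrow> bool" where
  "hw p z v \<longleftrightarrow> v \<in> F p \<and> (\<forall>y. neg y \<longrightarrow> T y p z v = 0)"

text \<open>If \<open>Q\<^sub>-\<^sub>1\<^sub>/\<^sub>2\<close> does not kill the residue, then the residue is replaced by its image under \<open>Q\<^sub>-\<^sub>1\<^sub>/\<^sub>2\<close>. The
  image is killed because the square of \<open>Q\<^sub>-\<^sub>1\<^sub>/\<^sub>2\<close> is \<open>I\<^sub>-\<^sub>1\<close>.\<close>

lemma highest_weight_exists:
  assumes F0: "F p0 \<noteq> {0}"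
  obtains p z v where "hw p z v" "v \<noteq> 0"
proof -
  obtain w p z where w: "w \<in> F p" "w \<noteq> 0"
    and k: "\<And>y. neg y \<Longrightarrow> y \<noteq> bmsQ (-1) \<Longrightarrow> T y p z w = 0" by (rule residue_killed[OF F0], rule that, assumption, assumption, blast)
  let ?Q = "bmsQ (-1)"
  let ?v = "T ?Q p z w"
  show thesis
  proof (cases "?v = 0")
    case True
    then have "hw p z w" using w(1) k by (auto simp: hw_def)
    then show thesis using w(2) that by blast
  next
    case False
    have vF: "?v \<in> F (p + deg2 ?Q)" by (rule T_in) (use w in auto)
    have "T y (p + deg2 ?Q) (z + of_int (deg2 ?Q)) ?v = 0" if y: "neg y" for y
    proof (cases "y = ?Q")
      case True
      have "T \<beta> p z w = 0" if "\<beta> \<in> Poly_Mapping.keys (bms_basis_bracket ?Q ?Q)" for \<beta>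
        using that by (intro k) (auto simp: in_keys_iff lookup_add lookup_single when_def split: if_splits)
      then have s: "(\<Sum>\<beta>\<in>Poly_Mapping.keys (bms_basis_bracket ?Q ?Q).
          Poly_Mapping.lookup (bms_basis_bracket ?Q ?Q) \<beta> *s T \<beta> p z w) = 0" by (intro sum.neutral) auto
      have "T ?Q (p + deg2 ?Q) (z + of_int (deg2 ?Q)) ?v = - T ?Q (p + deg2 ?Q) (z + of_int (deg2 ?Q)) ?v"
        using T_bracket[of ?Q ?Q w p z] w(1) unfolding s by (simp add: parity_sign_def)
      then have "2 *s T ?Q (p + deg2 ?Q) (z + of_int (deg2 ?Q)) ?v = 0"
        by (metis add.right_inverse one_add_one scale_left_distrib scale_one)
      then show ?thesis using True by simp
    next
      case False
      show ?thesis
      proof (rule T_bracket_zero)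
        fix \<beta> assume "\<beta> \<in> Poly_Mapping.keys (bms_basis_bracket y ?Q)"
        then show "T \<beta> p z w = 0" using y False
          by (intro k; cases y) (auto simp: in_keys_iff lookup_add lookup_minus lookup_uminus lookup_single when_def split: if_splits)
      qed (use y False w k neg_low in auto)
    qed
    then have "hw (p + deg2 ?Q) (z + of_int (deg2 ?Q)) ?v" using vF by (simp add: hw_def)
    then show thesis using False that by blast
  qed
qed

lemma hw_I0:
  assumes v: "hw p z v" shows "hw p z (T (bmsI 0) p z v)"
proof -
  have vF: "v \<in> F p" and k: "\<And>y. neg y \<Longrightarrow> T y p z v = 0" using v by (auto simp: hw_def)
  have "T y (p + deg2 (bmsI 0)) (z + of_int (deg2 (bmsI 0))) (T (bmsI 0) p z v) = 0" if y: "neg y" for y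
  proof (rule T_bracket_zero)
    fix \<beta> assume "\<beta> \<in> Poly_Mapping.keys (bms_basis_bracket y (bmsI 0))"
    then show "T \<beta> p z v = 0" using y
      by (intro k; cases y) (auto simp: in_keys_iff lookup_add lookup_minus lookup_uminus lookup_single when_def split: if_splits)
  qed (use y vF k neg_low in auto)
  moreover have "T (bmsI 0) p z v \<in> F p" using T_in[of "bmsI 0" v p z] vF by simp
  ultimately show ?thesis by (simp add: hw_def)
qed

lemma T_const:
  assumes "low x" "upc x = 0" "w \<in> F p" shows "T x p z w = T x p 0 w"
  by (rule vpoly_eq_by_steps[OF T_vpoly[OF assms(1,3)] vpoly.const])
    (use T_shift[OF assms(1,3)] assms(2) in auto)

text \<open>\<open>I\<^sub>0\<close> is nilpotent on highest weight vectors: \<open>L\<^sub>-\<^sub>1 I\<^sub>1\<^sup>k v = - 2 k I\<^sub>1\<^sup>k\<^sup>-\<^sup>1 I\<^sub>0 v\<close>, and \<open>I\<^sub>1\<close> is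
  nilpotent since \<open>[I\<^sub>1, I\<^sub>0] = 0\<close> turns into the relation \<open>[F, E] = E\<^sup>2\<close> of constant matrices.\<close>

lemma highest_weight_I0:
  assumes v: "hw p z v" "v \<noteq> 0"
  obtains v' where "hw p z v'" "v' \<noteq> 0" "T (bmsI 0) p z v' = 0"
proof -
  define E where "E = T (bmsI 1) p 0"
  define G where "G = T (bmsI 0) p 0"
  define J where "J = T (bmsI 0) p z"
  have E: "T (bmsI 1) p y w = E w" if "w \<in> F p" for y w
    using T_const[of "bmsI 1" w p y] that by (simp add: E_def)
  have Elin: "lin_on (F p) (F p) E" unfolding E_def by (rule T_lin_even[of _ 1]) auto
  have Glin: "lin_on (F p) (F p) G" unfolding G_def by (rule T_lin_even[of _ 0]) auto
  have EF: "E w \<in> F p" "(E ^^ k) w \<in> F p" if "w \<in> F p" for w k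
    using that lin_onD(1)[OF Elin] by (induction k) auto
  have pc: "T x (p + 2) = T x p" for x by (rule T_cong) simp
  have comm: "T (bmsI 0) p (y + 2) (E w) = E (T (bmsI 0) p y w)" if w: "w \<in> F p" for y w
  proof -
    have "T (bmsI 0) p y w \<in> F p" using T_in[of "bmsI 0" w p y] w by simp
    then show ?thesis using T_bracket[of "bmsI 1" "bmsI 0" w p y] w E pc by (simp add: parity_sign_def)
  qed
  have EG: "G (E w) = E (G w) + E (E w)" if w: "w \<in> F p" for w
  proof -
    have "T (bmsI 0) p (0 + 2) (E w) = G (E w) - E (E w)"
      using T_shift[of "bmsI 0" "E w" p 0] EF(1)[OF w] E[of "E w" 0] by (simp add: G_def)
    with comm[OF w, of 0] show ?thesis by (simp add: G_def)
  qed
  obtain B where B: "finite B" "span B = F p" using F_basis by blast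
  obtain K where K: "\<And>w. w \<in> F p \<Longrightarrow> (E ^^ K) w = 0"
    by (rule nilpotent_of_commutator_square[OF B(1), of E G, unfolded B(2), OF Elin Glin EG])
      (assumption, rule that, blast)
  have commk: "T (bmsI 0) p (z + 2 * of_nat k) ((E ^^ k) w) = (E ^^ k) (J w)" if w: "w \<in> F p" for k w
  proof (induction k)
    case (Suc k)
    have "T (bmsI 0) p (z + 2 * of_nat k + 2) (E ((E ^^ k) w)) = E (T (bmsI 0) p (z + 2 * of_nat k) ((E ^^ k) w))"
      by (rule comm[OF EF(2)[OF w]])
    then show ?case using Suc by (simp add: algebra_simps)
  qed (simp add: J_def)
  have Lm1: "T (bmsL (-1)) p (z + 2 * of_nat k) ((E ^^ k) u) = (- 2 * of_nat k) *s (E ^^ (k - 1)) (J u)"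
    if u: "hw p z u" for k u
  proof (induction k)
    case 0
    show ?case using u by (simp add: hw_def)
  next
    case (Suc k)
    have uF: "u \<in> F p" using u by (simp add: hw_def)
    have JF: "J u \<in> F p" using hw_I0[OF u] by (simp add: hw_def J_def)
    let ?w = "(E ^^ k) u" and ?y = "z + 2 * of_nat k"
    have wF: "?w \<in> F p" by (rule EF(2)[OF uF])
    have LF: "T (bmsL (-1)) p ?y ?w \<in> F p" using T_in[of "bmsL (-1)" ?w p ?y] wF by simp
    have pm: "T (bmsI 1) (p - 2) = T (bmsI 1) p" by (rule T_cong) presburger
    have "T (bmsL (-1)) p (?y + 2) (E ?w) = E (T (bmsL (-1)) p ?y ?w) + (- 2) *s T (bmsI 0) p ?y ?w"
      using T_bracket[of "bmsL (-1)" "bmsI 1" ?w p ?y] wF E[OF wF] E[OF LF] pc pm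
      by (simp add: parity_sign_def)
    also have "E (T (bmsL (-1)) p ?y ?w) = (- 2 * of_nat k) *s (E ^^ k) (J u)"
    proof (cases k)
      case 0
      then show ?thesis using Suc lin_on_0[OF Elin F_subspace] by simp
    next
      case (Suc j)
      then show ?thesis unfolding Suc.IH using lin_onD(3)[OF Elin] EF(2)[OF JF] \<open>T (bmsL (-1)) p ?y ?w = _\<close>
        by (simp del: scale_minus_left)
    qed
    also have "(- 2 * of_nat k) *s (E ^^ k) (J u) + (- 2) *s T (bmsI 0) p ?y ?w
        = (- 2 * of_nat (Suc k)) *s (E ^^ k) (J u)"
      unfolding commk[OF uF] by (simp add: scale_left_distrib[symmetric] del: scale_minus_left)
    finally show ?case by (simp add: algebra_simps)
  qed
  have hwJ: "hw p z ((J ^^ j) v)" for j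
    by (induction j) (use v hw_I0 in \<open>auto simp: J_def\<close>)
  have nil: "(E ^^ (K - j)) ((J ^^ j) u) = 0" if "hw p z u" "j \<le> K" for j u
    using that
  proof (induction j)
    case 0
    then show ?case using K by (simp add: hw_def)
  next
    case (Suc j)
    have hwj: "hw p z ((J ^^ j) u)"
      by (induction j) (use Suc.prems hw_I0 in \<open>auto simp: J_def\<close>)
    have z0: "(E ^^ (K - j)) ((J ^^ j) u) = 0" using Suc by simp
    have "T (bmsL (-1)) p (z + 2 * of_nat (K - j)) 0 = 0"
      by (rule lin_on_0[OF T_lin_even[of _ "-1"] F_subspace]) auto
    then have "(- 2 * of_nat (K - j)) *s (E ^^ (K - j - 1)) (J ((J ^^ j) u)) = 0"
      using Lm1[OF hwj, of "K - j"] z0 by simp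
    moreover have "- 2 * of_nat (K - j) \<noteq> (0::complex)" using Suc.prems(2) by simp
    ultimately show ?case by (simp only: scale_eq_0_iff) simp
  qed
  have "(J ^^ K) v = 0" using nil[OF v(1) order_refl] by simp
  then have ex: "\<exists>j. (J ^^ j) v = 0" by blast
  define j where "j = (LEAST j. (J ^^ j) v = 0)"
  have j: "(J ^^ j) v = 0" unfolding j_def using ex by (rule LeastI_ex)
  have "j \<noteq> 0" using j v(2) by (cases j) auto
  then obtain i where i: "j = Suc i" by (cases j) auto
  have "(J ^^ i) v \<noteq> 0" using not_less_Least[of i "\<lambda>j. (J ^^ j) v = 0"] i j_def by simp
  moreover have "T (bmsI 0) p z ((J ^^ i) v) = 0" using j i by (simp add: J_def)
  ultimately show thesis using that hwJ by blast
qed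

text \<open>Applying \<open>Q\<^sub>1\<^sub>/\<^sub>2\<close> repeatedly to a highest weight vector that \<open>I\<^sub>0\<close> kills produces highest weight
  vectors, on which the Casimir operator has infinitely many different eigenvalues unless one of
  them vanishes.\<close>

lemma singular_vector_exists:
  assumes F0: "F p0 \<noteq> {0}"
  obtains p z v where "v \<in> F p" "v \<noteq> 0" "T (bmsL (-1)) p z v = 0" "T (bmsL (-2)) p z v = 0"
    "T (bmsQ 0) p z v = 0"
proof -
  obtain p z v0 where "hw p z v0" "v0 \<noteq> 0" using highest_weight_exists[OF F0] by blast
  then obtain v where v: "hw p z v" "v \<noteq> 0" "T (bmsI 0) p z v = 0" using highest_weight_I0 by blast
  define hw0 where "hw0 p z v \<longleftrightarrow> hw p z v \<and> T (bmsI 0) p z v = 0" for p z v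
  have step: "hw0 (p + 1) (z + 1) (T (bmsQ 0) p z v)" if h: "hw0 p z v" for p z v
  proof -
    have vF: "v \<in> F p" and k: "\<And>y. neg y \<or> y = bmsI 0 \<Longrightarrow> T y p z v = 0" using h by (auto simp: hw_def hw0_def)
    have "T y (p + deg2 (bmsQ 0)) (z + of_int (deg2 (bmsQ 0))) (T (bmsQ 0) p z v) = 0" if y: "neg y \<or> y = bmsI 0" for y
    proof (rule T_bracket_zero)
      fix \<beta> assume "\<beta> \<in> Poly_Mapping.keys (bms_basis_bracket y (bmsQ 0))"
      then show "T \<beta> p z v = 0" using y
        by (intro k; cases y) (auto simp: in_keys_iff lookup_add lookup_minus lookup_uminus lookup_single when_def
            power2_eq_square eq_neg_iff_add_eq_0[symmetric, of _ "1::int"] split: if_splits)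
    qed (use y vF k neg_low in auto)
    moreover have "T (bmsQ 0) p z v \<in> F (p + 1)" using T_in[of "bmsQ 0" v p z] vF by simp
    ultimately show ?thesis by (auto simp: hw0_def hw_def)
  qed
  define V where "V = rec_nat v (\<lambda>j u. T (bmsQ 0) (p + int j) (z + of_nat j) u)"
  have V0: "V 0 = v" and VS: "V (Suc j) = T (bmsQ 0) (p + int j) (z + of_nat j) (V j)" for j
    by (simp_all add: V_def)
  have hV: "hw0 (p + int j) (z + of_nat j) (V j)" for j
  proof (induction j)
    case 0
    then show ?case using v by (simp add: V0 hw0_def)
  next
    case (Suc j)
    from step[OF Suc] show ?case by (simp add: VS algebra_simps)
  qed
  have "\<exists>j. V j = 0"
  proof (rule ccontr)
    assume "\<not> (\<exists>j. V j = 0)"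
    then have nz: "V j \<noteq> 0" for j by blast
    let ?s = "\<lambda>i::nat. l + z / 2 + of_nat i"
    let ?c = "\<lambda>i. - (?s i ^ 2 - ?s i)"
    obtain B where B: "finite B" "span B = F p" using F_basis by blast
    have "finite {r. \<exists>u\<in>F p. u \<noteq> 0 \<and> Cop p u = r *s u}"
      using finite_eigenvalues[OF B(1), of "Cop p"] Cop_lin unfolding B(2) by blast
    moreover have "?c i \<in> {r. \<exists>u\<in>F p. u \<noteq> 0 \<and> Cop p u = r *s u}" for i
    proof -
      let ?u = "V (2 * i)"
      have "hw (p + int (2 * i)) (z + of_nat (2 * i)) ?u" using hV[of "2 * i"] by (simp add: hw0_def)
      moreover have Fe: "F (p + int (2 * i)) = F p" "T x (p + int (2 * i)) = T x p" for x
        by (auto intro!: F_cong T_cong)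
      ultimately have u: "?u \<in> F p" "T (bmsL (-1)) p (z + of_nat (2 * i)) ?u = 0" by (auto simp: hw_def)
      have "l + (z + of_nat (2 * i)) / 2 = ?s i" by (simp add: add_divide_distrib)
      then have "Cop p ?u = ?c i *s ?u"
        using u(2) T_Lm1[OF u(1), of "z + of_nat (2 * i)"]
        by (simp only: scale_minus_left eq_neg_iff_add_eq_0 add.commute)
      then show ?thesis using u(1) nz by blast
    qed
    ultimately have fin: "finite (range ?c)" by (meson finite_subset image_subsetI)
    obtain M :: nat where M: "1 - Re (l + z / 2) < of_nat M" using reals_Archimedean2 by blast
    have "inj_on ?c {M..}"
    proof (rule inj_onI)
      fix i j assume ij: "i \<in> {M..}" "j \<in> {M..}" "?c i = ?c j"
      have "(a - b) * (a + b - 1) = - (b ^ 2 - b) - - (a ^ 2 - a)" for a b :: complex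
        by (simp add: power2_eq_square algebra_simps)
      then have "(?s i - ?s j) * (?s i + ?s j - 1) = ?c j - ?c i" .
      also have "\<dots> = 0" unfolding ij(3) by (rule diff_self)
      finally have "(?s i - ?s j) * (?s i + ?s j - 1) = 0" .
      moreover have "?s i + ?s j - 1 \<noteq> 0"
      proof
        assume "?s i + ?s j - 1 = 0"
        then have "Re (?s i + ?s j - 1) = 0" by simp
        moreover have "of_nat M \<le> real i" "of_nat M \<le> real j" using ij by auto
        ultimately show False using M by simp
      qed
      ultimately show "i = j" by simp
    qed
    then have "finite {M..}" using fin by (meson finite_imageD finite_subset image_mono subset_UNIV)
    then show False by (simp add: infinite_Ici)
  qed
  define j where "j = (LEAST j. V j = 0)"
  have j: "V j = 0" unfolding j_def using \<open>\<exists>j. V j = 0\<close> by (rule LeastI_ex)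
  have "j \<noteq> 0" using j v(2) V0 by (cases j) auto
  then obtain i where i: "j = Suc i" by (cases j) auto
  have nz: "V i \<noteq> 0" using not_less_Least[of i "\<lambda>j. V j = 0"] i j_def by simp
  have "hw (p + int i) (z + of_nat i) (V i)" using hV[of i] by (simp add: hw0_def)
  then show thesis
    using that[of "V i" "p + int i" "z + of_nat i"] nz j i VS[of i] by (auto simp: hw_def)
qed

end

section \<open>The half line through a singular vector\<close>

lemma poly_nonzero_eventually:
  fixes P :: "complex poly"
  assumes "P \<noteq> 0"
  shows "\<exists>N::int. \<forall>h\<ge>N. poly P (l + of_int h / 2) \<noteq> 0"
proof -
  let ?S = "{h::int. poly P (l + of_int h / 2) = 0}"
  have "inj (\<lambda>h::int. l + of_int h / 2)" by (auto simp: inj_def)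
  then have "finite ?S"
    using finite_vimageI[OF poly_roots_finite[OF assms], of "\<lambda>h::int. l + of_int h / 2"] by (simp add: vimage_def)
  then obtain M where M: "\<forall>h\<in>?S. h \<le> M" by (meson bdd_above.E bdd_above_finite)
  have "poly P (l + of_int h / 2) \<noteq> 0" if "h \<ge> M + 1" for h
    using M that by fastforce
  then show ?thesis by blast
qed

text \<open>The eigenvalues of \<open>L\<^sub>-\<^sub>1\<close> and \<open>L\<^sub>-\<^sub>2\<close> on the vector of weight \<open>s\<close> of \<open>\<A>\<^sub>0\<^sub>,\<^sub>b\<close>, continued to complex \<open>s\<close>,
  after a normalization in which \<open>L\<^sub>1\<close> maps basis vectors to basis vectors.\<close>

definition ell1 :: "complex \<Rightarrow> complex \<Rightarrow> complex" where
  "ell1 b s = (s - b) * (s + b - 1)"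

definition ell2 :: "complex \<Rightarrow> complex \<Rightarrow> complex" where
  "ell2 b s = - (s - 2 * b) * (s + b - 2) * (s + b - 1)"

text \<open>With \<open>x\<close> and \<open>y\<close> as the values of \<open>L\<^sub>2\<close> at \<open>s - 2\<close> and at \<open>s\<close>, these are the relations
  \<open>L\<^sub>2 L\<^sub>-\<^sub>1\<^sup>2 = L\<^sub>-\<^sub>1\<^sup>2 L\<^sub>2 + 3 L\<^sub>-\<^sub>1 L\<^sub>1 + 3 L\<^sub>1 L\<^sub>-\<^sub>1\<close> and \<open>[L\<^sub>2, L\<^sub>-\<^sub>2] = 4 L\<^sub>0\<close> in \<open>\<A>\<^sub>0\<^sub>,\<^sub>b\<close>.\<close>

lemma ell_identities:
  fixes b s x y :: complex
  assumes x: "x * ((s + b - 2) * (s + b - 1)) = - (s - 2 + 2 * b)"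
    and y: "y * ((s + b) * (s + b + 1)) = - (s + 2 * b)"
  shows "ell1 b (s - 1) * ell1 b s * x = ell1 b (s + 1) * ell1 b (s + 2) * y + 3 * (ell1 b (s + 1) + ell1 b s)"
    and "ell2 b s * x = ell2 b (s + 2) * y - 4 * s"
proof -
  have e: "ell1 b (s - 1) = (s - 1 - b) * (s + b - 2)" "ell1 b (s + 1) = (s + 1 - b) * (s + b)"
    "ell1 b (s + 2) = (s + 2 - b) * (s + b + 1)" "ell2 b (s + 2) = - (s + 2 - 2 * b) * ((s + b) * (s + b + 1))"
    by (simp_all add: ell1_def ell2_def algebra_simps)
  have 1: "ell1 b (s - 1) * ell1 b s * x = (s - 1 - b) * (s - b) * (x * ((s + b - 2) * (s + b - 1)))"
    unfolding e unfolding ell1_def by (simp only: mult_ac)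
  have 2: "ell1 b (s + 1) * ell1 b (s + 2) * y = (s + 1 - b) * (s + 2 - b) * (y * ((s + b) * (s + b + 1)))"
    unfolding e by (simp only: mult_ac)
  show "ell1 b (s - 1) * ell1 b s * x = ell1 b (s + 1) * ell1 b (s + 2) * y + 3 * (ell1 b (s + 1) + ell1 b s)"
    unfolding 1 2 x y by (simp add: ell1_def algebra_simps)
  have 3: "ell2 b s * x = - (s - 2 * b) * (x * ((s + b - 2) * (s + b - 1)))"
    unfolding ell2_def by (simp only: mult_ac)
  have 4: "ell2 b (s + 2) * y = - (s + 2 - 2 * b) * (y * ((s + b) * (s + b + 1)))"
    unfolding e by (simp only: mult_ac)
  show "ell2 b s * x = ell2 b (s + 2) * y - 4 * s"
    unfolding 3 4 x y by (simp add: algebra_simps)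
qed

lemma ell_identity_single:
  fixes b s x y :: complex
  assumes x: "x * ((s + b - 1) * (s + b)) = - (s - 1 + 2 * b)"
    and y: "y * ((s + b) * (s + b + 1)) = - (s + 2 * b)" and nz: "s + b \<noteq> 0"
  shows "ell1 b s * x = ell1 b (s + 2) * y + 3"
proof -
  have e: "ell1 b (s + 2) = (s + 2 - b) * (s + b + 1)"
    by (simp add: ell1_def algebra_simps)
  have 1: "(s + b) * (ell1 b s * x) = (s - b) * (x * ((s + b - 1) * (s + b)))"
    unfolding ell1_def by (simp only: mult_ac)
  have 2: "(s + b) * (ell1 b (s + 2) * y + 3) = (s + 2 - b) * (y * ((s + b) * (s + b + 1))) + 3 * (s + b)"
  proof -
    have "(s + b) * (ell1 b (s + 2) * y + 3) = (s + b) * (ell1 b (s + 2) * y) + 3 * (s + b)"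
      by (simp only: distrib_left mult.commute)
    then show ?thesis unfolding e by (simp only: mult_ac)
  qed
  have "(s + b) * (ell1 b s * x) = (s + b) * (ell1 b (s + 2) * y + 3)"
    unfolding 1 2 x y by (simp add: algebra_simps)
  with nz show ?thesis by simp
qed

text \<open>The determinant of these two relations as equations for \<open>x\<close> and \<open>y\<close>.\<close>

definition theta :: "complex \<Rightarrow> complex \<Rightarrow> complex" where
  "theta b s = ell2 b s * (ell1 b (s + 1) * ell1 b (s + 2)) - ell1 b (s - 1) * ell1 b s * ell2 b (s + 2)"

lemma theta_eq: "theta b s = (s + b - 2) * (s + b - 1) * (s + b) * (s + b + 1) *
    poly [:6 * b - 6 * b ^ 2, 8 * b - 4, -2:] s"
  unfolding theta_def ell1_def ell2_def by (simp add: power2_eq_square) algebra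

lemma theta_difference:
  "ell1 b (s - 2) * theta b s - ell1 b (s + 2) * theta b (s - 1) =
     (s + b - 3) * (s + b - 2) * (s + b - 1) * (s + b) * (s + b + 1) * poly [:16 * b ^ 2 - 6 * b - 4, 6 - 20 * b, 4:] s"
  unfolding theta_eq unfolding ell1_def by (simp add: power2_eq_square) algebra

context bms_gauge
begin

text \<open>At each complex weight, \<open>L\<^sub>-\<^sub>1\<close> and \<open>L\<^sub>-\<^sub>2\<close> act on the vector with the eigenvalues known from \<open>\<A>\<^sub>0\<^sub>,\<^sub>b\<close>.\<close>

definition eigenline :: "int \<Rightarrow> complex \<Rightarrow> 'a \<Rightarrow> bool" where
  "eigenline p b v \<longleftrightarrow> v \<in> F p \<and> (\<forall>z. T (bmsL (-1)) p z v = ell1 b (l + z / 2) *s v) \<and>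
     (\<forall>z. T (bmsL (-2)) p z v = ell2 b (l + z / 2) *s v)"

text \<open>If \<open>L\<^sub>-\<^sub>1\<close> and \<open>L\<^sub>-\<^sub>2\<close> kill the vector at one weight \<open>t\<close>, then the constant terms \<open>Cop\<close> and \<open>Dop\<close> act on
  it by scalars. The resulting polynomials in \<open>s\<close> vanish at \<open>t\<close>, and they factor with \<open>b = 1 - t\<close>.\<close>

lemma eigenlineI:
  assumes v: "v \<in> F p" "T (bmsL (-1)) p z0 v = 0" "T (bmsL (-2)) p z0 v = 0"
  shows "eigenline p (1 - (l + z0 / 2)) v"
proof -
  let ?t = "l + z0 / 2"
  let ?b = "1 - ?t"
  have C: "Cop p v = (- (?t ^ 2 - ?t)) *s v"
    using v(2) T_Lm1[OF v(1), of z0] by (simp only: scale_minus_left eq_neg_iff_add_eq_0 add.commute)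
  have D: "Dop p v = (- (?t ^ 3 - 3 * ?t ^ 2 + 2 * ?t) - (3 * ?t) * (- (?t ^ 2 - ?t))) *s v"
    using v(3) T_Lm2[OF v(1), of z0] unfolding C by (simp only: scale_left_diff_distrib scale_scale) simp
  have "T (bmsL (-1)) p z v = ell1 ?b (l + z / 2) *s v" for z
  proof -
    have "(s ^ 2 - s) + (- (t ^ 2 - t)) = ell1 (1 - t) s" for s t
      by (simp add: ell1_def power2_eq_square algebra_simps)
    then show ?thesis unfolding T_Lm1[OF v(1)] C by (simp only: scale_left_distrib[symmetric])
  qed
  moreover have "T (bmsL (-2)) p z v = ell2 ?b (l + z / 2) *s v" for z
  proof -
    have "- (s ^ 3 - 3 * s ^ 2 + 2 * s) - (3 * s) * (- (t ^ 2 - t))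
        - (- (t ^ 3 - 3 * t ^ 2 + 2 * t) - (3 * t) * (- (t ^ 2 - t))) = ell2 (1 - t) s" for s t
      by (simp add: ell2_def power2_eq_square power3_eq_cube algebra_simps)
    then show ?thesis
      unfolding T_Lm2[OF v(1)] D C by (simp only: scale_left_diff_distrib[symmetric] scale_scale)
  qed
  ultimately show ?thesis using v(1) by (simp add: eigenline_def)
qed

lemma eigenline_C1:
  assumes v: "eigenline p b v" shows "eigenline p b (T bmsC1 p 0 v)"
proof -
  have vF: "v \<in> F p" using v by (simp add: eigenline_def)
  have c: "T bmsC1 p' z w = T bmsC1 p 0 w" if "w \<in> F p" "p' mod 2 = p mod 2" for w z p'
    using T_const[of bmsC1 w p z] T_cong[OF that(2)] that(1) by simp
  have "T (bmsL k) p z (T bmsC1 p 0 v) = r *s T bmsC1 p 0 v"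
    if "T (bmsL k) p z v = r *s v" "k \<le> 1" for k z r
  proof -
    have "T (bmsL k) p z (T bmsC1 p z v) = T bmsC1 (p + 2 * k) (z + of_int (2 * k)) (T (bmsL k) p z v)"
      using T_bracket[of "bmsL k" bmsC1 v p z] vF that(2) by (simp add: parity_sign_def)
    also have "\<dots> = T bmsC1 p 0 (T (bmsL k) p z v)"
      by (rule c) (use T_in[of "bmsL k" v p z] vF that(2) in auto)
    also have "\<dots> = r *s T bmsC1 p 0 v"
      unfolding that(1) by (rule lin_onD(3)[OF T_lin[of bmsC1 p 0] vF]) simp
    finally show ?thesis using c[OF vF refl, of z] by simp
  qed
  moreover have "T bmsC1 p 0 v \<in> F p" using T_in[of bmsC1 v p 0] vF by simp
  ultimately show ?thesis using v by (simp add: eigenline_def)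
qed

lemma brk2_Lm2: "brk2 (bmsL (-2)) p z w = 4 *s T (bmsL 0) p z w + (1/2) *s T bmsC1 p z w"
proof -
  let ?u = "bms_basis_bracket (bmsL 2) (bmsL (-2))"
  have u: "?u = Poly_Mapping.single (bmsL 0) 4 + Poly_Mapping.single bmsC1 (1/2)" by simp
  have "Poly_Mapping.keys ?u \<subseteq> {bmsL 0, bmsC1}"
    unfolding u by (auto simp: in_keys_iff lookup_add lookup_single when_def split: if_splits)
  then have "brk2 (bmsL (-2)) p z w = (\<Sum>\<beta>\<in>{bmsL 0, bmsC1}. Poly_Mapping.lookup ?u \<beta> *s T \<beta> p z w)"
    unfolding brk2_def by (intro sum.mono_neutral_left) (auto simp: in_keys_iff)
  then show ?thesis unfolding u by (simp add: lookup_add lookup_single)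
qed

text \<open>For large \<open>s\<close> the vector \<open>L\<^sub>2 v\<close> is determined by its commutators with \<open>L\<^sub>-\<^sub>1\<close> and \<open>L\<^sub>-\<^sub>2\<close> up to a
  multiple of \<open>C\<^sub>1 v\<close>. Comparing the multiples at \<open>s\<close> and \<open>s - 1\<close> shows \<open>C\<^sub>1 v = 0\<close>.\<close>

lemma eigenline_L2:
  assumes v: "eigenline p b v"
  shows "\<exists>N::int. T bmsC1 p 0 v = 0 \<and> (\<forall>h\<ge>N. h mod 2 = p mod 2 \<longrightarrow>
     l + of_int h / 2 + b \<noteq> 0 \<and> l + of_int h / 2 + b + 1 \<noteq> 0 \<and>
     b2 h v = (- (l + of_int h / 2 + 2 * b) / ((l + of_int h / 2 + b) * (l + of_int h / 2 + b + 1))) *s v)"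
proof -
  let ?k = "T bmsC1 p 0 v"
  have vF: "v \<in> F p" using v by (simp add: eigenline_def)
  have kl: "eigenline p b ?k" by (rule eigenline_C1[OF v])
  have kF: "?k \<in> F p" using kl by (simp add: eigenline_def)
  let ?c = "b * (1 - b)" and ?d = "2 * b * (1 - b) * (b - 2)"
  obtain B where B: "finite B" "independent B" "span B = F p" using F_basis by blast
  have fin: "finite {()}" and C: "lin_on (span B) (span B) (Cop p)" and D: "lin_on (span B) (span B) (Dop p)"
    unfolding B(3) by (rule finite.intros Cop_lin Dop_lin | simp)+
  from solve_pair_system_vec[OF fin B(1,2) C D, of "\<lambda>_ _. ?c" "\<lambda>_ _. ?c * ?c" "\<lambda>_ _. ?d"]
  obtain q R1 R2 where q: "q \<noteq> 0"
    and Rl: "\<forall>x y s. lin_on (F p) (F p) (R1 x y s) \<and> lin_on (F p) (F p) (R2 x y s)"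
    and main: "\<forall>s u v r1 r2. (\<forall>x\<in>{()}. u x \<in> F p \<and> v x \<in> F p \<and> r1 x \<in> F p \<and> r2 x \<in> F p) \<longrightarrow>
     (\<forall>x\<in>{()}. (s^4 - 4 * s^3 + 5 * s^2 - 2 * s) *s u x + (2 * s^2 - 4 * s + 2) *s (\<Sum>y\<in>{()}. ?c *s u y) + (\<Sum>y\<in>{()}. (?c * ?c) *s u y)
        = (s^4 + 4 * s^3 + 5 * s^2 + 2 * s) *s v x + (2 * s^2 + 4 * s + 2) *s Cop p (v x) + Cop p (Cop p (v x)) + r1 x) \<longrightarrow>
     (\<forall>x\<in>{()}. (- (s^3 - 3 * s^2 + 2 * s)) *s u x - (3 * s) *s (\<Sum>y\<in>{()}. ?c *s u y) - (\<Sum>y\<in>{()}. ?d *s u y)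
        = (- (s^3 + 3 * s^2 + 2 * s)) *s v x - (3 * (s + 2)) *s Cop p (v x) - Dop p (v x) + r2 x) \<longrightarrow>
     (\<forall>x\<in>{()}. poly q s *s v x = (\<Sum>y\<in>{()}. R1 x y s (r1 y) + R2 x y s (r2 y)))"
    unfolding B(3) by (elim exE conjE) (rule that)
  have unique: "poly q s *s w = 0"
    if "u \<in> F p" "w \<in> F p"
      and e1: "(s^4 - 4 * s^3 + 5 * s^2 - 2 * s) *s u + (2 * s^2 - 4 * s + 2) *s (?c *s u) + (?c * ?c) *s u
        = (s^4 + 4 * s^3 + 5 * s^2 + 2 * s) *s w + (2 * s^2 + 4 * s + 2) *s Cop p w + Cop p (Cop p w)"
      and e2: "(- (s^3 - 3 * s^2 + 2 * s)) *s u - (3 * s) *s (?c *s u) - ?d *s u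
        = (- (s^3 + 3 * s^2 + 2 * s)) *s w - (3 * (s + 2)) *s Cop p w - Dop p w" for s u w
  proof -
    have "poly q s *s w = R1 () () s 0 + R2 () () s 0"
      using main[THEN spec[of _ s], THEN spec[of _ "\<lambda>_. u"], THEN spec[of _ "\<lambda>_. w"], THEN spec[of _ "\<lambda>_. 0"], THEN spec[of _ "\<lambda>_. 0"]]
        that subspace_0[OF F_subspace] by simp
    also have "\<dots> = 0" using Rl lin_on_0[OF _ F_subspace] by (metis add.right_neutral)
    finally show ?thesis .
  qed
  \<comment> \<open>The value of \<open>L\<^sub>2\<close> at the weight \<open>s\<close> in \<open>\<A>\<^sub>0\<^sub>,\<^sub>b\<close>, normalized as in \<open>ell1\<close>.\<close>
  define be where "be s = - (s + 2 * b) / ((s + b) * (s + b + 1))" for s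
  define X where "X c = [:c, 1::complex:]" for c
  \<comment> \<open>The product of all factors that must not vanish in the computation below.\<close>
  define P where "P = q * X b * X (b + 1) * X (b - 1) * X (b - 2) * X (b - 3) * X (- b) * X (- b - 1) *
     [:6 * b - 6 * b ^ 2, 8 * b - 4, -2:] * [:16 * b ^ 2 - 6 * b - 4, 6 - 20 * b, 4:]"
  have "P \<noteq> 0" unfolding P_def mult_eq_0_iff de_Morgan_disj using q by (simp add: X_def)
  from poly_nonzero_eventually[OF this, of l] obtain N0 :: int
    where N0: "\<And>h. h \<ge> N0 \<Longrightarrow> poly P (l + of_int h / 2) \<noteq> 0" by blast
  define N where "N = \<bar>N0\<bar> + 4"
  define s where "s h = l + of_int h / 2" for h :: int
  have nz: "poly q (s h) \<noteq> 0" "s h + b \<noteq> 0" "s h + b + 1 \<noteq> 0" "s h + b - 1 \<noteq> 0" "s h + b - 2 \<noteq> 0" "s h + b - 3 \<noteq> 0"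
    "ell1 b (s h) \<noteq> 0" "ell1 b (s h - 1) \<noteq> 0" "theta b (s h) \<noteq> 0"
    "ell1 b (s h - 2) * theta b (s h) - ell1 b (s h + 2) * theta b (s h - 1) \<noteq> 0" if "h \<ge> N0" for h
  proof -
    define r where "r = s h"
    define G H where "G = [:6 * b - 6 * b ^ 2, 8 * b - 4, -2:]" and "H = [:16 * b ^ 2 - 6 * b - 4, 6 - 20 * b, 4:]"
    have Xp: "poly (X c) r = r + c" for c by (simp add: X_def)
    have "poly q r * (r + b) * (r + (b + 1)) * (r + (b - 1)) * (r + (b - 2)) * (r + (b - 3)) * (r + - b) * (r + (- b - 1))
        * poly G r * poly H r \<noteq> 0"
      using N0[OF that] unfolding P_def G_def[symmetric] H_def[symmetric] poly_mult s_def[symmetric] r_def[symmetric] Xp .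
    then have f: "poly q r \<noteq> 0" "r + b \<noteq> 0" "r + (b + 1) \<noteq> 0" "r + (b - 1) \<noteq> 0" "r + (b - 2) \<noteq> 0" "r + (b - 3) \<noteq> 0"
       "r + - b \<noteq> 0" "r + (- b - 1) \<noteq> 0" "poly G r \<noteq> 0" "poly H r \<noteq> 0"
      unfolding mult_eq_0_iff de_Morgan_disj by blast+
    have e: "r + b + 1 = r + (b + 1)" "r + b - 1 = r + (b - 1)" "r + b - 2 = r + (b - 2)" "r + b - 3 = r + (b - 3)"
      "ell1 b r = (r + - b) * (r + (b - 1))" "ell1 b (r - 1) = (r + (- b - 1)) * (r + (b - 2))"
      by (simp_all add: ell1_def algebra_simps)
    show "poly q (s h) \<noteq> 0" "s h + b \<noteq> 0" "s h + b + 1 \<noteq> 0" "s h + b - 1 \<noteq> 0" "s h + b - 2 \<noteq> 0" "s h + b - 3 \<noteq> 0"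
    "ell1 b (s h) \<noteq> 0" "ell1 b (s h - 1) \<noteq> 0" "theta b (s h) \<noteq> 0"
      unfolding r_def[symmetric] theta_eq G_def[symmetric] H_def[symmetric] e mult_eq_0_iff de_Morgan_disj
      using f by blast+
    show "ell1 b (s h - 2) * theta b (s h) - ell1 b (s h + 2) * theta b (s h - 1) \<noteq> 0"
      unfolding r_def[symmetric] theta_difference H_def[symmetric] e mult_eq_0_iff de_Morgan_disj
      using f by blast
  qed
  have s2: "s (h - 2) = s h - 1" "s (h - 4) = s h - 2" for h
    by (simp_all add: s_def diff_divide_distrib)
  have zs: "l + (of_int h + 2) / 2 = s h + 1" "l + (of_int h + 4) / 2 = s h + 2" "l + (of_int h - 2) / 2 = s h - 1" for h
    by (simp_all add: s_def add_divide_distrib diff_divide_distrib)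
  have be: "be (s h) * ((s h + b) * (s h + b + 1)) = - (s h + 2 * b)" if "h \<ge> N0" for h
    using nz(2,3)[OF that] by (simp add: be_def)
  have T1: "T (bmsL (-1)) p z w = ell1 b (l + z / 2) *s w" "T (bmsL (-2)) p z w = ell2 b (l + z / 2) *s w"
    if "w = v \<or> w = ?k" for z w
    using v kl that by (auto simp: eigenline_def)
  have bF: "b2 h v \<in> F p" if "h \<ge> 0" "h mod 2 = p mod 2" for h by (rule b2(1)[OF that(2,1) vF])
  have r1: "ell1 b (s h) *s b2 (h - 2) v = T (bmsL (-1)) p (of_int h + 4) (b2 h v) + 3 *s v"
    if h: "h \<ge> 2" "h mod 2 = p mod 2" for h
  proof -
    have "b2 (h - 2) (T (bmsL (-1)) p (of_int h) v) = T (bmsL (-1)) p (of_int h + 4) (b2 h v) + 3 *s v"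
      using b2_L[of "-1" v p h] vF h by (simp add: brk2_Lm1)
    moreover have "(h - 2) mod 2 = p mod 2" using h by presburger
    ultimately show ?thesis
      using T1(1)[of v "of_int h"] lin_onD(3)[OF b2_lin[of "h - 2" p], of v "ell1 b (s h)"] vF h by (simp add: s_def)
  qed
  have r2: "ell2 b (s h) *s b2 (h - 4) v = T (bmsL (-2)) p (of_int h + 4) (b2 h v) + (- 4 * s h) *s v + (1/2) *s ?k"
    if h: "h \<ge> 4" "h mod 2 = p mod 2" for h
  proof -
    have "brk2 (bmsL (-2)) p (of_int h) v = (- 4 * s h) *s v + (1/2) *s ?k"
    proof -
      have "brk2 (bmsL (-2)) p (of_int h) v = 4 *s T (bmsL 0) p (of_int h) v + (1/2) *s T bmsC1 p (of_int h) v"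
        by (rule brk2_Lm2)
      then show ?thesis using T_L0[OF vF, of "of_int h"] T_const[of bmsC1 v p "of_int h"] vF
        by (simp add: s_def)
    qed
    then have "b2 (h - 4) (T (bmsL (-2)) p (of_int h) v)
        = T (bmsL (-2)) p (of_int h + 4) (b2 h v) + ((- 4 * s h) *s v + (1/2) *s ?k)"
      using b2_L[of "-2" v p h] vF h by simp
    moreover have "(h - 4) mod 2 = p mod 2" using h by presburger
    ultimately show ?thesis
      using T1(2)[of v "of_int h"] lin_onD(3)[OF b2_lin[of "h - 4" p], of v "ell2 b (s h)"] vF h
      by (simp add: s_def add.assoc)
  qed
  \<comment> \<open>By Cramer's rule, these are the contributions of \<open>C\<^sub>1 v / 2\<close>, which occurs in \<open>[L\<^sub>2, L\<^sub>-\<^sub>2]\<close>, to \<open>L\<^sub>2 v\<close> at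
    the weights \<open>s\<close> and \<open>s - 2\<close>.\<close>
  let ?g2 = "\<lambda>s. ell1 b (s - 1) * ell1 b s / theta b s" and ?g1 = "\<lambda>s. ell1 b (s + 1) * ell1 b (s + 2) / theta b s"
  have sol: "b2 h v = be (s h) *s v + (?g2 (s h) / 2) *s ?k" if h: "h \<ge> N" "h mod 2 = p mod 2" for h
  proof -
    let ?s = "s h" and ?t = "T (bmsL (-1)) p" and ?t2 = "T (bmsL (-2)) p"
    have hN: "h \<ge> N0" "h - 4 \<ge> N0" "h \<ge> 4" "h \<ge> 2" "h - 2 \<ge> 2" "h \<ge> 0" "h - 4 \<ge> 0" "h - 2 \<ge> 0" using h by (auto simp: N_def)
    have hm: "(h - 2) mod 2 = p mod 2" "(h - 4) mod 2 = p mod 2" using h by presburger+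
    define u w where "u = b2 (h - 4) v - (be (?s - 2) *s v + (?g1 ?s / 2) *s ?k)"
      and "w = b2 h v - (be ?s *s v + (?g2 ?s / 2) *s ?k)"
    have sc: "c *s v + d *s ?k \<in> F p" for c d
      using vF kF by (intro subspace_add[OF F_subspace] subspace_scale[OF F_subspace])
    have uF: "u \<in> F p" unfolding u_def
      by (rule subspace_diff[OF F_subspace bF[OF hN(7) hm(2)] sc])
    have wF: "w \<in> F p" unfolding w_def
      by (rule subspace_diff[OF F_subspace bF[OF hN(6) h(2)] sc])
    note tl = lin_onD[OF T_lin_even[of "bmsL (-1)" "-1" p], simplified] and tl2 = lin_onD[OF T_lin_even[of "bmsL (-2)" "-2" p], simplified]
    note td = lin_on_diff[OF T_lin_even[of "bmsL (-1)" "-1" p] F_subspace, simplified]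
      and td2 = lin_on_diff[OF T_lin_even[of "bmsL (-2)" "-2" p] F_subspace, simplified]
    have tvk: "?t z (c *s v + d *s ?k) = ell1 b (l + z / 2) *s (c *s v + d *s ?k)"
      "?t2 z (c *s v + d *s ?k) = ell2 b (l + z / 2) *s (c *s v + d *s ?k)" for z c d
      using vF kF subspace_scale[OF F_subspace] by (simp_all add: tl tl2 T1 scale_right_distrib mult.commute)
    have be0: "be (?s - 2) * ((?s + b - 2) * (?s + b - 1)) = - (?s - 2 + 2 * b)"
      using be[OF hN(2)] unfolding s2 by (simp add: algebra_simps)
    have th: "theta b ?s \<noteq> 0" by (rule nz[OF hN(1)])
    have main1: "(ell1 b (?s - 1) * ell1 b ?s) *s u = ?t (of_int h + 2) (?t (of_int h + 4) w)"
    proof -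
      have "(ell1 b (?s - 1) * ell1 b ?s) *s b2 (h - 4) v = ell1 b ?s *s (?t (of_int h + 2) (b2 (h - 2) v) + 3 *s v)"
      proof -
        have "ell1 b (?s - 1) *s b2 (h - 4) v = ?t (of_int h + 2) (b2 (h - 2) v) + 3 *s v"
          using r1[OF hN(5) hm(1)] unfolding s2 by (simp add: algebra_simps)
        from arg_cong[OF this, of "\<lambda>w. ell1 b ?s *s w"] show ?thesis by (simp only: scale_scale mult.commute)
      qed
      also have "\<dots> = ?t (of_int h + 2) (ell1 b ?s *s b2 (h - 2) v) + (3 * ell1 b ?s) *s v"
        using tl(3)[OF bF[OF hN(8) hm(1)]] by (simp add: scale_right_distrib mult.commute)
      also have "\<dots> = ?t (of_int h + 2) (?t (of_int h + 4) (b2 h v)) + (3 * (ell1 b (?s + 1) + ell1 b ?s)) *s v"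
        unfolding r1[OF hN(4) h(2)]
        using tl vF bF[OF hN(6) h(2)] subspace_scale[OF F_subspace] T1(1)[of v "of_int h + 2"] zs(1)
        by (simp add: scale_left_distrib distrib_left mult.commute algebra_simps)
      finally have a: "(ell1 b (?s - 1) * ell1 b ?s) *s b2 (h - 4) v =
         ?t (of_int h + 2) (?t (of_int h + 4) (b2 h v)) + (3 * (ell1 b (?s + 1) + ell1 b ?s)) *s v" .
      have "?t (of_int h + 2) (?t (of_int h + 4) w) = ?t (of_int h + 2) (?t (of_int h + 4) (b2 h v))
          - (ell1 b (?s + 1) * ell1 b (?s + 2)) *s (be ?s *s v + (?g2 ?s / 2) *s ?k)"
      proof -
        define m where "m = be ?s *s v + (?g2 ?s / 2) *s ?k"
        have mF: "m \<in> F p" unfolding m_def by (rule sc)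
        have tm: "?t z m = ell1 b (l + z / 2) *s m" for z unfolding m_def by (rule tvk)
        note yF = bF[OF hN(6) h(2)]
        have "?t (of_int h + 4) (b2 h v - m) = ?t (of_int h + 4) (b2 h v) - ell1 b (?s + 2) *s m"
          by (simp only: td[OF yF mF] tm zs)
        then have "?t (of_int h + 2) (?t (of_int h + 4) (b2 h v - m)) =
            ?t (of_int h + 2) (?t (of_int h + 4) (b2 h v)) - ell1 b (?s + 2) *s (ell1 b (?s + 1) *s m)"
          by (simp only: td[OF tl(1)[OF yF] subspace_scale[OF F_subspace mF]] tl(3)[OF mF] tm zs)
        then show ?thesis unfolding w_def m_def[symmetric] by (simp only: scale_scale mult.commute)
      qed
      moreover have "(ell1 b (?s - 1) * ell1 b ?s) *s (be (?s - 2) *s v + (?g1 ?s / 2) *s ?k) =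
          (3 * (ell1 b (?s + 1) + ell1 b ?s)) *s v + (ell1 b (?s + 1) * ell1 b (?s + 2)) *s (be ?s *s v + (?g2 ?s / 2) *s ?k)"
        unfolding scale_right_distrib scale_scale ell_identities(1)[OF be0 be[OF hN(1)]]
        by (simp add: scale_left_distrib mult_ac add_ac)
      ultimately show ?thesis unfolding u_def scale_right_diff_distrib a by simp
    qed
    have main2: "ell2 b ?s *s u = ?t2 (of_int h + 4) w"
    proof -
      have "?t2 (of_int h + 4) w = ?t2 (of_int h + 4) (b2 h v) - ell2 b (?s + 2) *s (be ?s *s v + (?g2 ?s / 2) *s ?k)"
        unfolding w_def by (simp only: td2[OF bF[OF hN(6) h(2)] sc] tvk zs)
      moreover have "ell2 b ?s *s (be (?s - 2) *s v + (?g1 ?s / 2) *s ?k) =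
          (- 4 * ?s) *s v + (1/2) *s ?k + ell2 b (?s + 2) *s (be ?s *s v + (?g2 ?s / 2) *s ?k)"
      proof -
        have "ell2 b ?s * (?g1 ?s / 2) = 1/2 + ell2 b (?s + 2) * (?g2 ?s / 2)"
          using th by (simp add: theta_def field_simps)
        then show ?thesis
          unfolding scale_right_distrib scale_scale ell_identities(2)[OF be0 be[OF hN(1)]]
          by (simp add: scale_left_distrib scale_left_diff_distrib algebra_simps)
      qed
      ultimately show ?thesis unfolding u_def scale_right_diff_distrib r2[OF hN(3) h(2)] by simp
    qed
    have id1: "ell1 b (r - 1) * ell1 b r = (r^4 - 4 * r^3 + 5 * r^2 - 2 * r) + (2 * r^2 - 4 * r + 2) * ?c + ?c * ?c"
      "(((r + 1) ^ 2 - (r + 1)) * ((r + 2) ^ 2 - (r + 2))) = r^4 + 4 * r^3 + 5 * r^2 + 2 * r"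
      "((r + 1) ^ 2 - (r + 1)) + ((r + 2) ^ 2 - (r + 2)) = 2 * r^2 + 4 * r + 2"
      "ell2 b r = - (r^3 - 3 * r^2 + 2 * r) - 3 * r * ?c - ?d"
      "- ((r + 2) ^ 3 - 3 * (r + 2) ^ 2 + 2 * (r + 2)) = - (r^3 + 3 * r^2 + 2 * r)" for r :: complex
      unfolding ell1_def ell2_def by algebra+
    have e1: "(?s^4 - 4 * ?s^3 + 5 * ?s^2 - 2 * ?s) *s u + (2 * ?s^2 - 4 * ?s + 2) *s (?c *s u) + (?c * ?c) *s u
        = (?s^4 + 4 * ?s^3 + 5 * ?s^2 + 2 * ?s) *s w + (2 * ?s^2 + 4 * ?s + 2) *s Cop p w + Cop p (Cop p w)"
      using main1 unfolding T_Lm1_twice[OF wF] zs id1 by (simp only: scale_left_distrib scale_scale)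
    have e2: "(- (?s^3 - 3 * ?s^2 + 2 * ?s)) *s u - (3 * ?s) *s (?c *s u) - ?d *s u
        = (- (?s^3 + 3 * ?s^2 + 2 * ?s)) *s w - (3 * (?s + 2)) *s Cop p w - Dop p w"
      using main2 unfolding T_Lm2[OF wF] zs id1 by (simp only: scale_left_diff_distrib scale_scale)
    have "poly q ?s *s w = 0" by (rule unique[OF uF wF e1 e2])
    then have "w = 0" using nz(1)[OF hN(1)] by simp
    then show ?thesis by (simp add: w_def)
  qed
  have k0: "?k = 0"
  proof -
    define h where "h = p mod 2 + 2 * N"
    have h: "h \<ge> N" "h - 2 \<ge> N" "h mod 2 = p mod 2" "(h - 2) mod 2 = p mod 2" "h \<ge> N0" "h - 2 \<ge> N0" "h \<ge> 2" "h \<ge> 0"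
      using pos_mod_sign[of 2 p] by (auto simp: h_def N_def) presburger+
    let ?s = "s h"
    have be1: "be (?s - 1) * ((?s + b - 1) * (?s + b)) = - (?s - 1 + 2 * b)"
      using be[OF h(6)] unfolding s2 by (simp add: algebra_simps)
    have id3: "ell1 b ?s * be (?s - 1) = ell1 b (?s + 2) * be ?s + 3"
      by (rule ell_identity_single[OF be1 be[OF h(5)] nz(2)[OF h(5)]])
    have th: "theta b ?s \<noteq> 0" "theta b (?s - 1) \<noteq> 0"
      using nz(9)[OF h(5)] nz(9)[OF h(6)] by (simp_all add: s2)
    have "ell1 b ?s *s (be (?s - 1) *s v + (?g2 (?s - 1) / 2) *s ?k)
        = ell1 b (?s + 2) *s (be ?s *s v + (?g2 ?s / 2) *s ?k) + 3 *s v"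
    proof -
      have "T (bmsL (-1)) p (of_int h + 4) (be ?s *s v + (?g2 ?s / 2) *s ?k) =
          ell1 b (?s + 2) *s (be ?s *s v + (?g2 ?s / 2) *s ?k)"
        using lin_onD[OF T_lin_even[of "bmsL (-1)" "-1" p], simplified] vF kF subspace_scale[OF F_subspace]
        by (simp add: T1 zs scale_right_distrib mult.commute)
      then show ?thesis using r1[OF h(7,3)] unfolding sol[OF h(1,3)] sol[OF h(2,4)] s2 by simp
    qed
    then have "(ell1 b ?s * be (?s - 1)) *s v + (ell1 b ?s * ?g2 (?s - 1) / 2) *s ?k
        = (ell1 b (?s + 2) * be ?s + 3) *s v + (ell1 b (?s + 2) * ?g2 ?s / 2) *s ?k"
      by (simp add: scale_right_distrib scale_left_distrib add_ac)
    then have "((ell1 b ?s * ?g2 (?s - 1) - ell1 b (?s + 2) * ?g2 ?s) / 2) *s ?k = 0"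
      unfolding id3 by (simp add: diff_divide_distrib scale_left_diff_distrib)
    moreover have "(ell1 b ?s * ?g2 (?s - 1) - ell1 b (?s + 2) * ?g2 ?s) \<noteq> 0"
    proof -
      have "?s - 1 - 1 = ?s - 2" by simp
      then have "(ell1 b ?s * ?g2 (?s - 1) - ell1 b (?s + 2) * ?g2 ?s) * (theta b ?s * theta b (?s - 1))
         = ell1 b ?s * ell1 b (?s - 1) * (ell1 b (?s - 2) * theta b ?s - ell1 b (?s + 2) * theta b (?s - 1))"
        using th by (simp add: field_simps)
      also have "\<dots> \<noteq> 0" using nz[OF h(5)] by simp
      finally show ?thesis by auto
    qed
    ultimately show ?thesis by simp
  qed
  show ?thesis
    using k0 sol nz(2,3) by (intro exI[of _ N] conjI allI impI) (auto simp: be_def s_def N_def)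
qed

text \<open>The singular vector is placed at the positions \<open>h 0, h 1, \<dots>\<close>, which lie beyond the bound \<open>N\<close> for the
  formula for \<open>L\<^sub>2\<close>.\<close>

lemma normalized_line_exists:
  assumes F0: "F p0 \<noteq> {0}"
  obtains b c w where "\<And>n::nat. w n \<noteq> 0" "\<And>n. w n \<in> wt (c + of_nat n)" "\<And>n. c + of_nat n + b \<noteq> 0"
    "\<And>n. A (bmsL 1) (w n) = w (Suc n)" "\<And>n. A (bmsL (-1)) (w (Suc n)) = ell1 b (c + of_nat (Suc n)) *s w n"
    "\<And>n. A (bmsL (-2)) (w (Suc (Suc n))) = ell2 b (c + of_nat (Suc (Suc n))) *s w n"
    "\<And>n. A (bmsL 2) (w n) = (- (c + of_nat n + 2 * b) / ((c + of_nat n + b) * (c + of_nat n + b + 1))) *s w (Suc (Suc n))"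
    "\<And>n. A (bmsQ 0) (w n) = 0" "\<And>n. A bmsC1 (w n) = 0"
proof -
  obtain v p z0 where v: "v \<in> F p" "v \<noteq> 0" "T (bmsL (-1)) p z0 v = 0" "T (bmsL (-2)) p z0 v = 0"
    "T (bmsQ 0) p z0 v = 0"
    by (rule singular_vector_exists[OF F0])
  define b where "b = 1 - (l + z0 / 2)"
  have e: "eigenline p b v" unfolding b_def by (rule eigenlineI[OF v(1,3,4)])
  obtain N :: int where C1: "T bmsC1 p 0 v = 0" and N: "\<forall>h\<ge>N. h mod 2 = p mod 2 \<longrightarrow>
     l + of_int h / 2 + b \<noteq> 0 \<and> l + of_int h / 2 + b + 1 \<noteq> 0 \<and>
     b2 h v = (- (l + of_int h / 2 + 2 * b) / ((l + of_int h / 2 + b) * (l + of_int h / 2 + b + 1))) *s v"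
    using eigenline_L2[OF e] by blast
  define h where "h n = p mod 2 + 2 * \<bar>N\<bar> + 2 * int n" for n
  have h: "h n \<ge> N" "h n \<ge> 0" "h n mod 2 = p mod 2" "h (Suc n) = h n + 2" for n
    using pos_mod_sign[of 2 p] by (auto simp: h_def)
  define c where "c = l + of_int (h 0) / 2"
  have hc: "l + of_int (h n) / 2 = c + of_nat n" for n by (simp add: c_def h_def add_divide_distrib)
  define w where "w n = tau (h n) v" for n
  have tT: "A x (w n) = tau (h n + deg2 x) (T x p (of_int (h n)) v)" if "low x" "0 \<le> h n + deg2 x" for x n
    unfolding w_def using T_tau[OF that(1) v(1) h(3,2) that(2)] by simp
  have const: "T x p z v = T x p 0 v" if "low x" "upc x = 0" for x z
    by (rule T_const[OF that v(1)])
  show thesis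
  proof (rule that[of w c b])
    fix n
    show "w n \<noteq> 0"
    proof
      assume "w n = 0"
      then have "tau (h n) v = tau (h n) 0" by (simp add: w_def)
      from tau_inj[OF h(2,3) v(1) subspace_0[OF F_subspace] this] v(2) show False by simp
    qed
    show "w n \<in> wt (c + of_nat n)" unfolding w_def hc[symmetric] by (rule tau_in[OF h(2,3) v(1)])
    show "c + of_nat n + b \<noteq> 0" using N h(1,3) hc by metis
    show "A (bmsL 1) (w n) = w (Suc n)" unfolding w_def h(4) tau_Suc[OF h(2)] ..
    have h2: "h (Suc n) + deg2 (bmsL (-1)) = h n" "h (Suc (Suc n)) + deg2 (bmsL (-2)) = h n"
      by (simp_all add: h_def)
    show "A (bmsL (-1)) (w (Suc n)) = ell1 b (c + of_nat (Suc n)) *s w n"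
    proof -
      have "A (bmsL (-1)) (w (Suc n)) = tau (h n) (ell1 b (l + of_int (h (Suc n)) / 2) *s v)"
        using tT[of "bmsL (-1)" "Suc n"] e h(2)[of n] unfolding h2 eigenline_def by simp
      then show ?thesis unfolding hc tau_scale w_def .
    qed
    show "A (bmsL (-2)) (w (Suc (Suc n))) = ell2 b (c + of_nat (Suc (Suc n))) *s w n"
    proof -
      have "A (bmsL (-2)) (w (Suc (Suc n))) = tau (h n) (ell2 b (l + of_int (h (Suc (Suc n))) / 2) *s v)"
        using tT[of "bmsL (-2)" "Suc (Suc n)"] e h(2)[of n] unfolding h2 eigenline_def by simp
      then show ?thesis unfolding hc tau_scale w_def .
    qed
    have h4: "h (Suc (Suc n)) = h n + 4" by (simp add: h_def)
    have "A (bmsL 2) (w n) = tau (h n + 4) (b2 (h n) v)"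
      unfolding w_def using b2(2)[OF h(3,2) v(1)] by simp
    also have "b2 (h n) v = (- (c + of_nat n + 2 * b) / ((c + of_nat n + b) * (c + of_nat n + b + 1))) *s v"
      using N[rule_format, OF h(1,3)] unfolding hc by blast
    finally show "A (bmsL 2) (w n) = (- (c + of_nat n + 2 * b) / ((c + of_nat n + b) * (c + of_nat n + b + 1))) *s w (Suc (Suc n))"
      using h4 by (simp only: tau_scale w_def)
    have "T (bmsQ 0) p z v = 0" for z
      using const[of "bmsQ 0" z] const[of "bmsQ 0" z0] v(5) by simp
    then show "A (bmsQ 0) (w n) = 0" using tT[of "bmsQ 0" n] h(2)[of n] by simp
    show "A bmsC1 (w n) = 0" using tT[of bmsC1 n] h(2)[of n] const[of bmsC1] C1 by simp
  qed
qed

end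

context bms_ops
begin

text \<open>The vectors \<open>y 0, y 1, \<dots>\<close> behave as \<open>v\<^sub>0, v\<^sub>1, \<dots>\<close> in \<open>\<A>\<^sub>c\<^sub>,\<^sub>b\<close> with respect to all operators that do not
  lead below index \<open>0\<close>.\<close>

definition half_line :: "complex \<Rightarrow> complex \<Rightarrow> (nat \<Rightarrow> 'v) \<Rightarrow> bool" where
  "half_line c b y \<longleftrightarrow>
     (\<forall>n k. 0 \<le> int n + k \<longrightarrow> A (bmsL k) (y n) = (- (c + of_nat n + b * of_int k)) *s y (nat (int n + k))) \<and>
     (\<forall>n k. 0 \<le> int n + k \<longrightarrow> A (bmsI k) (y n) = 0 \<and> A (bmsQ k) (y n) = 0) \<and>
     (\<forall>n. A bmsC1 (y n) = 0 \<and> A bmsC2 (y n) = 0)"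

text \<open>For \<open>k \<ge> 2\<close> the operator \<open>L\<^sub>k\<^sub>+\<^sub>1\<close> is a multiple of \<open>[L\<^sub>1, L\<^sub>k]\<close>, and similarly for negative indices.\<close>

lemma line_all_L:
  assumes w: "\<And>n. y n \<in> wt (c + of_nat n)"
    and g: "\<And>n k. k \<in> {1,-1,2,-2} \<Longrightarrow> 0 \<le> int n + k \<Longrightarrow>
      A (bmsL k) (y n) = (- (c + of_nat n + b * of_int k)) *s y (nat (int n + k))"
    and nk: "0 \<le> int n + k"
  shows "A (bmsL k) (y n) = (- (c + of_nat n + b * of_int k)) *s y (nat (int n + k))"
proof -
  let ?P = "\<lambda>k n. A (bmsL k) (y n) = (- (c + of_nat n + b * of_int k)) *s y (nat (int n + k))"
  have up: "?P (int j + 2) n" for j n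
  proof (induction j arbitrary: n)
    case 0
    then show ?case using g[of 2 n] by simp
  next
    case (Suc j)
    let ?k = "int j + 2" and ?s = "c + of_nat n"
    have k1: "1 - ?k \<noteq> 0" "int (Suc j) + 2 = 1 + ?k" by simp_all
    have nn: "nat (int n + ?k) = n + j + 2" "nat (int (n + j + 2) + 1) = n + j + 3"
      "nat (int n + 1) = Suc n" "nat (int (Suc n) + ?k) = n + j + 3" "nat (int n + (1 + ?k)) = n + j + 3" by simp_all
    have g1: "A (bmsL 1) (y (n + j + 2)) = (- (c + of_nat (n + j + 2) + b)) *s y (n + j + 3)"
      using g[of 1 "n + j + 2"] unfolding nn by simp
    have g2: "A (bmsL 1) (y n) = (- (?s + b)) *s y (Suc n)"
      using g[of 1 n] unfolding nn by simp
    have s1: "c + of_nat (n + j + 2) = ?s + of_int ?k" "c + of_nat (Suc n) = ?s + 1" by simp_all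
    have "of_int (1 - ?k) *s A (bmsL (1 + ?k)) (y n) = A (bmsL 1) (A (bmsL ?k) (y n)) - A (bmsL ?k) (A (bmsL 1) (y n))"
      using LL[of 1 ?k "y n"] by simp
    also have "A (bmsL 1) (A (bmsL ?k) (y n)) = ((?s + b * of_int ?k) * (?s + of_int ?k + b)) *s y (n + j + 3)"
      unfolding Suc[of n] nn A_scale g1 s1 by (simp only: scale_scale minus_mult_minus)
    also have "A (bmsL ?k) (A (bmsL 1) (y n)) = ((?s + b) * (?s + 1 + b * of_int ?k)) *s y (n + j + 3)"
      unfolding g2 A_scale Suc[of "Suc n"] nn s1 by (simp only: scale_scale minus_mult_minus)
    also have "((?s + b * of_int ?k) * (?s + of_int ?k + b)) *s y (n + j + 3) - ((?s + b) * (?s + 1 + b * of_int ?k)) *s y (n + j + 3)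
       = of_int (1 - ?k) *s ((- (?s + b * of_int (1 + ?k))) *s y (n + j + 3))"
    proof -
      have "(s + b * k) * (s + k + b) - (s + b) * (s + 1 + b * k) = (1 - k) * (- (s + b * (1 + k)))" for s k
        by (simp add: algebra_simps)
      from this[of ?s "of_int ?k"] show ?thesis
        unfolding scale_left_diff_distrib[symmetric] by simp
    qed
    finally show ?case unfolding k1(2) nn using k1(1)
      by (metis of_int_eq_0_iff scale_left_imp_eq)
  qed
  have down: "?P (- (int j + 2)) n" if "0 \<le> int n - (int j + 2)" for j n
    using that
  proof (induction j arbitrary: n)
    case 0
    then show ?case using g[of "-2" n] by simp
  next
    case (Suc j)
    let ?k = "- (int j + 2)" and ?s = "c + of_nat n"
    obtain m where m: "n = m + j + 3" using Suc.prems nat_le_iff_add[of "j + 3" n] by (auto simp: algebra_simps)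
    have k1: "- 1 - ?k \<noteq> 0" "- (int (Suc j) + 2) = - 1 + ?k" by simp_all
    have nn: "nat (int n + ?k) = Suc m" "nat (int (Suc m) + - 1) = m"
      "nat (int n + - 1) = m + j + 2" "nat (int (m + j + 2) + ?k) = m" "nat (int n + (- 1 + ?k)) = m" using m by simp_all
    have ih: "?P ?k n" by (rule Suc.IH) (use m in simp)
    have ih': "?P ?k (m + j + 2)" by (rule Suc.IH) simp
    have g1: "A (bmsL (-1)) (y (Suc m)) = (- (c + of_nat (Suc m) - b)) *s y m"
      using g[of "-1" "Suc m"] unfolding nn by simp
    have g2: "A (bmsL (-1)) (y n) = (- (?s - b)) *s y (m + j + 2)"
      using g[of "-1" n] m unfolding nn by simp
    have s1: "c + of_nat (Suc m) = ?s + of_int ?k" "c + of_nat (m + j + 2) = ?s - 1" using m by simp_all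
    have "of_int (- 1 - ?k) *s A (bmsL (- 1 + ?k)) (y n) = A (bmsL (- 1)) (A (bmsL ?k) (y n)) - A (bmsL ?k) (A (bmsL (- 1)) (y n))"
      using LL[of "- 1" ?k "y n"] by simp
    also have "A (bmsL (- 1)) (A (bmsL ?k) (y n)) = ((?s + b * of_int ?k) * (?s + of_int ?k - b)) *s y m"
      unfolding ih nn A_scale g1 s1 by (simp only: scale_scale minus_mult_minus)
    also have "A (bmsL ?k) (A (bmsL (- 1)) (y n)) = ((?s - b) * (?s - 1 + b * of_int ?k)) *s y m"
      unfolding g2 A_scale ih' nn s1 by (simp only: scale_scale minus_mult_minus)
    also have "((?s + b * of_int ?k) * (?s + of_int ?k - b)) *s y m - ((?s - b) * (?s - 1 + b * of_int ?k)) *s y m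
       = of_int (- 1 - ?k) *s ((- (?s + b * of_int (- 1 + ?k))) *s y m)"
    proof -
      have "(s + b * k) * (s + k - b) - (s - b) * (s - 1 + b * k) = (- 1 - k) * (- (s + b * (- 1 + k)))" for s k
        by (simp add: algebra_simps)
      from this[of ?s "of_int ?k"] show ?thesis
        unfolding scale_left_diff_distrib[symmetric] by simp
    qed
    finally show ?case unfolding k1(2) nn using k1(1)
      by (metis of_int_eq_0_iff scale_left_imp_eq)
  qed
  consider "k = 0" | "k \<in> {1, -1}" | j where "k = int j + 2" | j where "k = - (int j + 2)"
  proof -
    have "k = 0 \<or> k \<in> {1,-1} \<or> k = int (nat (k - 2)) + 2 \<or> k = - (int (nat (- k - 2)) + 2)" by auto
    then show thesis using that by blast
  qed
  then show ?thesis
  proof cases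
    case 1
    then show ?thesis using w[of n] by (simp add: wt_def)
  next
    case 2
    then show ?thesis using g nk by blast
  next
    case (3 j)
    then show ?thesis using up by blast
  next
    case (4 j)
    then show ?thesis using down nk by simp
  qed
qed

text \<open>Brackets of the \<open>L\<^sub>k\<close> with \<open>Q\<^sub>1\<^sub>/\<^sub>2\<close> give all \<open>Q\<^sub>r\<close>, whose brackets give all \<open>I\<^sub>k\<close> and \<open>C\<^sub>2\<close>. The
  relations used at \<open>y n\<close> involve vectors up to two places below, and so the first two are dropped.\<close>

lemma half_line_of_generators:
  assumes w: "\<And>n. y n \<in> wt (c + of_nat n)"
    and g: "\<And>n k. k \<in> {1,-1,2,-2} \<Longrightarrow> 0 \<le> int n + k \<Longrightarrow>
      A (bmsL k) (y n) = (- (c + of_nat n + b * of_int k)) *s y (nat (int n + k))"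
    and Q0: "\<And>n. A (bmsQ 0) (y n) = 0" and C1: "\<And>n. A bmsC1 (y n) = 0"
  shows "half_line (c + 2) b (\<lambda>n. y (n + 2))"
proof -
  note L = line_all_L[OF w g]
  have QL: "A (bmsQ j) (A (bmsL k) (y n)) = 0" if "0 \<le> int n + k" "A (bmsQ j) (y (nat (int n + k))) = 0" for n k j
    using L[OF _ _ that(1)] that(2) by simp
  have Qm: "A (bmsQ (- int m)) (y n) = 0" if "n \<ge> m" for m n
    using that
  proof (induction m arbitrary: n rule: less_induct)
    case (less m)
    consider "m = 0" | "m = 1" | "m = 2" | "m \<ge> 3" by linarith
    then show ?case
    proof cases
      case 1
      then show ?thesis using Q0 by simp
    next
      case 2
      have "(- 1) *s A (bmsQ (- 1)) (y n) = A (bmsL (- 1)) (A (bmsQ 0) (y n)) - A (bmsQ 0) (A (bmsL (- 1)) (y n))"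
        using LQ[of "- 1" 0 "y n"] by simp
      also have "\<dots> = 0" using Q0 QL[of n "- 1" 0] less.prems 2 by simp
      finally show ?thesis using 2 by simp
    next
      case 3
      have "(- 3/2) *s A (bmsQ (- 2)) (y n) = A (bmsL (- 2)) (A (bmsQ 0) (y n)) - A (bmsQ 0) (A (bmsL (- 2)) (y n))"
        using LQ[of "- 2" 0 "y n"] by simp
      also have "\<dots> = 0" using Q0 QL[of n "- 2" 0] less.prems 3 by simp
      finally show ?thesis using 3 by simp
    next
      case 4
      define j where "j = m - 1"
      have j: "m = Suc j" "j \<ge> 2" using 4 by (auto simp: j_def)
      have q: "A (bmsQ (- int j)) (y n) = 0" "A (bmsQ (- int j)) (y (n - 1)) = 0"
        using less.IH[of j] less.prems j by auto
      have "(of_int (- 1) / 2 - (of_int (- int j) + 1 / 2)) *s A (bmsQ (- 1 + - int j)) (y n)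
          = A (bmsL (- 1)) (A (bmsQ (- int j)) (y n)) - A (bmsQ (- int j)) (A (bmsL (- 1)) (y n))"
        using LQ[of "- 1" "- int j" "y n"] by simp
      also have "\<dots> = 0"
      proof -
        have "nat (int n + - 1) = n - 1" using less.prems j by simp
        then show ?thesis using q QL[of n "- 1" "- int j"] less.prems j by simp
      qed
      finally have "(of_int (- 1) / 2 - (of_int (- int j) + 1 / 2) :: complex) = 0 \<or> A (bmsQ (- 1 + - int j)) (y n) = 0"
        by (simp only: scale_eq_0_iff)
      moreover have "of_int (- 1) / 2 - (of_int (- int j) + 1 / 2) = (of_int (int j - 1) :: complex)" by simp
      moreover have "(of_int (int j - 1) :: complex) \<noteq> 0" using j by (simp only: of_int_eq_0_iff)
      moreover have "- 1 + - int j = - int m" using j by simp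
      ultimately show ?thesis by simp
    qed
  qed
  have Qp: "A (bmsQ (int j + 1)) (y n) = 0" if "n \<ge> 1" for j n
    using that
  proof (induction j arbitrary: n)
    case 0
    have "A (bmsQ (- 1)) (y n) = 0" "A (bmsQ (- 1)) (y (n + 2)) = 0" using Qm[of 1] 0 by auto
    moreover have "(of_int 2 / 2 - (of_int (- 1) + 1 / 2)) *s A (bmsQ (2 + - 1)) (y n)
        = A (bmsL 2) (A (bmsQ (- 1)) (y n)) - A (bmsQ (- 1)) (A (bmsL 2) (y n))"
      using LQ[of 2 "- 1" "y n"] by simp
    ultimately have "(3/2) *s A (bmsQ 1) (y n) = 0" using QL[of n 2 "- 1"] by (simp add: nat_add_distrib)
    then show ?case by simp
  next
    case (Suc j)
    have "A (bmsQ (int j + 1)) (y n) = 0" "A (bmsQ (int j + 1)) (y (n + 1)) = 0" using Suc by auto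
    moreover have "(of_int 1 / 2 - (of_int (int j + 1) + 1 / 2)) *s A (bmsQ (1 + (int j + 1))) (y n)
        = A (bmsL 1) (A (bmsQ (int j + 1)) (y n)) - A (bmsQ (int j + 1)) (A (bmsL 1) (y n))"
      using LQ[of 1 "int j + 1" "y n"] by simp
    moreover have "(of_int 1 / 2 - (of_int (int j + 1) + 1 / 2) :: complex) = - of_nat (Suc j)" by simp
    moreover have "nat (int n + 1) = n + 1" by simp
    ultimately have "(- of_nat (Suc j)) *s A (bmsQ (1 + (int j + 1))) (y n) = 0" using QL[of n 1 "int j + 1"] by simp
    then have "A (bmsQ (1 + (int j + 1))) (y n) = 0"
      by (simp only: scale_eq_0_iff neg_equal_0_iff_equal of_nat_eq_0_iff) simp
    then show ?case by (simp add: algebra_simps)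
  qed
  have Q: "A (bmsQ k) (y n) = 0" if "n \<ge> 1" "0 \<le> int n + k" for k n
  proof (cases "k \<le> 0")
    case True
    then show ?thesis using Qm[of "nat (- k)" n] that by simp
  next
    case False
    then show ?thesis using Qp[of n "nat (k - 1)"] that by simp
  qed
  have I: "A (bmsI k) (y n) = 0" if "n \<ge> 1" "1 \<le> int n + k" for k n
  proof -
    have "A (bmsQ (k - 1)) (y n) = 0" "A (bmsQ 0) (y n) = 0" using Q that by auto
    moreover have "(((of_int (k - 1) + 1/2) ^ 2 - 1/4) / 3 :: complex) = 0" if "k = 0"
      using that by (simp add: power2_eq_square)
    ultimately have "2 *s A (bmsI k) (y n) = 0"
      using QQ[of "k - 1" 0 "y n"] by (cases "k = 0") (auto simp: power2_eq_square)
    then show ?thesis by simp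
  qed
  have C2: "A bmsC2 (y n) = 0" if "n \<ge> 2" for n
  proof -
    have "A (bmsQ 1) (y n) = 0" "A (bmsQ (- 2)) (y n) = 0" "A (bmsI 0) (y n) = 0" using Q I that by auto
    then have "(((of_int 1 + 1/2) ^ 2 - 1/4) / 3) *s A bmsC2 (y n) = 0"
      using QQ[of 1 "- 2" "y n"] by simp
    then show ?thesis by (simp add: power2_eq_square)
  qed
  show ?thesis
    unfolding half_line_def
  proof (intro conjI allI impI)
    fix n and k :: int
    assume nk: "0 \<le> int n + k"
    have e: "nat (int (n + 2) + k) = nat (int n + k) + 2" using nk by simp
    have "A (bmsL k) (y (n + 2)) = (- (c + of_nat (n + 2) + b * of_int k)) *s y (nat (int (n + 2) + k))"
      by (rule L) (use nk in auto)
    then show "A (bmsL k) (y (n + 2)) = (- (c + 2 + of_nat n + b * of_int k)) *s y (nat (int n + k) + 2)"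
      unfolding e by (simp add: algebra_simps)
    show "A (bmsI k) (y (n + 2)) = 0" "A (bmsQ k) (y (n + 2)) = 0" using I Q nk by auto
  qed (use C1 C2 in auto)
qed

end

context bms_gauge
begin

text \<open>The factors \<open>g n\<close> change the normalization in which \<open>L\<^sub>1\<close> maps \<open>w n\<close> to \<open>w (Suc n)\<close> into the one of
  \<open>\<A>\<^sub>c\<^sub>,\<^sub>b\<close>.\<close>

theorem half_line_exists:
  assumes F0: "F p0 \<noteq> {0}"
  shows "\<exists>c b y. half_line c b y \<and> y 0 \<noteq> 0"
proof -
  obtain w c b where nz: "\<And>n::nat. w n \<noteq> 0" and wt: "\<And>n. w n \<in> wt (c + of_nat n)" and cb: "\<And>n. c + of_nat n + b \<noteq> 0"
    and L1: "\<And>n. A (bmsL 1) (w n) = w (Suc n)"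
    and Lm1: "\<And>n. A (bmsL (-1)) (w (Suc n)) = ell1 b (c + of_nat (Suc n)) *s w n"
    and Lm2: "\<And>n. A (bmsL (-2)) (w (Suc (Suc n))) = ell2 b (c + of_nat (Suc (Suc n))) *s w n"
    and L2: "\<And>n. A (bmsL 2) (w n) = (- (c + of_nat n + 2 * b) / ((c + of_nat n + b) * (c + of_nat n + b + 1))) *s w (Suc (Suc n))"
    and Q0: "\<And>n. A (bmsQ 0) (w n) = 0" and C1: "\<And>n. A bmsC1 (w n) = 0"
    by (rule normalized_line_exists[OF F0], rule that)
  define g where "g n = (\<Prod>i<n. - inverse (c + of_nat i + b))" for n
  have g0: "g n \<noteq> 0" for n using cb by (simp add: g_def)
  have gS: "g n = - (c + of_nat n + b) * g (Suc n)" for n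
  proof -
    have "x = - z * (x * - inverse z)" if "z \<noteq> 0" for x z :: complex using that by simp
    from this[OF cb[of n]] show ?thesis by (simp only: g_def prod.lessThan_Suc)
  qed
  define y where "y n = g n *s w n" for n
  have "A (bmsL k) (y n) = (- (c + of_nat n + b * of_int k)) *s y (nat (int n + k))"
    if k: "k \<in> {1,-1,2,-2}" "0 \<le> int n + k" for n k
  proof -
    consider "k = 1" | "k = 2" | m where "k = -1" "n = Suc m" | m where "k = -2" "n = Suc (Suc m)"
    proof -
      have "k = 1 \<or> k = 2 \<or> (k = -1 \<and> n = Suc (n - 1)) \<or> (k = -2 \<and> n = Suc (Suc (n - 2)))" using k by auto
      then show thesis using that by blast
    qed
    then show ?thesis
    proof cases
      case 1
      then have e: "nat (int n + k) = Suc n" by simp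
      show ?thesis unfolding e unfolding 1 y_def A_scale L1 scale_scale by (subst gS) simp
    next
      case 2
      then have e: "nat (int n + k) = Suc (Suc n)" by simp
      have "g n * (- (c + of_nat n + 2 * b) / ((c + of_nat n + b) * (c + of_nat n + b + 1)))
          = - (c + of_nat n + b * of_int k) * g (Suc (Suc n))"
      proof -
        have "z * (u * x) * (- w / (z * u)) = - w * x" if "z \<noteq> 0" "u \<noteq> 0" for x z u w :: complex
          using that by (simp add: field_simps)
        moreover have "c + of_nat n + b + 1 \<noteq> 0" using cb[of "Suc n"] by (simp add: add_ac)
        ultimately have "(c + of_nat n + b) * ((c + of_nat n + b + 1) * g (Suc (Suc n))) *
            (- (c + of_nat n + 2 * b) / ((c + of_nat n + b) * (c + of_nat n + b + 1)))
          = - (c + of_nat n + 2 * b) * g (Suc (Suc n))"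
          using cb[of n] by blast
        moreover have "g n = (c + of_nat n + b) * ((c + of_nat n + b + 1) * g (Suc (Suc n)))"
          by (subst gS, subst gS) (simp add: algebra_simps)
        ultimately show ?thesis using 2 by (simp only: of_int_numeral mult.commute[of b])
      qed
      then show ?thesis unfolding e unfolding 2 y_def A_scale L2 scale_scale by simp
    next
      case (3 m)
      then have e: "nat (int n + k) = m" by simp
      have "g n * ell1 b (c + of_nat n) = - (c + of_nat n + b * of_int k) * g m"
        unfolding 3 gS[of m] by (simp add: ell1_def algebra_simps)
      then show ?thesis unfolding e unfolding y_def A_scale scale_scale 3 Lm1 by simp
    next
      case (4 m)
      then have e: "nat (int n + k) = m" by simp
      have "g n * ell2 b (c + of_nat n) = - (c + of_nat n + b * of_int k) * g m"
        unfolding 4 gS[of m] gS[of "Suc m"] by (simp add: ell2_def algebra_simps)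
      then show ?thesis unfolding e unfolding y_def A_scale scale_scale 4 Lm2 by simp
    qed
  qed
  then have "half_line (c + 2) b (\<lambda>n. y (n + 2))"
    by (intro half_line_of_generators)
      (use wt Q0 C1 subspace_scale[OF wt_subspace] in \<open>auto simp: y_def\<close>)
  moreover have "y (0 + 2) \<noteq> 0" using nz g0 by (simp add: y_def)
  ultimately show ?thesis by blast
qed

end

section \<open>Large weights\<close>

context bms_ops
begin

lemma L1_lowered:
  assumes v: "v \<in> wt s" "A (bmsL 1) v = 0"
  shows "(A (bmsL (-1)) ^^ k) v \<in> wt (s - of_nat k)"
    and "A (bmsL 1) ((A (bmsL (-1)) ^^ Suc k) v) = (- of_nat (Suc k) * (2 * s - of_nat k)) *s (A (bmsL (-1)) ^^ k) v"
proof -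
  let ?u = "\<lambda>k. (A (bmsL (-1)) ^^ k) v"
  show w: "?u k \<in> wt (s - of_nat k)" for k
  proof (induction k)
    case (Suc k)
    then show ?case using A_wt[of "?u k" "s - of_nat k" "bmsL (-1)"] by (simp add: algebra_simps)
  qed (use v in simp)
  have step: "A (bmsL 1) (?u (Suc k)) = A (bmsL (-1)) (A (bmsL 1) (?u k)) + (- 2 * (s - of_nat k)) *s ?u k" for k
    using LL[of 1 "-1" "?u k"] w[of k] by (simp add: wt_def)
  show "A (bmsL 1) (?u (Suc k)) = (- of_nat (Suc k) * (2 * s - of_nat k)) *s ?u k" for k
  proof (induction k)
    case 0
    then show ?case using step[of 0] v by simp
  next
    case (Suc k)
    have "A (bmsL 1) (?u (Suc (Suc k))) = (- of_nat (Suc k) * (2 * s - of_nat k)) *s ?u (Suc k)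
        + (- 2 * (s - of_nat (Suc k))) *s ?u (Suc k)"
      unfolding step[of "Suc k"] Suc by simp
    also have "\<dots> = (- of_nat (Suc (Suc k)) * (2 * s - of_nat (Suc k))) *s ?u (Suc k)"
      unfolding scale_left_distrib[symmetric] by (simp add: algebra_simps)
    finally show ?case .
  qed
qed

text \<open>A vector of weight \<open>lam + n\<close> killed by \<open>L\<^sub>1\<close> descends under \<open>L\<^sub>-\<^sub>1\<^sup>n\<close> to an eigenvector of
  \<open>L\<^sub>-\<^sub>1 L\<^sub>1\<close> in the fixed weight space \<open>lam\<close>, whose eigenvalue \<open>- n (2 lam + n + 1)\<close> determines \<open>n\<close>.\<close>

lemma L1_injective_eventually:
  assumes fin: "\<exists>B. finite B \<and> span B = wt lam"
  shows "\<exists>n0. \<forall>n\<ge>n0. \<forall>v. v \<in> wt (lam + of_nat n) \<longrightarrow> A (bmsL 1) v = 0 \<longrightarrow> v = 0"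
proof -
  obtain B where B: "finite B" "span B = wt lam" using fin by blast
  obtain M :: nat where M: "of_nat M > - 2 * Re lam" by (metis reals_Archimedean2)
  let ?E = "\<lambda>v. A (bmsL (-1)) (A (bmsL 1) v)"
  have "lin_on (span B) (span B) ?E"
    unfolding lin_on_def B(2)
  proof (intro conjI ballI allI)
    fix u assume "u \<in> wt lam"
    from A_wt[OF A_wt[OF this, of "bmsL 1"], of "bmsL (-1)"] show "?E u \<in> wt lam" by simp
  qed simp_all
  from finite_eigenvalues[OF B(1) this]
  have fin: "finite {r. \<exists>u\<in>wt lam. u \<noteq> 0 \<and> ?E u = r *s u}" by (simp add: B(2))
  define e :: "nat \<Rightarrow> complex" where "e n = - of_nat n * (2 * lam + of_nat n + 1)" for n
  let ?K = "{n. n > M \<and> (\<exists>v. v \<in> wt (lam + of_nat n) \<and> A (bmsL 1) v = 0 \<and> v \<noteq> 0)}"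
  have "inj_on e ?K"
  proof (rule inj_onI)
    fix n m assume nm: "n \<in> ?K" "m \<in> ?K" "e n = e m"
    have "(of_nat n - of_nat m) * (2 * lam + of_nat n + of_nat m + 1) = 0"
      using nm(3) by (simp add: e_def algebra_simps)
    moreover have "2 * lam + of_nat n + of_nat m + 1 \<noteq> 0"
    proof
      assume "2 * lam + of_nat n + of_nat m + 1 = 0"
      from arg_cong[OF this, of Re] show False using nm(1) M by simp
    qed
    ultimately show "n = m" by simp
  qed
  then have inj: "inj_on e ?K" .
  have "e ` ?K \<subseteq> {r. \<exists>u\<in>wt lam. u \<noteq> 0 \<and> ?E u = r *s u}"
  proof safe
    fix n v assume n: "n > M" and v: "v \<in> wt (lam + of_nat n)" "A (bmsL 1) v = 0" "v \<noteq> 0"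
    let ?u = "\<lambda>k. (A (bmsL (-1)) ^^ k) v"
    note d = L1_lowered[OF v(1,2)]
    have nz: "k \<le> n \<Longrightarrow> ?u k \<noteq> 0" for k
    proof (induction k)
      case (Suc k)
      show ?case
      proof
        assume "?u (Suc k) = 0"
        then have "(- of_nat (Suc k) * (2 * (lam + of_nat n) - of_nat k)) *s ?u k = 0"
          using d(2)[of k] by (metis A_0)
        moreover have "?u k \<noteq> 0" using Suc by simp
        ultimately have "(- of_nat (Suc k) * (2 * (lam + of_nat n) - of_nat k)) = 0"
          unfolding scale_eq_0_iff by blast
        then have "2 * (lam + of_nat n) - of_nat k = 0"
          by (metis mult_eq_0_iff neg_equal_0_iff_equal of_nat_eq_0_iff nat.distinct(2))
        from arg_cong[OF this, of Re] show False using Suc.prems n M by simp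
      qed
    qed (use v in simp)
    obtain k where k: "n = Suc k" using n by (cases n) auto
    have "?E (?u n) = e n *s ?u n"
      unfolding k d(2) by (simp add: e_def algebra_simps)
    moreover have "?u n \<in> wt lam" using d(1)[of n] by simp
    ultimately show "\<exists>u\<in>wt lam. u \<noteq> 0 \<and> ?E u = e n *s u" using nz[of n] by blast
  qed
  then have "finite ?K" using finite_imageD[OF finite_subset[OF _ fin] inj] by blast
  then obtain m where m: "\<forall>n\<in>?K. n \<le> m" using finite_nat_set_iff_bounded_le by blast
  show ?thesis
  proof (intro exI allI impI)
    fix n v
    assume n: "n \<ge> Suc (max M m)" and v: "v \<in> wt (lam + of_nat n)" "A (bmsL 1) v = 0"
    show "v = 0"
    proof (rule ccontr)
      assume "v \<noteq> 0"
      then have "n \<in> ?K" using n v by auto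
      then show False using m n by auto
    qed
  qed
qed

text \<open>Injectivity makes the dimensions of the weight spaces \<open>lam + n\<close> increase, and they are bounded.\<close>

lemma L1_bijective_eventually:
  assumes fin: "\<And>s. \<exists>B. finite B \<and> card B \<le> N \<and> span B = wt s"
  shows "\<exists>n0. \<forall>n\<ge>n0. bij_betw (A (bmsL 1)) (wt (lam + of_nat n)) (wt (lam + of_nat n + 1))"
proof -
  obtain n0 where inj: "\<And>n v. n \<ge> n0 \<Longrightarrow> v \<in> wt (lam + of_nat n) \<Longrightarrow> A (bmsL 1) v = 0 \<Longrightarrow> v = 0"
    using L1_injective_eventually[of lam] fin by metis
  interpret L1: Vector_Spaces.linear scale scale "A (bmsL 1)"
    by unfold_locales simp_all
  have inj': "inj_on (A (bmsL 1)) (wt (lam + of_nat n))" if "n \<ge> n0" for n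
  proof (rule inj_onI)
    fix u v assume "u \<in> wt (lam + of_nat n)" "v \<in> wt (lam + of_nat n)" "A (bmsL 1) u = A (bmsL 1) v"
    then have "u - v = 0" using inj[OF that, of "u - v"] subspace_diff[OF wt_subspace] by simp
    then show "u = v" by simp
  qed
  \<comment> \<open>An independent set of the greatest size \<open>M\<close> that occurs in a weight space with \<open>n \<ge> n0\<close> is a basis,
    and \<open>L\<^sub>1\<close> maps it to an independent set of the same size, hence to a basis.\<close>
  define R where "R n B \<longleftrightarrow> n \<ge> n0 \<and> finite B \<and> independent B \<and> B \<subseteq> wt (lam + of_nat n)" for n B
  have "card B \<le> N" if "R n B" for n B
  proof -
    obtain C where C: "finite C" "card C \<le> N" "span C = wt (lam + of_nat n)" using fin by blast
    then show ?thesis using independent_span_bound[OF C(1), of B] that by (auto simp: R_def)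
  qed
  moreover have "R n0 {}" by (simp add: R_def independent_empty)
  ultimately obtain p where p: "R (fst p) (snd p)" and p_max: "\<And>q. R (fst q) (snd q) \<Longrightarrow> card (snd q) \<le> card (snd p)"
    using ex_has_greatest_nat[of "\<lambda>q. R (fst q) (snd q)" "(n0, {})" "\<lambda>q. card (snd q)" "Suc N"]
    by (auto simp: less_Suc_eq_le)
  define n1 where "n1 = fst p"
  define M where "M = card (snd p)"
  have RM: "R n1 (snd p)" "card (snd p) = M" and max: "\<And>n B. R n B \<Longrightarrow> card B \<le> M"
    using p p_max[of "(_, _)"] by (auto simp: n1_def M_def)
  have span: "span B = wt (lam + of_nat n)" if "R n B" "card B = M" for n B
  proof -
    have "wt (lam + of_nat n) \<subseteq> span B"
    proof (rule ccontr)
      assume "\<not> ?thesis"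
      then obtain v where v: "v \<in> wt (lam + of_nat n)" "v \<notin> span B" by blast
      then have "R n (insert v B)" "card (insert v B) = Suc M"
        using that span_base[of v B] by (auto simp: R_def independent_insert intro!: card_insert_disjoint)
      then show False using max[of n "insert v B"] by simp
    qed
    then show ?thesis using that span_minimal[OF _ wt_subspace] unfolding R_def by blast
  qed
  have step: "R (Suc n) (A (bmsL 1) ` B) \<and> card (A (bmsL 1) ` B) = M" if "R n B" "card B = M" for n B
  proof -
    have i: "inj_on (A (bmsL 1)) (span B)" using inj'[of n] span[OF that] that by (simp add: R_def)
    have "A (bmsL 1) v \<in> wt (lam + of_nat (Suc n))" if "v \<in> wt (lam + of_nat n)" for v
      using A_wt[OF that, of "bmsL 1"] by (simp add: algebra_simps)
    moreover have "independent (A (bmsL 1) ` B)"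
      by (rule L1.independent_injective_image) (use that i in \<open>auto simp: R_def\<close>)
    moreover have "card (A (bmsL 1) ` B) = M"
      using that(2) card_image[OF inj_on_subset[OF i span_superset]] by simp
    ultimately show ?thesis using that by (auto simp: R_def)
  qed
  have ex: "\<exists>B. R n B \<and> card B = M" if "n \<ge> n1" for n
    using that
  proof (induction n rule: dec_induct)
    case base
    then show ?case using RM by blast
  next
    case (step n)
    then show ?case using \<open>\<And>n B. R n B \<Longrightarrow> card B = M \<Longrightarrow> R (Suc n) (A (bmsL 1) ` B) \<and> card (A (bmsL 1) ` B) = M\<close> by blast
  qed
  have "bij_betw (A (bmsL 1)) (wt (lam + of_nat n)) (wt (lam + of_nat n + 1))" if n: "n \<ge> n1" for n
  proof -
    obtain B where B: "R n B" "card B = M" using ex[OF n] by blast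
    have "A (bmsL 1) ` span B = span (A (bmsL 1) ` B)" by (rule L1.span_image[symmetric])
    also have "\<dots> = wt (lam + of_nat (Suc n))" using step[OF B] span by blast
    also have "lam + of_nat (Suc n) = lam + of_nat n + 1" by simp
    finally show ?thesis
      using inj'[of n] B span[OF B] by (simp add: bij_betw_def R_def)
  qed
  then show ?thesis by blast
qed

lemma half_line_in_direction:
  assumes fin: "\<And>s. \<exists>B. finite B \<and> card B \<le> N \<and> span B = wt s"
    and inf: "infinite {n::nat. wt (lam + of_nat n) \<noteq> {0}}"
  shows "\<exists>c b y. half_line c b y \<and> y 0 \<noteq> 0"
proof -
  obtain n1 where n1: "\<And>n. n \<ge> n1 \<Longrightarrow> bij_betw (A (bmsL 1)) (wt (lam + of_nat n)) (wt (lam + of_nat n + 1))"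
    using L1_bijective_eventually[OF fin, of lam] by blast
  obtain n2 where n2: "\<And>n. n \<ge> n2 \<Longrightarrow> bij_betw (A (bmsL 1)) (wt (lam + 1/2 + of_nat n)) (wt (lam + 1/2 + of_nat n + 1))"
    using L1_bijective_eventually[OF fin, of "lam + 1/2"] by blast
  obtain n where n: "n \<ge> max n1 n2" "wt (lam + of_nat n) \<noteq> {0}"
    using inf unfolding infinite_nat_iff_unbounded_le by blast
  define l where "l = lam + of_nat n"
  interpret bms_gauge scale A l
  proof
    show "\<exists>B. finite B \<and> span B = wt l" "\<exists>B. finite B \<and> span B = wt (l + 1/2)" using fin by meson+
    fix h :: int assume h: "h \<ge> 0"
    have "h = 2 * int (nat (h div 2)) \<or> h = 2 * int (nat (h div 2)) + 1"
    proof -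
      have e: "int (nat (h div 2)) = h div 2" using h by simp
      show ?thesis unfolding e by presburger
    qed
    then consider j where "h = 2 * int j" | j where "h = 2 * int j + 1" by blast
    then show "bij_betw (A (bmsL 1)) (wt (l + of_int h / 2)) (wt (l + of_int h / 2 + 1))"
    proof cases
      case (1 j)
      have "l + of_int h / 2 = lam + of_nat (n + j)" by (simp add: 1 l_def)
      then show ?thesis using n1[of "n + j"] n by simp
    next
      case (2 j)
      have "l + of_int h / 2 = lam + 1/2 + of_nat (n + j)" by (simp add: 2 l_def add_divide_distrib)
      then show ?thesis using n2[of "n + j"] n by simp
    qed
  qed
  have "F 0 \<noteq> {0}" using n(2) unfolding F_def by (simp add: l_def)
  then show ?thesis by (rule half_line_exists)
qed

end

section \<open>Reflection\<close>

text \<open>The remaining relations follow by super skew-symmetry and centrality.\<close>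

lemma bms_opsI:
  fixes sc :: "complex \<Rightarrow> 'v::ab_group_add \<Rightarrow> 'v" and A
  assumes vs: "vector_space sc"
    and hadd: "\<And>x u v. A x (u + v) = A x u + A x v" and hscale: "\<And>x c v. A x (sc c v) = sc c (A x v)"
    and LL: "\<And>m n v. A (bmsL m) (A (bmsL n) v) = A (bmsL n) (A (bmsL m) v) + sc (of_int (m - n)) (A (bmsL (m + n)) v)
      + (if m + n = 0 then sc (of_int (m ^ 3 - m) / 12) (A bmsC1 v) else 0)"
    and LI: "\<And>m n v. A (bmsL m) (A (bmsI n) v) = A (bmsI n) (A (bmsL m) v) + sc (of_int (m - n)) (A (bmsI (m + n)) v)
      + (if m + n = 0 then sc (of_int (m ^ 3 - m) / 12) (A bmsC2 v) else 0)"
    and LQ: "\<And>m k v. A (bmsL m) (A (bmsQ k) v) = A (bmsQ k) (A (bmsL m) v)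
      + sc (of_int m / 2 - (of_int k + 1/2)) (A (bmsQ (m + k)) v)"
    and QQ: "\<And>k l v. A (bmsQ k) (A (bmsQ l) v) = - A (bmsQ l) (A (bmsQ k) v) + sc 2 (A (bmsI (k + l + 1)) v)
      + (if k + l + 1 = 0 then sc (((of_int k + 1/2) ^ 2 - 1/4) / 3) (A bmsC2 v) else 0)"
    and II: "\<And>m n v. A (bmsI m) (A (bmsI n) v) = A (bmsI n) (A (bmsI m) v)"
    and IQ: "\<And>m n v. A (bmsI m) (A (bmsQ n) v) = A (bmsQ n) (A (bmsI m) v)"
    and C1: "\<And>x v. A bmsC1 (A x v) = A x (A bmsC1 v)" and C2: "\<And>x v. A bmsC2 (A x v) = A x (A bmsC2 v)"
  shows "bms_ops sc A"
proof -
  interpret cvs sc using vs by (simp add: cvs_def)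
  have ld: "lin_ext sc A (u - w) v = lin_ext sc A u v - lin_ext sc A w v" for u w v
    using lin_ext_add[of A u "- w" v] by simp
  have even: "parity_sign 0 p = 1" "parity_sign p 0 = 1" "parity_sign 1 1 = -1" for p
    by (auto simp: parity_sign_def)
  show ?thesis
  proof (intro_locales, unfold_locales)
    show "lin_on UNIV UNIV (A x)" for x using hadd hscale by (simp add: lin_on_def)
    show "A x (A y v) = sc (parity_sign (bms_parity x) (bms_parity y)) (A y (A x v)) + lin_ext sc A (bms_basis_bracket x y) v" for x y v
    proof (cases x)
      case x: (bmsL m)
      show ?thesis
      proof (cases y)
        case (bmsL n)
        then show ?thesis using LL[of m n v] x by (simp add: even lin_ext_if)
      next
        case (bmsI n)
        then show ?thesis using LI[of m n v] x by (simp add: even lin_ext_if)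
      next
        case (bmsQ n)
        then show ?thesis using LQ[of m n v] x by (simp add: even)
      qed (simp_all add: x even C1 C2)
    next
      case x: (bmsI m)
      show ?thesis
      proof (cases y)
        case (bmsL n)
        then show ?thesis using LI[of n m v] x by (cases "n + m = 0") (simp_all add: even ld algebra_simps)
      next
        case (bmsI n)
        then show ?thesis using II[of m n v] x by (simp add: even)
      next
        case (bmsQ n)
        then show ?thesis using IQ[of m n v] x by (simp add: even)
      qed (simp_all add: x even C1 C2)
    next
      case x: (bmsQ m)
      show ?thesis
      proof (cases y)
        case (bmsL n)
        then show ?thesis using LQ[of n m v] x by (simp add: even)
      next
        case (bmsI n)
        then show ?thesis using IQ[of n m v] x by (simp add: even)
      next
        case (bmsQ n)
        then show ?thesis using QQ[of m n v] x by (simp add: even lin_ext_if)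
      qed (simp_all add: x even C1 C2)
    qed (simp_all add: even C1 C2)
  qed
qed

fun opp :: "bms_basis \<Rightarrow> bms_basis" where
  "opp (bmsL k) = bmsL (- k)"
| "opp (bmsI k) = bmsI (- k)"
| "opp (bmsQ k) = bmsQ (- k - 1)"
| "opp c = c"

fun opp_coeff :: "bms_basis \<Rightarrow> complex" where
  "opp_coeff (bmsQ k) = \<i>"
| "opp_coeff _ = - 1"

context bms_ops
begin

text \<open>The automorphism \<open>L\<^sub>m \<mapsto> - L\<^sub>-\<^sub>m\<close>, \<open>I\<^sub>m \<mapsto> - I\<^sub>-\<^sub>m\<close>, \<open>Q\<^sub>r \<mapsto> \<i> Q\<^sub>-\<^sub>r\<close>, \<open>C\<^sub>i \<mapsto> - C\<^sub>i\<close>, which exchanges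
  the two directions in which the weights can be infinite in number.\<close>

definition reflected :: "bms_basis \<Rightarrow> 'v \<Rightarrow> 'v" where
  "reflected x v = opp_coeff x *s A (opp x) v"

lemma reflected_ops: "bms_ops scale reflected"
proof (rule bms_opsI)
  show "vector_space scale" by unfold_locales
  have neg: "((p - q) / d) *s v = - (((q - p) / d) *s v)" for p q d v
  proof -
    have "(p - q) / d = - ((q - p) / d)" by (metis minus_diff_eq minus_divide_left)
    then show ?thesis by (simp only: scale_minus_left)
  qed
  have sq: "(- 1 - z)\<^sup>2 = (1 + z)\<^sup>2" for z :: complex by (simp add: power2_eq_square algebra_simps)
  have IQ: "A (bmsI m) (A (bmsQ n) v) = A (bmsQ n) (A (bmsI m) v)" for m n v
    using A_bracket[of "bmsI m" "bmsQ n" v] by (simp add: parity_sign_def)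
  have C2: "A bmsC2 (A x v) = A x (A bmsC2 v)" for x v
    using A_bracket[of bmsC2 x v] by (cases x) (simp_all add: parity_sign_def)
  show "reflected (bmsL m) (reflected (bmsL n) v) = reflected (bmsL n) (reflected (bmsL m) v)
      + of_int (m - n) *s reflected (bmsL (m + n)) v
      + (if m + n = 0 then (of_int (m ^ 3 - m) / 12) *s reflected bmsC1 v else 0)" for m n v
    using LL[of "- m" "- n" v] by (simp add: reflected_def scale_left_diff_distrib field_simps neg[of "of_int m" "of_int m ^ 3" 12])
  show "reflected (bmsL m) (reflected (bmsI n) v) = reflected (bmsI n) (reflected (bmsL m) v)
      + of_int (m - n) *s reflected (bmsI (m + n)) v
      + (if m + n = 0 then (of_int (m ^ 3 - m) / 12) *s reflected bmsC2 v else 0)" for m n v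
    using LI[of "- m" "- n" v] by (simp add: reflected_def scale_left_diff_distrib field_simps neg[of "of_int m" "of_int m ^ 3" 12])
  show "reflected (bmsL m) (reflected (bmsQ k) v) = reflected (bmsQ k) (reflected (bmsL m) v)
      + (of_int m / 2 - (of_int k + 1/2)) *s reflected (bmsQ (m + k)) v" for m k v
    using LQ[of "- m" "- k - 1" v]
    by (simp add: reflected_def scale_left_diff_distrib field_simps
        neg[of "\<i> * of_int m" "\<i> + \<i> * (of_int k * 2)" 2])
  show "reflected (bmsQ k) (reflected (bmsQ l) v) = - reflected (bmsQ l) (reflected (bmsQ k) v)
      + 2 *s reflected (bmsI (k + l + 1)) v
      + (if k + l + 1 = 0 then (((of_int k + 1/2) ^ 2 - 1/4) / 3) *s reflected bmsC2 v else 0)" for k l v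
    using QQ[of "- k - 1" "- l - 1" v] sq[of "of_int k * 2"] by (simp add: reflected_def field_simps)
  show "reflected (bmsI m) (reflected (bmsI n) v) = reflected (bmsI n) (reflected (bmsI m) v)" for m n v
    by (simp add: reflected_def II[of "- m"])
  show "reflected (bmsI m) (reflected (bmsQ n) v) = reflected (bmsQ n) (reflected (bmsI m) v)" for m n v
    by (simp add: reflected_def IQ)
  show "reflected bmsC2 (reflected x v) = reflected x (reflected bmsC2 v)" for x v
    by (simp add: reflected_def C2)
qed (simp_all add: reflected_def C1_central scale_right_distrib mult.commute)

lemma A_reflected: "\<exists>k. \<forall>v. A x v = k *s reflected (opp x) v"
  by (rule exI[of _ "inverse (opp_coeff (opp x))"]) (cases x; simp add: reflected_def)

end

section \<open>The submodule generated by a half line\<close>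

text \<open>A sum of eigenvectors with eigenvalues other than \<open>r\<close> is annihilated by \<open>p(f)\<close> for some polynomial \<open>p\<close>
  with \<open>p(r) \<noteq> 0\<close>, whereas \<open>p(f)\<close> multiplies \<open>v\<close> by \<open>p(r)\<close>.\<close>

lemma (in cvs) wt_sum_direct:
  assumes f: "lin_on UNIV UNIV f" and v: "f v = r *s v"
    and span: "v \<in> span {u. \<exists>t. t \<noteq> r \<and> f u = t *s u}"
  shows "v = 0"
proof -
  note sU = subspace_UNIV
  note lin = lin_onD[OF opoly_lin[OF f sU]]
  let ?S = "{u. \<exists>p. poly p r \<noteq> 0 \<and> opoly p f u = 0}"
  have "\<exists>p. poly p r \<noteq> 0 \<and> opoly p f v = 0"
    using span
  proof (rule span_induct)
    show "subspace ?S"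
    proof (rule subspaceI)
      show "0 \<in> ?S" using lin_on_0[OF opoly_lin[OF f sU] sU, of 1] by (intro CollectI exI[of _ 1]) simp
    next
      fix u w assume "u \<in> ?S" "w \<in> ?S"
      then obtain p q where p: "poly p r \<noteq> 0" "opoly p f u = 0" and q: "poly q r \<noteq> 0" "opoly q f w = 0" by auto
      have "opoly (p * q) f u = 0" "opoly (p * q) f w = 0"
        using p q opoly_mult[OF f sU, of u p q] opoly_mult[OF f sU, of w q p] lin_on_0[OF opoly_lin[OF f sU] sU]
        by (auto simp: mult.commute)
      then have "opoly (p * q) f (u + w) = 0" using lin(2)[of u w "p * q"] by simp
      then show "u + w \<in> ?S" using p q by (intro CollectI exI[of _ "p * q"]) auto
    next
      fix k u assume "u \<in> ?S"
      then show "k *s u \<in> ?S" using lin(3)[of u] by auto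
    qed
    fix u assume "u \<in> {u. \<exists>t. t \<noteq> r \<and> f u = t *s u}"
    then obtain t where "t \<noteq> r" "f u = t *s u" by blast
    then have "poly [:- t, 1:] r \<noteq> 0 \<and> opoly [:- t, 1:] f u = 0" by (simp add: opoly_pCons)
    then show "\<exists>p. poly p r \<noteq> 0 \<and> opoly p f u = 0" by blast
  qed
  then obtain p where "poly p r \<noteq> 0" "opoly p f v = 0" by blast
  then show ?thesis using opoly_eigen[OF f UNIV_I v sU, of p] by simp
qed

context bms_ops
begin

definition generated :: "(nat \<Rightarrow> 'v) \<Rightarrow> 'v set" where
  "generated y = span {foldr A xs (y n) | xs n. True}"

lemma generated_base: "y n \<in> generated y"
proof -
  have "foldr A [] (y n) \<in> generated y" unfolding generated_def by (rule span_base) blast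
  then show ?thesis by simp
qed

lemma generated_closed:
  assumes "v \<in> generated y" shows "A x v \<in> generated y"
  using assms unfolding generated_def
proof (rule span_induct)
  let ?W = "{foldr A xs (y n) | xs n. True}"
  show "subspace {v. A x v \<in> span ?W}"
    by (rule subspaceI) (auto simp: span_zero intro: span_add span_scale)
  fix v assume "v \<in> ?W"
  then obtain xs n where "v = foldr A xs (y n)" by blast
  then have "A x v = foldr A (x # xs) (y n)" by simp
  then show "A x v \<in> span ?W" by (intro span_base) blast
qed

text \<open>Moving the operator that acts first to the end of a word costs shorter words of the same degree.\<close>

lemma move_first_operator_last:
  assumes "subspace U" "A x (foldr A xs v) \<in> U"
    and "\<And>ws. length ws = length xs \<Longrightarrow> sum_list (map deg2 ws) = sum_list (map deg2 xs) + deg2 x \<Longrightarrow> foldr A ws v \<in> U"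
  shows "foldr A xs (A x v) \<in> U"
  using assms
proof (induction xs arbitrary: U)
  case Nil
  then show ?case by simp
next
  case (Cons x' xs)
  let ?U = "{u. A x' u \<in> U}" and ?w = "foldr A xs v"
  note U = Cons.prems(1)
  have "subspace ?U" using U by (auto simp: subspace_def)
  moreover have "A x ?w \<in> ?U"
  proof -
    have "lin_ext scale A (bms_basis_bracket x' x) ?w \<in> U"
      unfolding lin_ext_def
    proof (intro subspace_sum[OF U] subspace_scale[OF U])
      fix \<beta> assume "\<beta> \<in> Poly_Mapping.keys (bms_basis_bracket x' x)"
      from deg2_bracket[OF this] have "foldr A (\<beta> # xs) v \<in> U" by (intro Cons.prems(3)) simp_all
      then show "A \<beta> ?w \<in> U" by simp
    qed
    moreover have "A x (A x' ?w) \<in> U" using Cons.prems(2) by simp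
    ultimately show ?thesis using A_bracket[of x' x ?w] subspace_add[OF U] subspace_scale[OF U] by simp
  qed
  moreover have "foldr A ws v \<in> ?U" if "length ws = length xs" "sum_list (map deg2 ws) = sum_list (map deg2 xs) + deg2 x" for ws
    using Cons.prems(3)[of "x' # ws"] that by simp
  ultimately have "foldr A xs (A x v) \<in> ?U" by (rule Cons.IH)
  then show ?case by simp
qed

text \<open>The multiples of the half line's vector of degree \<open>d / 2\<close>; none of its vectors has an odd \<open>d\<close>.\<close>

definition line_at :: "(nat \<Rightarrow> 'v) \<Rightarrow> int \<Rightarrow> 'v set" where
  "line_at y d = (if even d then span {y (nat (d div 2))} else {0})"

lemma line_at_step:
  assumes hl: "half_line c b y" and d: "0 \<le> d" "0 \<le> d + deg2 x" and v: "v \<in> line_at y d"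
  shows "A x v \<in> line_at y (d + deg2 x)"
proof (cases "even d")
  case False
  then have "v = 0" using v by (simp add: line_at_def)
  then show ?thesis by (simp add: line_at_def span_zero)
next
  case True
  then obtain n where n: "d = 2 * int n" using d(1) by (metis evenE nonneg_int_cases zero_le_mult_iff zero_le_numeral nle_le not_numeral_le_zero)
  obtain k where k: "v = k *s y n" using v True n by (auto simp: line_at_def span_singleton)
  show ?thesis
  proof (cases x)
    case (bmsL j)
    then have "A x (y n) = (- (c + of_nat n + b * of_int j)) *s y (nat (int n + j))"
      using hl d n by (simp add: half_line_def)
    then have "A x v = (k * - (c + of_nat n + b * of_int j)) *s y (nat (int n + j))"
      by (simp only: k A_scale scale_scale)
    moreover have "line_at y (d + deg2 x) = span {y (nat (int n + j))}"
      using bmsL n by (simp add: line_at_def)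
    ultimately show ?thesis by (simp only:) (rule span_scale, rule span_base, simp)
  next
    case (bmsI j)
    then have "A x (y n) = 0" using hl d n by (simp add: half_line_def)
    then show ?thesis by (simp add: k line_at_def span_zero)
  next
    case (bmsQ j)
    then have "A x (y n) = 0" using hl d n by (simp add: half_line_def)
    then show ?thesis by (simp add: k line_at_def span_zero)
  next
    case bmsC1
    then have "A x (y n) = 0" using hl by (simp add: half_line_def)
    then show ?thesis by (simp add: k line_at_def span_zero)
  next
    case bmsC2
    then have "A x (y n) = 0" using hl by (simp add: half_line_def)
    then show ?thesis by (simp add: k line_at_def span_zero)
  qed
qed

text \<open>An operator that leaves the half line at once can be moved to the end of the word. There it acts on
  a vector of the half line, by induction, and leads to a point of nonnegative degree.\<close>

lemma word_in_line:
  assumes hl: "half_line c b y" and d: "0 \<le> 2 * int n + sum_list (map deg2 xs)"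
  shows "foldr A xs (y n) \<in> line_at y (2 * int n + sum_list (map deg2 xs))"
  using d
proof (induction "length xs" arbitrary: xs n)
  case 0
  then show ?case by (simp add: line_at_def span_base)
next
  case (Suc r)
  obtain zs x where xs: "xs = zs @ [x]" and zs: "length zs = r"
    using Suc(2) by (metis length_Suc_conv_rev)
  let ?d = "2 * int n + sum_list (map deg2 xs)"
  have U: "subspace (line_at y ?d)" by (simp add: line_at_def)
  have d0: "0 \<le> 2 * int n" by simp
  have base: "y n \<in> line_at y (2 * int n)" by (simp add: line_at_def span_base)
  have "foldr A zs (A x (y n)) \<in> line_at y ?d"
  proof (cases "0 \<le> 2 * int n + deg2 x")
    case True
    note in_line = line_at_step[OF hl d0 True base]
    show ?thesis
    proof (cases "even (2 * int n + deg2 x)")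
      case False
      then have "A x (y n) = 0" using in_line by (simp add: line_at_def)
      moreover have "foldr A zs 0 = 0" by (induction zs) auto
      ultimately show ?thesis using subspace_0[OF U] by simp
    next
      case even: True
      define m where "m = nat ((2 * int n + deg2 x) div 2)"
      have m: "2 * int n + deg2 x = 2 * int m" using even True by (auto simp: m_def)
      obtain k where k: "A x (y n) = k *s y m"
        using in_line even by (auto simp: line_at_def span_singleton m_def)
      have sc: "foldr A zs (k *s v) = k *s foldr A zs v" for v by (induction zs) auto
      have e: "?d = 2 * int m + sum_list (map deg2 zs)" using m xs by simp
      have "foldr A zs (y m) \<in> line_at y ?d"
        unfolding e by (rule Suc(1)) (use zs Suc.prems e in auto)
      then show ?thesis unfolding k sc by (rule subspace_scale[OF U])
    qed
  next
    case False
    show ?thesis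
    proof (rule move_first_operator_last[OF U])
      let ?e = "2 * int n + sum_list (map deg2 zs)"
      have e: "?d = ?e + deg2 x" "0 \<le> ?e" using False Suc.prems xs by auto
      have "foldr A zs (y n) \<in> line_at y ?e" by (rule Suc(1)) (use zs e in auto)
      then show "A x (foldr A zs (y n)) \<in> line_at y ?d"
        using line_at_step[OF hl e(2)] Suc.prems unfolding e(1) by blast
    next
      fix ws :: "bms_basis list"
      assume ws: "length ws = length zs" "sum_list (map deg2 ws) = sum_list (map deg2 zs) + deg2 x"
      have e: "?d = 2 * int n + sum_list (map deg2 ws)" using ws xs by simp
      show "foldr A ws (y n) \<in> line_at y ?d" unfolding e
        by (rule Suc(1)) (use ws zs Suc.prems e in auto)
    qed
  qed
  then show ?case by (simp add: xs)
qed

lemma half_line_wt: "half_line c b y \<Longrightarrow> y n \<in> wt (c + of_nat n)"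
  unfolding half_line_def by (elim conjE allE[of _ n] allE[of _ "0::int"]) (simp add: wt_def)

lemma word_wt: "v \<in> wt s \<Longrightarrow> foldr A xs v \<in> wt (s + of_int (sum_list (map deg2 xs)) / 2)"
proof (induction xs)
  case (Cons x xs)
  show ?case using A_wt[OF Cons.IH[OF Cons.prems], of x] by (simp add: add_divide_distrib algebra_simps)
qed simp

text \<open>A word that leads to the weight of \<open>y m\<close> leads to a multiple of \<open>y m\<close>, and all other words lead to
  other weights.\<close>

theorem generated_wt:
  assumes hl: "half_line c b y" and v: "v \<in> generated y" "v \<in> wt (c + of_nat m)"
  shows "v \<in> span {y m}"
proof -
  let ?s = "c + of_nat m" and ?O = "span {u. \<exists>t. t \<noteq> - (c + of_nat m) \<and> A (bmsL 0) u = t *s u}"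
  let ?P = "{v. \<exists>v0\<in>span {y m}. \<exists>v1\<in>?O. v = v0 + v1}"
  have "\<exists>v0\<in>span {y m}. \<exists>v1\<in>?O. v = v0 + v1"
    using v(1) unfolding generated_def
  proof (rule span_induct)
    have "subspace {x + z | x z. x \<in> span {y m} \<and> z \<in> ?O}" by (rule subspace_sums) auto
    moreover have "?P = {x + z | x z. x \<in> span {y m} \<and> z \<in> ?O}" by blast
    ultimately show "subspace ?P" by simp
    fix v assume "v \<in> {foldr A xs (y n) | xs n. True}"
    then obtain xs n where v: "v = foldr A xs (y n)" by blast
    let ?d = "2 * int n + sum_list (map deg2 xs)"
    show "\<exists>v0\<in>span {y m}. \<exists>v1\<in>?O. v = v0 + v1"
    proof (cases "?d = 2 * int m")
      case True
      then have "v \<in> span {y m}" using word_in_line[OF hl, of n xs] by (simp add: v line_at_def)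
      then show ?thesis using span_zero[of "{u. \<exists>t. t \<noteq> - (c + of_nat m) \<and> A (bmsL 0) u = t *s u}"] by force
    next
      case False
      have "v \<in> wt (c + of_nat n + of_int (sum_list (map deg2 xs)) / 2)"
        unfolding v by (rule word_wt[OF half_line_wt[OF hl]])
      also have "c + of_nat n + of_int (sum_list (map deg2 xs)) / 2 = c + of_int ?d / 2"
        by (simp add: add_divide_distrib)
      finally have "A (bmsL 0) v = (- (c + of_int ?d / 2)) *s v" by (simp add: wt_def)
      moreover have "- (c + of_int ?d / 2) \<noteq> - (c + of_nat m)"
      proof
        assume "- (c + of_int ?d / 2) = - (c + of_nat m)"
        then have "complex_of_int ?d = of_int (2 * int m)" by (simp add: field_simps)
        with False show False unfolding of_int_eq_iff by blast
      qed
      ultimately have "v \<in> ?O" by (intro span_base) blast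
      then show ?thesis using span_zero[of "{y m}"] by force
    qed
  qed
  then obtain v0 v1 where d: "v0 \<in> span {y m}" "v1 \<in> ?O" "v = v0 + v1" by blast
  have "v0 \<in> wt ?s" using d(1) half_line_wt[OF hl, of m] subspace_scale[OF wt_subspace] by (auto simp: span_singleton)
  then have "v1 \<in> wt ?s" using v(2) d(3) subspace_diff[OF wt_subspace, of v ?s v0] by simp
  then have "v1 = 0" using wt_sum_direct[OF A_lin _ d(2)] by (simp add: wt_def)
  then show ?thesis using d by simp
qed

end

section \<open>Modules as families of operators\<close>

abbreviation rep_op :: "'v bms_rep \<Rightarrow> bms_basis \<Rightarrow> 'v \<Rightarrow> 'v" where
  "rep_op V x \<equiv> act V (bms_vec x)"

lemma bms_vec_part: "bms_vec x \<in> bms_part (bms_parity x)"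
  by (simp add: bms_part_def)

lemma bms_bracket_vec: "bms_bracket (bms_vec x) (bms_vec y) = bms_basis_bracket x y"
  by (auto simp: bms_bracket_def bilinear_extension_def intro!: poly_mapping_eqI)

lemma act_expand:
  assumes "bms_module V"
  shows "act V u v = lin_ext (smul V) (rep_op V) u v"
proof -
  interpret f: Vector_Spaces.linear pm_scale "smul V" "\<lambda>x. act V x v"
    using assms by (simp add: bms_module_def)
  have "u = (\<Sum>\<beta>\<in>Poly_Mapping.keys u. pm_scale (Poly_Mapping.lookup u \<beta>) (bms_vec \<beta>))"
    by (rule poly_mapping_eqI) (simp add: lookup_sum lookup_single when_def in_keys_iff if_distrib[of "(*) _"] cong: if_cong)
  then have "act V u v = act V (\<Sum>\<beta>\<in>Poly_Mapping.keys u. pm_scale (Poly_Mapping.lookup u \<beta>) (bms_vec \<beta>)) v" by simp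
  then show ?thesis by (simp add: f.sum f.scale lin_ext_def)
qed

lemma act_part:
  "bms_module V \<Longrightarrow> x \<in> bms_part p \<Longrightarrow> v \<in> part V q \<Longrightarrow> act V x v \<in> part V (p + q)"
  by (simp add: bms_module_def)

lemma parts_decompose:
  "bms_module V \<Longrightarrow> \<exists>u\<in>part V 0. \<exists>w\<in>part V 1. v = u + w"
  by (simp add: bms_module_def)

lemma bms_parity_opp: "bms_parity (opp x) = bms_parity x"
  by (cases x) auto

lemma module_ops:
  assumes V: "bms_module V"
  shows "bms_ops (smul V) (rep_op V)"
proof -
  interpret cvs "smul V" using V by (simp add: bms_module_def cvs_def)
  show ?thesis
  proof (intro_locales, unfold_locales)
    fix x
    interpret f: Vector_Spaces.linear "smul V" "smul V" "rep_op V x"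
      using V by (simp add: bms_module_def)
    show "lin_on UNIV UNIV (rep_op V x)" by (simp add: lin_on_def f.add f.scale)
  next
    fix x y v
    have "act V (bms_bracket (bms_vec x) (bms_vec y)) v = rep_op V x (rep_op V y v)
        - smul V (parity_sign (bms_parity x) (bms_parity y)) (rep_op V y (rep_op V x v))"
      using V bms_vec_part[of x] bms_vec_part[of y] unfolding bms_module_def by blast
    moreover have e: "act V (bms_basis_bracket x y) v = lin_ext (smul V) (rep_op V) (bms_basis_bracket x y) v"
      by (rule act_expand[OF V])
    ultimately show "rep_op V x (rep_op V y v) = smul V (parity_sign (bms_parity x) (bms_parity y)) (rep_op V y (rep_op V x v))
        + lin_ext (smul V) (rep_op V) (bms_basis_bracket x y) v"
      unfolding bms_bracket_vec e by (simp add: eq_diff_eq add.commute)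
  qed
qed

lemma A_act_expand: "act (A_module a b) u f = lin_ext pm_scale (rep_op (A_module a b)) u f"
  by (auto simp: A_module_def lin_ext_def bilinear_extension_def lookup_sum sum_distrib_left mult.assoc
      intro!: poly_mapping_eqI)

lemma A_op_L: "Poly_Mapping.lookup (rep_op (A_module a b) (bmsL m) f) j
    = - (a + of_int (j - m) + b * of_int m) * Poly_Mapping.lookup f (j - m)"
proof -
  have "Poly_Mapping.lookup (rep_op (A_module a b) (bmsL m) f) j
      = (\<Sum>i\<in>Poly_Mapping.keys f. Poly_Mapping.lookup f i * (if m + i = j then - (a + of_int i + b * of_int m) else 0))"
    by (simp add: A_module_def bilinear_extension_def lookup_sum lookup_single when_def) (intro sum.cong, auto)
  also have "\<dots> = (\<Sum>i\<in>Poly_Mapping.keys f. if i = j - m then - (a + of_int (j - m) + b * of_int m) * Poly_Mapping.lookup f (j - m) else 0)"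
    by (intro sum.cong) auto
  finally show ?thesis by (simp add: in_keys_iff)
qed

lemma A_op_other: "(\<And>m. x \<noteq> bmsL m) \<Longrightarrow> rep_op (A_module a b) x f = 0"
  by (cases x) (auto simp: A_module_def bilinear_extension_def intro!: poly_mapping_eqI simp: lookup_sum)

lemma A_op_single: "rep_op (A_module a b) (bmsL m) (Poly_Mapping.single i 1) = Poly_Mapping.single (m + i) (- (a + of_int i + b * of_int m))"
  by (rule poly_mapping_eqI) (auto simp: A_op_L lookup_single when_def)

lemma A_ops: "bms_ops pm_scale (rep_op (A_module a b))"
proof (rule bms_opsI)
  let ?A = "rep_op (A_module a b)"
  have z: "?A (bmsI m) f = 0" "?A (bmsQ m) f = 0" "?A bmsC1 f = 0" "?A bmsC2 f = 0" for m f
    by (simp_all add: A_op_other)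
  have l0: "?A x 0 = 0" for x
    by (cases x) (auto intro!: poly_mapping_eqI simp: A_op_L z)
  show "vector_space pm_scale" by (rule vector_space_pm_scale)
  show "?A x (u + v) = ?A x u + ?A x v" for x u v
    by (cases x) (auto intro!: poly_mapping_eqI simp: A_op_L z lookup_add algebra_simps)
  show "?A x (pm_scale c v) = pm_scale c (?A x v)" for x c v
    by (cases x) (auto intro!: poly_mapping_eqI simp: A_op_L z)
  show "?A (bmsL m) (?A (bmsL n) v) = ?A (bmsL n) (?A (bmsL m) v) + pm_scale (of_int (m - n)) (?A (bmsL (m + n)) v)
      + (if m + n = 0 then pm_scale (of_int (m ^ 3 - m) / 12) (?A bmsC1 v) else 0)" for m n v
  proof (rule poly_mapping_eqI)
    fix j
    define x where "x = Poly_Mapping.lookup v (j - m - n)"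
    have if0: "(if m + n = 0 then pm_scale (of_int (m ^ 3 - m) / 12) (?A bmsC1 v) else 0) = 0"
      by (auto simp: z intro!: poly_mapping_eqI)
    have ring: "- (a + (J - M) + b * M) * (- (a + (J - M - N) + b * N) * X)
        = - (a + (J - N) + b * N) * (- (a + (J - M - N) + b * M) * X) + (M - N) * (- (a + (J - M - N) + b * (M + N)) * X)"
      for J M N X by (simp add: algebra_simps)
    have e: "j - (m + n) = j - m - n" "j - n - m = j - m - n" by simp_all
    show "Poly_Mapping.lookup (?A (bmsL m) (?A (bmsL n) v)) j = Poly_Mapping.lookup (?A (bmsL n) (?A (bmsL m) v)
      + pm_scale (of_int (m - n)) (?A (bmsL (m + n)) v)
      + (if m + n = 0 then pm_scale (of_int (m ^ 3 - m) / 12) (?A bmsC1 v) else 0)) j"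
      unfolding if0 add_0_right
      by (simp only: A_op_L lookup_add lookup_pm_scale e x_def[symmetric] of_int_diff of_int_add ring)
  qed
  show "?A bmsC1 (?A x v) = ?A x (?A bmsC1 v)" "?A bmsC2 (?A x v) = ?A x (?A bmsC2 v)" for x v
    by (simp_all add: z l0)
qed (auto simp: A_op_other intro!: poly_mapping_eqI simp: A_op_L lookup_add)

abbreviation pair_scale :: "(complex \<Rightarrow> 'v \<Rightarrow> 'v) \<Rightarrow> (complex \<Rightarrow> 'w \<Rightarrow> 'w) \<Rightarrow> complex \<Rightarrow> 'v \<times> 'w \<Rightarrow> 'v \<times> 'w" where
  "pair_scale s t c p \<equiv> (s c (fst p), t c (snd p))"

abbreviation pair_ops :: "(bms_basis \<Rightarrow> 'v \<Rightarrow> 'v) \<Rightarrow> (bms_basis \<Rightarrow> 'w \<Rightarrow> 'w) \<Rightarrow> bms_basis \<Rightarrow> 'v \<times> 'w \<Rightarrow> 'v \<times> 'w" where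
  "pair_ops A B x p \<equiv> (A x (fst p), B x (snd p))"

lemma bms_ops_pair:
  assumes "bms_ops s A" "bms_ops t B"
  shows "bms_ops (pair_scale s t) (pair_ops A B)"
proof -
  interpret A: bms_ops s A by fact
  interpret B: bms_ops t B by fact
  have vs: "vector_space (pair_scale s t)"
    by unfold_locales
      (auto simp: A.scale_right_distrib A.scale_left_distrib B.scale_right_distrib B.scale_left_distrib)
  interpret cvs "pair_scale s t" using vs by (simp add: cvs_def)
  have ext: "lin_ext (pair_scale s t) (pair_ops A B) u p = (lin_ext s A u (fst p), lin_ext t B u (snd p))" for u p
    by (rule prod_eqI) (simp_all add: lin_ext_def fst_sum snd_sum)
  show ?thesis
  proof (intro_locales, unfold_locales)
    show "lin_on UNIV UNIV (pair_ops A B x)" for x by (simp add: lin_on_def)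
    show "pair_ops A B x (pair_ops A B y p) = pair_scale s t (parity_sign (bms_parity x) (bms_parity y)) (pair_ops A B y (pair_ops A B x p))
        + lin_ext (pair_scale s t) (pair_ops A B) (bms_basis_bracket x y) p" for x y p
      using A.A_bracket[of x y "fst p"] B.A_bracket[of x y "snd p"] by (simp add: ext)
  qed
qed

section \<open>Invariant relations with a module of the intermediate series\<close>

lemma bit_cases: "(e::bit) = 0 \<or> e = 1"
  by (cases e) auto

lemma submodule_cases:
  assumes "simple_module V" "submodule V S"
  shows "S = {0} \<or> S = UNIV"
  using assms by (simp add: simple_module_def)

text \<open>When the odd operators vanish, the two graded parts are submodules.\<close>

lemma concentrated_in_one_parity:
  assumes V: "simple_module V" and Q: "\<And>k v. rep_op V (bmsQ k) v = 0"
  obtains e where "\<And>p. part V p = (if p = e then UNIV else {0})"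
proof -
  have m: "bms_module V" using V by (simp add: simple_module_def)
  interpret bms_ops "smul V" "rep_op V" by (rule module_ops[OF m])
  have sub: "subspace (part V p)" for p using m by (simp add: bms_module_def)
  have dec: "\<exists>u\<in>part V 0. \<exists>w\<in>part V 1. v = u + w" and int: "part V 0 \<inter> part V 1 = {0}" for v
    using m by (simp_all add: bms_module_def)
  have "submodule V (part V p)" for p
    unfolding submodule_def
  proof (intro conjI ballI allI)
    show "subspace (part V p)" by (rule sub)
    fix v assume v: "v \<in> part V p"
    show "\<exists>u\<in>part V p \<inter> part V 0. \<exists>w\<in>part V p \<inter> part V 1. v = u + w"
      using bit_cases[of p]
    proof
      assume "p = 0"
      then show ?thesis using v subspace_0[OF sub] by (intro bexI[of _ v] bexI[of _ 0]) auto
    next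
      assume "p = 1"
      then show ?thesis using v subspace_0[OF sub] by (intro bexI[of _ 0] bexI[of _ v]) auto
    qed
    fix x
    show "act V x v \<in> part V p"
    proof (subst act_expand[OF m], unfold lin_ext_def, intro subspace_sum[OF sub] subspace_scale[OF sub])
      fix \<beta>
      show "rep_op V \<beta> v \<in> part V p"
      proof (cases "bms_parity \<beta> = 0")
        case True
        then show ?thesis using act_part[OF m bms_vec_part[of \<beta>] v] unfolding True add_0_left by simp
      next
        case False
        then obtain k where "\<beta> = bmsQ k" by (cases \<beta>) auto
        then show ?thesis using Q subspace_0[OF sub] by simp
      qed
    qed
  qed
  then have c: "part V p = {0} \<or> part V p = UNIV" for p using submodule_cases[OF V] by blast
  have nt: "(UNIV::'a set) \<noteq> {0}" using V by (simp add: simple_module_def)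
  show thesis
  proof (cases "part V 0 = UNIV")
    case True
    then have "part V 1 = {0}" using int by auto
    then show ?thesis using True that[of 0] bit_cases by metis
  next
    case False
    then have z: "part V 0 = {0}" using c by blast
    then have "part V 1 = UNIV" using dec c nt by (metis UNIV_eq_I add_0 singletonD)
    then show ?thesis using z that[of 1] bit_cases by metis
  qed
qed

lemma A_submoduleI:
  assumes "module.subspace pm_scale S" "\<And>x f. f \<in> S \<Longrightarrow> act (A_module a b) x f \<in> S"
  shows "submodule (A_module a b) S"
  using assms module.subspace_0[OF _ assms(1)] vector_space_pm_scale
  by (auto simp: submodule_def A_module_def vector_space_def module_def)

text \<open>The vectors of \<open>V\<close> that are related to some vector form a nonzero submodule, hence all of \<open>V\<close>. Those
  related to \<open>0\<close> form a proper submodule, hence \<open>0\<close>. So the relation is the graph of a map onto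
  \<open>V\<close>, from the submodule \<open>S\<close> of \<open>\<A>\<^sub>a\<^sub>,\<^sub>b\<close> and with the kernel \<open>T\<close>.\<close>

lemma isomorphic_of_relation:
  fixes V :: "'v::ab_group_add bms_rep"
  assumes V: "simple_module V"
    and add: "\<And>u f u' f'. (u, f) \<in> R \<Longrightarrow> (u', f') \<in> R \<Longrightarrow> (u + u', f + f') \<in> R"
    and scale: "\<And>k u f. (u, f) \<in> R \<Longrightarrow> (smul V k u, pm_scale k f) \<in> R"
    and closed: "\<And>x u f. (u, f) \<in> R \<Longrightarrow> (rep_op V x u, rep_op (A_module a b) x f) \<in> R"
    and graded: "\<And>u f. (u, f) \<in> R \<Longrightarrow> \<exists>u0\<in>part V e. \<exists>u1\<in>part V (e + 1). u = u0 + u1 \<and> (u0, f) \<in> R \<and> (u1, 0) \<in> R"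
    and nz: "(v, w) \<in> R" "v \<noteq> 0" and proper: "(v', 0) \<notin> R"
  shows "isomorphic_to_A' V a b"
proof -
  let ?M = "A_module a b"
  have m: "bms_module V" using V by (simp add: simple_module_def)
  interpret A: bms_ops "smul V" "rep_op V" by (rule module_ops[OF m])
  interpret B: bms_ops pm_scale "rep_op ?M" by (rule A_ops)
  have zero: "(0, 0) \<in> R" using scale[OF nz(1), of 0] by simp
  have diff: "(u - u', f - f') \<in> R" if "(u, f) \<in> R" "(u', f') \<in> R" for u u' f f'
    using add[OF that(1) scale[OF that(2), of "-1"]] by simp
  have closed': "(act V x u, act ?M x f) \<in> R" if "(u, f) \<in> R" for x u f
  proof -
    have "((\<Sum>\<beta>\<in>I. smul V (Poly_Mapping.lookup x \<beta>) (rep_op V \<beta> u)),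
        (\<Sum>\<beta>\<in>I. pm_scale (Poly_Mapping.lookup x \<beta>) (rep_op ?M \<beta> f))) \<in> R" if "finite I" for I
      using that by (induction I) (auto simp: zero intro!: add scale closed \<open>(u, f) \<in> R\<close>)
    then show ?thesis by (subst act_expand[OF m], subst A_act_expand) (simp add: lin_ext_def)
  qed
  have act0: "act V x 0 = 0" "act ?M x 0 = 0" for x
    by (subst act_expand[OF m], simp add: lin_ext_def) (subst A_act_expand, simp add: lin_ext_def)
  have swap: "\<exists>u\<in>S \<inter> part V 0. \<exists>w\<in>S \<inter> part V 1. z = u + w"
    if "u0 \<in> S" "u0 \<in> part V e" "u1 \<in> S" "u1 \<in> part V (e + 1)" "z = u0 + u1" for S u0 u1 z
    using bit_cases[of e]
  proof
    assume "e = 0"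
    then show ?thesis using that by (intro bexI[of _ u0] bexI[of _ u1]) auto
  next
    assume "e = 1"
    then show ?thesis using that by (intro bexI[of _ u1] bexI[of _ u0]) (auto simp: add.commute)
  qed
  have D: "submodule V {u. \<exists>f. (u, f) \<in> R}"
    unfolding submodule_def
  proof (intro conjI ballI allI)
    show "A.subspace {u. \<exists>f. (u, f) \<in> R}"
      by (rule A.subspaceI) (use zero add scale in blast)+
    fix u assume "u \<in> {u. \<exists>f. (u, f) \<in> R}"
    then obtain f where f: "(u, f) \<in> R" by blast
    from graded[OF f] obtain u0 u1 where "u0 \<in> part V e" "u1 \<in> part V (e + 1)" "u = u0 + u1" "(u0, f) \<in> R" "(u1, 0) \<in> R" by blast
    then show "\<exists>y\<in>{u. \<exists>f. (u, f) \<in> R} \<inter> part V 0. \<exists>w\<in>{u. \<exists>f. (u, f) \<in> R} \<inter> part V 1. u = y + w"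
      by (intro swap[of u0 _ u1]) auto
    show "act V x u \<in> {u. \<exists>f. (u, f) \<in> R}" for x using closed'[OF f] by blast
  qed
  have total: "\<exists>f. (u, f) \<in> R" for u
    using submodule_cases[OF V D] nz by blast
  have K: "submodule V {u. (u, 0) \<in> R}"
    unfolding submodule_def
  proof (intro conjI ballI allI)
    show "A.subspace {u. (u, 0) \<in> R}"
      by (rule A.subspaceI) (use zero add[of _ 0 _ 0] scale[of _ 0] in auto)
    fix u assume "u \<in> {u. (u, 0) \<in> R}"
    then have f: "(u, 0) \<in> R" by blast
    from graded[OF f] obtain u0 u1 where "u0 \<in> part V e" "u1 \<in> part V (e + 1)" "u = u0 + u1" "(u0, 0) \<in> R" "(u1, 0) \<in> R" by blast
    then show "\<exists>y\<in>{u. (u, 0) \<in> R} \<inter> part V 0. \<exists>w\<in>{u. (u, 0) \<in> R} \<inter> part V 1. u = y + w"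
      by (intro swap[of u0 _ u1]) auto
    show "act V x u \<in> {u. (u, 0) \<in> R}" for x using closed'[OF f, of x] act0 by simp
  qed
  have K0: "u = 0" if "(u, 0) \<in> R" for u
    using submodule_cases[OF V K] proper that by blast
  have func: "u = u'" if "(u, f) \<in> R" "(u', f) \<in> R" for u u' f
    using K0[of "u - u'"] diff[OF that] by simp
  have "rep_op V (bmsQ k) u = 0" for k u
  proof -
    obtain f where "(u, f) \<in> R" using total by blast
    from closed[OF this, of "bmsQ k"] show ?thesis by (intro K0) (simp add: A_op_other)
  qed
  then obtain e' where e': "\<And>p. part V p = (if p = e' then UNIV else {0})"
    using concentrated_in_one_parity[OF V] by blast
  have pA: "part ?M p = (if p = 0 then UNIV else {0})" and sm: "smul ?M = pm_scale" for p by (simp_all add: A_module_def)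
  have shift: "part V (p + e') = (if p = 0 then UNIV else {0})" "part V p = (if p + e' = 0 then UNIV else {0})" for p
    unfolding e' using bit_cases[of p] bit_cases[of e'] by auto
  define S where "S = {f. \<exists>u. (u, f) \<in> R}"
  define T where "T = {f. (0, f) \<in> R}"
  have S: "submodule ?M S"
  proof (rule A_submoduleI)
    show "B.subspace S" unfolding S_def by (rule B.subspaceI) (use zero add scale in blast)+
    show "act ?M x f \<in> S" if "f \<in> S" for x f using that closed' unfolding S_def by blast
  qed
  have T: "submodule ?M T"
  proof (rule A_submoduleI)
    show "B.subspace T" unfolding T_def by (rule B.subspaceI) (use zero add[of 0 _ 0] scale[of 0] in auto)
    show "act ?M x f \<in> T" if "f \<in> T" for x f using that closed'[of 0 f x] act0 unfolding T_def by simp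
  qed
  have TS: "T \<subseteq> S" by (auto simp: S_def T_def)
  show ?thesis
  proof (cases "simple_module ?M")
    case True
    have "w \<in> S" "w \<noteq> 0" using nz K0 by (auto simp: S_def)
    then have "S = UNIV" using submodule_cases[OF True S] by blast
    moreover have "T = {0}"
    proof -
      have "w \<notin> T" using func[OF nz(1), of 0] nz(2) by (auto simp: T_def)
      then show ?thesis using submodule_cases[OF True T] by blast
    qed
    ultimately have onto: "\<exists>u. (u, f) \<in> R" and inj: "(0, f) \<in> R \<Longrightarrow> f = 0" for f
      by (auto simp: S_def T_def)
    have uniq: "f = f'" if "(u, f) \<in> R" "(u, f') \<in> R" for u f f'
      using inj[of "f - f'"] diff[OF that] by simp
    define g where "g u = (THE f. (u, f) \<in> R)" for u
    have g: "g u = f" if "(u, f) \<in> R" for u f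
      unfolding g_def by (rule the_equality) (use that uniq in auto)
    have gR: "(u, g u) \<in> R" for u using total[of u] g by blast
    have "Vector_Spaces.linear (smul V) pm_scale g"
      by unfold_locales (use g[OF add[OF gR gR]] g[OF scale[OF gR]] in auto)
    moreover have "bij g"
    proof (rule bijI)
      show "inj g" using func gR by (metis injI)
      show "surj g" using onto g by (metis surjI surj_def)
    qed
    moreover have "g (act V x u) = act ?M x (g u)" for x u by (rule g) (rule closed'[OF gR])
    moreover have "g ` part V p = part ?M (p + e')" for p
    proof -
      have "g ` UNIV = UNIV" using \<open>bij g\<close> by (simp add: bij_is_surj)
      moreover have "g 0 = 0" by (rule g[OF zero])
      ultimately show ?thesis unfolding shift(2)[of p] pA by auto
    qed
    ultimately have "bms_isomorphic V ?M" unfolding bms_isomorphic_def sm by blast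
    then show ?thesis using True by (simp add: isomorphic_to_A'_def)
  next
    case False
    define g where "g C = (THE u. \<exists>f\<in>C. (u, f) \<in> R)" for C
    have g: "g ((+) f ` T) = u" if f: "(u, f) \<in> R" for u f
      unfolding g_def
    proof (rule the_equality)
      have "0 \<in> T" using zero by (simp add: T_def)
      then show "\<exists>f\<in>(+) f ` T. (u, f) \<in> R" using f by force
      fix u' assume "\<exists>f\<in>(+) f ` T. (u', f) \<in> R"
      then obtain t where "(0, t) \<in> R" "(u', f + t) \<in> R" by (auto simp: T_def)
      from diff[OF this(2,1)] f show "u' = u" by (auto intro: func)
    qed
    have "bij_betw g ((\<lambda>f. (+) f ` T) ` S) UNIV"
    proof (rule bij_betwI')
      fix C C' assume "C \<in> (\<lambda>f. (+) f ` T) ` S" "C' \<in> (\<lambda>f. (+) f ` T) ` S"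
      then obtain f f' u u' where C: "C = (+) f ` T" "C' = (+) f' ` T" "(u, f) \<in> R" "(u', f') \<in> R"
        by (auto simp: S_def)
      have "C = C'" if "u = u'"
      proof -
        have d: "(0, f - f') \<in> R" using diff[OF C(3,4)] that by simp
        have "(+) f ` T \<subseteq> (+) f' ` T"
        proof safe
          fix t assume "t \<in> T"
          then have "f - f' + t \<in> T" using add[OF d, of 0 t] by (simp add: T_def)
          then show "f + t \<in> (+) f' ` T" by (rule rev_image_eqI) simp
        qed
        moreover have "(+) f' ` T \<subseteq> (+) f ` T"
        proof safe
          fix t assume "t \<in> T"
          then have "t - (f - f') \<in> T" using diff[OF _ d, of 0 t] by (simp add: T_def)
          then show "f' + t \<in> (+) f ` T" by (rule rev_image_eqI) simp
        qed
        ultimately show ?thesis using C by blast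
      qed
      moreover have "g C = u" "g C' = u'" unfolding C(1,2) by (rule g[OF C(3)], rule g[OF C(4)])
      ultimately show "(g C = g C') = (C = C')" by auto
    next
      fix u :: 'v
      obtain f where "(u, f) \<in> R" using total by blast
      then show "\<exists>C\<in>(\<lambda>f. (+) f ` T) ` S. u = g C" using g by (force simp: S_def)
    qed simp
    moreover have "\<forall>f\<in>S. \<forall>f'\<in>S. g ((+) (f + f') ` T) = g ((+) f ` T) + g ((+) f' ` T)"
    proof (intro ballI)
      fix f f' assume "f \<in> S" "f' \<in> S"
      then obtain u u' where "(u, f) \<in> R" "(u', f') \<in> R" by (auto simp: S_def)
      then show "g ((+) (f + f') ` T) = g ((+) f ` T) + g ((+) f' ` T)" using g add by metis
    qed
    moreover have "\<forall>c. \<forall>f\<in>S. g ((+) (smul ?M c f) ` T) = smul V c (g ((+) f ` T))"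
    proof (intro ballI allI)
      fix c f assume "f \<in> S"
      then obtain u where "(u, f) \<in> R" by (auto simp: S_def)
      then show "g ((+) (smul ?M c f) ` T) = smul V c (g ((+) f ` T))" unfolding sm using g scale by metis
    qed
    moreover have "\<forall>x. \<forall>f\<in>S. g ((+) (act ?M x f) ` T) = act V x (g ((+) f ` T))"
    proof (intro ballI allI)
      fix x f assume "f \<in> S"
      then obtain u where "(u, f) \<in> R" by (auto simp: S_def)
      then show "g ((+) (act ?M x f) ` T) = act V x (g ((+) f ` T))" using g closed' by metis
    qed
    moreover have "\<forall>p. g ` (\<lambda>f. (+) f ` T) ` (S \<inter> part ?M p) = part V (p + e')"
    proof
      fix p
      have "g ` (\<lambda>f. (+) f ` T) ` S = UNIV"
        using \<open>bij_betw g ((\<lambda>f. (+) f ` T) ` S) UNIV\<close> by (simp add: bij_betw_def)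
      moreover have "S \<inter> {0} = {0}" "g ((+) 0 ` T) = 0" using zero g[OF zero] by (auto simp: S_def)
      ultimately show "g ` (\<lambda>f. (+) f ` T) ` (S \<inter> part ?M p) = part V (p + e')"
        unfolding shift(1) pA by auto
    qed
    ultimately have "isomorphic_to_quotient V ?M S T" unfolding isomorphic_to_quotient_def by blast
    then show ?thesis using False V S T TS by (auto simp: isomorphic_to_A'_def simple_subquotient_def)
  qed
qed

section \<open>The classification\<close>

text \<open>Each operator preserves or exchanges the parities, so that the equations of a half line hold for the
  components of either parity.\<close>

lemma (in bms_ops) half_line_component:
  assumes hl: "half_line c b y"
    and sub: "\<And>p. subspace (P p)" and int: "P 0 \<inter> P 1 = {0}"
    and A: "\<And>x p v. v \<in> P p \<Longrightarrow> A x v \<in> P (bms_parity x + p)"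
    and y: "\<And>n. y n = z n + z' n" and z: "\<And>n. z n \<in> P e" and z': "\<And>n. z' n \<in> P (e + 1)"
  shows "half_line c b z"
proof -
  have uniq: "u = w" if "u + u' = w + w'" "u \<in> P p" "w \<in> P p" "u' \<in> P (p + 1)" "w' \<in> P (p + 1)" for p u u' w w'
  proof -
    have "u - w = w' - u'" using that(1) by (simp add: algebra_simps)
    moreover have "u - w \<in> P p" "w' - u' \<in> P (p + 1)" using that subspace_diff[OF sub] by auto
    ultimately have "u - w \<in> P 0 \<inter> P 1" using bit_cases[of p] by auto
    then show ?thesis using int by simp
  qed
  have *: "A x (z n) = k *s z m" if "A x (y n) = k *s y m" "bms_parity x = 0" for x n k m
  proof (rule uniq[where p = e])
    show "A x (z n) + A x (z' n) = k *s z m + k *s z' m"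
      using that(1) by (simp add: y scale_right_distrib)
    show "A x (z n) \<in> P e" using A[OF z[of n], of x] unfolding that(2) add_0_left .
    show "A x (z' n) \<in> P (e + 1)" using A[OF z'[of n], of x] unfolding that(2) add_0_left .
  qed (rule subspace_scale[OF sub], rule z z')+
  have **: "A x (z n) = 0" if "A x (y n) = 0" for x n
  proof (rule uniq[where p = "bms_parity x + e"])
    show "A x (z n) + A x (z' n) = 0 + 0" using that by (simp add: y)
    show "A x (z n) \<in> P (bms_parity x + e)" by (rule A[OF z])
    show "A x (z' n) \<in> P (bms_parity x + e + 1)" unfolding add.assoc by (rule A[OF z'])
  qed (rule subspace_0[OF sub])+
  show ?thesis
    using hl unfolding half_line_def by (auto intro!: * **)
qed

text \<open>The relation is the submodule generated by a half line in the direct sum of the two modules. The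
  operators \<open>D\<close> are those of the direct sum, or their reflection. Odd operators kill the second
  component, and so \<open>(u, f)\<close> in the relation implies \<open>(u\<^sub>0, f)\<close> for the component \<open>u\<^sub>0\<close> of \<open>u\<close>
  with the parity of the half line.\<close>

lemma isomorphic_of_half_line:
  fixes V :: "'v::ab_group_add bms_rep"
  defines "sc \<equiv> pair_scale (smul V) pm_scale"
  assumes V: "simple_module V"
    and ops: "bms_ops sc D"
    and D_op: "\<And>x. \<exists>k x'. \<forall>p. D x p = sc k (pair_ops (rep_op V) (rep_op (A_module a b)) x' p) \<and> bms_parity x' = bms_parity x"
    and op_D: "\<And>x. \<exists>k x'. \<forall>p. pair_ops (rep_op V) (rep_op (A_module a b)) x p = sc k (D x' p)"
    and hl: "bms_ops.half_line sc D c b' (\<lambda>n. (z n, w n))"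
    and z: "\<And>n. z n \<in> part V e" and nz: "z 0 \<noteq> 0" "w 0 \<noteq> 0"
  shows "isomorphic_to_A' V a b"
proof -
  let ?M = "A_module a b"
  let ?Y = "\<lambda>n. (z n, w n)"
  have m: "bms_module V" using V by (simp add: simple_module_def)
  interpret A: bms_ops "smul V" "rep_op V" by (rule module_ops[OF m])
  interpret B: bms_ops pm_scale "rep_op ?M" by (rule A_ops)
  interpret D: bms_ops sc D by (rule ops)
  have sub: "A.subspace (part V p)" for p using m by (simp add: bms_module_def)
  define R where "R = D.generated ?Y"
  have R: "D.subspace R" by (simp add: R_def D.generated_def)
  have homogeneous: "(\<exists>q. fst (foldr D xs (?Y n)) \<in> part V q \<and> (q = e \<or> snd (foldr D xs (?Y n)) = 0))" for xs n
  proof (induction xs)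
    case Nil
    then show ?case using z by auto
  next
    case (Cons x xs)
    let ?p = "foldr D xs (?Y n)"
    obtain q where q: "fst ?p \<in> part V q" "q = e \<or> snd ?p = 0" using Cons by blast
    obtain k x' where x': "D x ?p = sc k (pair_ops (rep_op V) (rep_op ?M) x' ?p)" "bms_parity x' = bms_parity x"
      using D_op by blast
    have "fst (D x ?p) \<in> part V (bms_parity x + q)"
      using act_part[OF m bms_vec_part[of x'] q(1)] x' A.subspace_scale[OF sub] by (simp add: sc_def)
    moreover have "bms_parity x + q = e \<or> snd (D x ?p) = 0"
    proof (cases "bms_parity x' = 0 \<and> q = e")
      case True
      then show ?thesis using x'(2) by simp
    next
      case False
      then have "rep_op ?M x' (snd ?p) = 0"
        using q(2) A_op_other[of x' a b] by (cases x') auto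
      then show ?thesis using x'(1) by (simp add: sc_def)
    qed
    ultimately show ?case by auto
  qed
  have graded: "\<exists>u0\<in>part V e. \<exists>u1\<in>part V (e + 1). fst p = u0 + u1 \<and> (u0, snd p) \<in> R \<and> (u1, 0) \<in> R" if "p \<in> R" for p
    using that unfolding R_def D.generated_def
  proof (rule D.span_induct)
    let ?W = "{foldr D xs (?Y n) | xs n. True}"
    let ?G = "{p. \<exists>u0\<in>part V e. \<exists>u1\<in>part V (e + 1). fst p = u0 + u1 \<and> (u0, snd p) \<in> D.span ?W \<and> (u1, 0) \<in> D.span ?W}"
    show "D.subspace ?G"
    proof (rule D.subspaceI)
      have "0 \<in> part V e" "0 \<in> part V (e + 1)" "(0, 0) \<in> D.span ?W"
        using A.subspace_0[OF sub] D.span_zero[of ?W] by (auto simp: zero_prod_def)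
      then show "0 \<in> ?G" by force
    next
      fix p p' assume "p \<in> ?G" "p' \<in> ?G"
      then obtain u0 u1 u0' u1' where u: "u0 \<in> part V e" "u1 \<in> part V (e + 1)" "fst p = u0 + u1"
        "(u0, snd p) \<in> D.span ?W" "(u1, 0) \<in> D.span ?W" "u0' \<in> part V e" "u1' \<in> part V (e + 1)" "fst p' = u0' + u1'"
        "(u0', snd p') \<in> D.span ?W" "(u1', 0) \<in> D.span ?W" by blast
      have "(u0 + u0', snd (p + p')) \<in> D.span ?W" "(u1 + u1', 0) \<in> D.span ?W"
        using D.span_add[OF u(4,9)] D.span_add[OF u(5,10)] by simp_all
      moreover have "fst (p + p') = (u0 + u0') + (u1 + u1')" using u by (simp add: algebra_simps)
      ultimately show "p + p' \<in> ?G"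
        using A.subspace_add[OF sub u(1,6)] A.subspace_add[OF sub u(2,7)] by blast
    next
      fix k p assume "p \<in> ?G"
      then obtain u0 u1 where u: "u0 \<in> part V e" "u1 \<in> part V (e + 1)" "fst p = u0 + u1"
        "(u0, snd p) \<in> D.span ?W" "(u1, 0) \<in> D.span ?W" by blast
      have "(smul V k u0, snd (sc k p)) \<in> D.span ?W" "(smul V k u1, 0) \<in> D.span ?W"
        using D.span_scale[OF u(4), of k] D.span_scale[OF u(5), of k] by (simp_all add: sc_def)
      moreover have "fst (sc k p) = smul V k u0 + smul V k u1" using u by (simp add: sc_def A.scale_right_distrib)
      ultimately show "sc k p \<in> ?G"
        using A.subspace_scale[OF sub u(1)] A.subspace_scale[OF sub u(2)] by blast
    qed
    fix p assume p: "p \<in> ?W"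
    then obtain xs n where xs: "p = foldr D xs (?Y n)" by blast
    obtain q where q: "fst p \<in> part V q" "q = e \<or> snd p = 0" using homogeneous xs by blast
    have pW: "(fst p, snd p) \<in> D.span ?W" "(0, 0) \<in> D.span ?W"
      using D.span_base[OF p] D.span_zero[of ?W] by (simp_all add: zero_prod_def)
    show "\<exists>u0\<in>part V e. \<exists>u1\<in>part V (e + 1). fst p = u0 + u1 \<and> (u0, snd p) \<in> D.span ?W \<and> (u1, 0) \<in> D.span ?W"
    proof (cases "q = e")
      case True
      then show ?thesis using q pW A.subspace_0[OF sub]
        by (intro bexI[of _ "fst p"] bexI[of _ 0]) auto
    next
      case False
      have qe: "q = e + 1" using False bit_cases[of q] bit_cases[of e] by auto
      have sp: "snd p = 0" using q(2) False by blast
      show ?thesis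
      proof (rule bexI[of _ 0], rule bexI[of _ "fst p"], intro conjI)
        show "(0, snd p) \<in> D.span ?W" "(fst p, 0) \<in> D.span ?W" using pW unfolding sp by simp_all
        show "fst p \<in> part V (e + 1)" using q(1) unfolding qe .
      qed (simp_all add: A.subspace_0[OF sub])
    qed
  qed
  show ?thesis
  proof (rule isomorphic_of_relation[OF V])
    show "(u + u', f + f') \<in> R" if "(u, f) \<in> R" "(u', f') \<in> R" for u f u' f'
      using D.subspace_add[OF R that] by simp
    show "(smul V k u, pm_scale k f) \<in> R" if "(u, f) \<in> R" for k u f
      using D.subspace_scale[OF R that, of k] by (simp add: sc_def)
    show "(rep_op V x u, rep_op ?M x f) \<in> R" if uf: "(u, f) \<in> R" for x u f
    proof -
      obtain k x' where x': "pair_ops (rep_op V) (rep_op ?M) x (u, f) = sc k (D x' (u, f))" using op_D by blast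
      have "sc k (D x' (u, f)) \<in> R"
        using D.generated_closed uf R D.subspace_scale unfolding R_def by blast
      then show ?thesis using x' by simp
    qed
    show "\<exists>u0\<in>part V e. \<exists>u1\<in>part V (e + 1). u = u0 + u1 \<and> (u0, f) \<in> R \<and> (u1, 0) \<in> R" if "(u, f) \<in> R" for u f
      using graded[OF that] by simp
    show "(z 0, w 0) \<in> R" using D.generated_base[of ?Y 0] by (simp add: R_def)
    show "z 0 \<noteq> 0" by (rule nz)
    show "(z 0, 0) \<notin> R"
    proof
      assume r: "(z 0, 0) \<in> R"
      obtain k x' where x': "\<forall>p. D (bmsL 0) p = sc k (pair_ops (rep_op V) (rep_op ?M) x' p)" using D_op by blast
      have "D (bmsL 0) (?Y 0) = sc (- c) (?Y 0)"
        using D.half_line_wt[OF hl, of 0] by (simp add: D.wt_def)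
      then have "fst (sc k (pair_ops (rep_op V) (rep_op ?M) x' (?Y 0))) = fst (sc (- c) (?Y 0))" using x' by simp
      then have "D (bmsL 0) (z 0, 0) = sc (- c) (z 0, 0)" using x' by (simp add: sc_def)
      then have "(z 0, 0) \<in> D.wt (c + of_nat 0)" by (simp add: D.wt_def)
      from D.generated_wt[OF hl r[unfolded R_def] this] obtain k where "(z 0, 0) = sc k (?Y 0)"
        by (auto simp: D.span_singleton)
      then have "pm_scale k (w 0) = 0" "z 0 = smul V k (z 0)" by (simp_all add: sc_def)
      then show False using nz by (auto simp: B.scale_eq_0_iff)
    qed
  qed
qed

lemma isomorphic_of_positive_half_line:
  fixes V :: "'v::ab_group_add bms_rep"
  assumes V: "simple_module V" and hl: "bms_ops.half_line (smul V) (rep_op V) c b z"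
    and z: "\<And>n. z n \<in> part V e" "z 0 \<noteq> 0"
  shows "isomorphic_to_A' V c b"
proof -
  let ?M = "A_module c b"
  have m: "bms_module V" using V by (simp add: simple_module_def)
  interpret A: bms_ops "smul V" "rep_op V" by (rule module_ops[OF m])
  interpret B: bms_ops pm_scale "rep_op ?M" by (rule A_ops)
  have ops: "bms_ops (pair_scale (smul V) pm_scale) (pair_ops (rep_op V) (rep_op ?M))"
    by (rule bms_ops_pair[OF module_ops[OF m] A_ops])
  interpret D: bms_ops "pair_scale (smul V) pm_scale" "pair_ops (rep_op V) (rep_op ?M)" by (rule ops)
  define w :: "nat \<Rightarrow> int \<Rightarrow>\<^sub>0 complex" where "w n = Poly_Mapping.single (int n) 1" for n
  have hlY: "D.half_line c b (\<lambda>n. (z n, w n))"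
    unfolding D.half_line_def
  proof (intro conjI allI impI)
    fix n k assume nk: "0 \<le> int n + k"
    have "rep_op ?M (bmsL k) (w n) = pm_scale (- (c + of_nat n + b * of_int k)) (w (nat (int n + k)))"
      using nk by (auto simp: w_def A_op_single lookup_single when_def add.commute intro!: poly_mapping_eqI)
    then show "pair_ops (rep_op V) (rep_op ?M) (bmsL k) (z n, w n)
        = pair_scale (smul V) pm_scale (- (c + of_nat n + b * of_int k)) (z (nat (int n + k)), w (nat (int n + k)))"
      using hl nk by (simp add: A.half_line_def)
    show "pair_ops (rep_op V) (rep_op ?M) (bmsI k) (z n, w n) = 0" "pair_ops (rep_op V) (rep_op ?M) (bmsQ k) (z n, w n) = 0"
      using hl nk by (simp_all add: A.half_line_def A_op_other zero_prod_def)
  qed (use hl in \<open>simp_all add: A.half_line_def A_op_other zero_prod_def\<close>)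
  show ?thesis
  proof (rule isomorphic_of_half_line[OF V ops _ _ hlY z])
    show "w 0 \<noteq> 0" by (simp add: w_def)
    show "\<exists>k x'. \<forall>p. pair_ops (rep_op V) (rep_op ?M) x p = pair_scale (smul V) pm_scale k (pair_ops (rep_op V) (rep_op ?M) x' p) \<and> bms_parity x' = bms_parity x" for x
      by (intro exI[of _ 1] exI[of _ x]) simp
    show "\<exists>k x'. \<forall>p. pair_ops (rep_op V) (rep_op ?M) x p = pair_scale (smul V) pm_scale k (pair_ops (rep_op V) (rep_op ?M) x' p)" for x
      by (intro exI[of _ 1] exI[of _ x]) simp
  qed
qed

lemma isomorphic_of_negative_half_line:
  fixes V :: "'v::ab_group_add bms_rep"
  assumes V: "simple_module V"
    and hl: "bms_ops.half_line (smul V) (bms_ops.reflected (smul V) (rep_op V)) c b z"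
    and z: "\<And>n. z n \<in> part V e" "z 0 \<noteq> 0"
  shows "isomorphic_to_A' V (- c) b"
proof -
  let ?M = "A_module (- c) b"
  let ?sc = "pair_scale (smul V) pm_scale" and ?P = "pair_ops (rep_op V) (rep_op ?M)"
  have m: "bms_module V" using V by (simp add: simple_module_def)
  interpret A: bms_ops "smul V" "rep_op V" by (rule module_ops[OF m])
  interpret A': bms_ops "smul V" A.reflected by (rule A.reflected_ops)
  interpret B: bms_ops pm_scale "rep_op ?M" by (rule A_ops)
  interpret P: bms_ops ?sc ?P by (rule bms_ops_pair[OF module_ops[OF m] A_ops])
  interpret D: bms_ops ?sc P.reflected by (rule P.reflected_ops)
  define w :: "nat \<Rightarrow> int \<Rightarrow>\<^sub>0 complex" where "w n = Poly_Mapping.single (- int n) 1" for n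
  have refl: "P.reflected x (u, f) = (A.reflected x u, B.reflected x f)" for x u f
    by (simp add: P.reflected_def A.reflected_def B.reflected_def)
  have other: "B.reflected x f = 0" if "\<And>m. x \<noteq> bmsL m" for x f
  proof (cases x)
    case (bmsL k)
    then show ?thesis using that[of k] by simp
  qed (simp_all add: B.reflected_def A_op_other)
  have hlY: "D.half_line c b (\<lambda>n. (z n, w n))"
    unfolding D.half_line_def
  proof (intro conjI allI impI)
    fix n k assume nk: "0 \<le> int n + k"
    have "B.reflected (bmsL k) (w n) = pm_scale (- (c + of_nat n + b * of_int k)) (w (nat (int n + k)))"
      using nk by (auto simp: w_def B.reflected_def A_op_single lookup_single when_def intro!: poly_mapping_eqI)
    then show "P.reflected (bmsL k) (z n, w n) = ?sc (- (c + of_nat n + b * of_int k)) (z (nat (int n + k)), w (nat (int n + k)))"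
      using hl nk by (simp add: A'.half_line_def refl)
    show "P.reflected (bmsI k) (z n, w n) = 0" "P.reflected (bmsQ k) (z n, w n) = 0"
      using hl nk by (simp_all add: A'.half_line_def refl other zero_prod_def)
  qed (use hl in \<open>simp_all add: A'.half_line_def refl other zero_prod_def\<close>)
  show ?thesis
  proof (rule isomorphic_of_half_line[OF V P.reflected_ops _ _ hlY z])
    show "w 0 \<noteq> 0" by (simp add: w_def)
    show "\<exists>k x'. \<forall>p. P.reflected x p = ?sc k (?P x' p) \<and> bms_parity x' = bms_parity x" for x
      by (intro exI[of _ "opp_coeff x"] exI[of _ "opp x"]) (cases x; simp add: P.reflected_def)
    show "\<exists>k x'. \<forall>p. ?P x p = ?sc k (P.reflected x' p)" for x
      using P.A_reflected[of x] by blast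
  qed
qed

text \<open>If only finitely many weights occur in each coset of the integers, then the brackets
  \<open>[L\<^sub>k, L\<^sub>-\<^sub>k]\<close> with large \<open>k\<close> vanish on a weight vector, which forces its weight to be \<open>0\<close>.\<close>

lemma (in bms_ops) weight_zero_of_finite:
  assumes fin: "\<And>s. finite {n::nat. wt (s + of_nat n) \<noteq> {0}}" "\<And>s. finite {n::nat. wt (s - of_nat n) \<noteq> {0}}"
    and v: "v \<in> wt s" "v \<noteq> 0"
  shows "s = 0"
proof -
  obtain N where N: "\<And>n. n > N \<Longrightarrow> wt (s + of_nat n) = {0}"
    using fin(1)[of s] unfolding finite_nat_set_iff_bounded_le by (metis (mono_tags, lifting) mem_Collect_eq not_le)
  obtain N' where N': "\<And>n. n > N' \<Longrightarrow> wt (s - of_nat n) = {0}"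
    using fin(2)[of s] unfolding finite_nat_set_iff_bounded_le by (metis (mono_tags, lifting) mem_Collect_eq not_le)
  have 1: "(2 * of_nat k) *s A (bmsL 0) v + (of_int (int k ^ 3 - int k) / 12) *s A bmsC1 v = 0" if k: "k > max N N'" for k
  proof -
    have "A (bmsL (int k)) v \<in> wt (s + of_nat k)" "A (bmsL (- int k)) v \<in> wt (s - of_nat k)"
      using A_wt[OF v(1), of "bmsL (int k)"] A_wt[OF v(1), of "bmsL (- int k)"] by simp_all
    then have "A (bmsL (int k)) v = 0" "A (bmsL (- int k)) v = 0" using N[of k] N'[of k] k by auto
    then show ?thesis using LL[of "int k" "- int k" v] by simp
  qed
  define k where "k = Suc (max N N')"
  let ?d = "\<lambda>k. (2 * of_nat k :: complex)" and ?e = "\<lambda>k. (of_int (int k ^ 3 - int k) / 12 :: complex)"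
  have k: "k > max N N'" "Suc k > max N N'" unfolding k_def by linarith+
  have "?e (Suc k) *s (?d k *s A (bmsL 0) v + ?e k *s A bmsC1 v) - ?e k *s (?d (Suc k) *s A (bmsL 0) v + ?e (Suc k) *s A bmsC1 v)
      = (?e (Suc k) * ?d k - ?e k * ?d (Suc k)) *s A (bmsL 0) v"
    by (simp only: scale_right_distrib scale_scale scale_left_diff_distrib mult.commute[of "?e k" "?e (Suc k)"]) simp
  then have "(?e (Suc k) * ?d k - ?e k * ?d (Suc k)) *s A (bmsL 0) v = 0"
    unfolding 1[OF k(1)] 1[OF k(2)] by simp
  moreover have "?e (Suc k) * ?d k - ?e k * ?d (Suc k) = of_nat (k * (k + 1) * (2 * k + 1)) / 6"
    by (simp add: field_simps power3_eq_cube)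
  moreover have "of_nat (k * (k + 1) * (2 * k + 1)) / 6 \<noteq> (0::complex)"
    using k by (simp del: of_nat_mult of_nat_add)
  ultimately have "A (bmsL 0) v = 0" by (metis scale_eq_0_iff)
  then show ?thesis using v by (simp add: wt_def)
qed

text \<open>Only the weight \<open>0\<close> occurs, so the operators of nonzero degree vanish, and with them
  \<open>L\<^sub>0\<close>, \<open>I\<^sub>0\<close>, \<open>C\<^sub>1\<close> and \<open>C\<^sub>2\<close>, which are combinations of their brackets.
  A homogeneous vector \<open>v\<close> of \<open>V\<close> is related to \<open>v\<^sub>0\<close> in \<open>\<A>\<^sub>0\<^sub>,\<^sub>0\<close>, which is also killed by all
  operators.\<close>

lemma isomorphic_of_finite_weights:
  fixes V :: "'v::ab_group_add bms_rep"
  defines "W \<equiv> bms_ops.wt (smul V) (rep_op V)"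
  assumes V: "simple_module V"
    and spanned: "module.span (smul V) (\<Union>s. W s) = UNIV"
    and fin: "\<And>s. finite {n::nat. W (s + of_nat n) \<noteq> {0}}" "\<And>s. finite {n::nat. W (s - of_nat n) \<noteq> {0}}"
  shows "isomorphic_to_A' V 0 0"
proof -
  let ?M = "A_module 0 0"
  have m: "bms_module V" using V by (simp add: simple_module_def)
  interpret A: bms_ops "smul V" "rep_op V" by (rule module_ops[OF m])
  interpret B: bms_ops pm_scale "rep_op ?M" by (rule A_ops)
  have "W s \<subseteq> W 0" for s
    using A.weight_zero_of_finite[OF fin[unfolded W_def], of _ s] A.subspace_0[OF A.wt_subspace]
    unfolding W_def by blast
  then have "A.span (\<Union>s. W s) \<subseteq> W 0" unfolding W_def by (intro A.span_minimal A.wt_subspace) blast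
  then have W0: "v \<in> W 0" for v using spanned by blast
  have off: "rep_op V x v = 0" if "deg2 x \<noteq> 0" for x v
  proof (rule ccontr)
    assume nz: "rep_op V x v \<noteq> 0"
    have in_wt: "rep_op V x v \<in> A.wt (of_int (deg2 x) / 2)" using A.A_wt[of v 0 x] W0 by (simp add: W_def)
    from A.weight_zero_of_finite[OF fin[unfolded W_def] in_wt nz] that show False by simp
  qed
  have "rep_op V (bmsL 0) v = 0" "rep_op V (bmsI 0) v = 0" for v
    using A.LL[of 1 "-1" v] A.LI[of 1 "-1" v] off by simp_all
  moreover from this have "rep_op V bmsC1 v = 0" "rep_op V bmsC2 v = 0" for v
    using A.LL[of 2 "-2" v] A.LI[of 2 "-2" v] off by simp_all
  moreover have "deg2 (bmsQ k) \<noteq> 0" for k by simp presburger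
  ultimately have z: "rep_op V x v = 0" for x v using off[of x] by (cases x) force+
  have w: "rep_op ?M x (Poly_Mapping.single 0 k) = 0" for x k
    by (cases x) (auto simp: A_op_L A_op_other lookup_single when_def intro!: poly_mapping_eqI)
  have sub: "A.subspace (part V p)" for p using m by (simp add: bms_module_def)
  obtain v e where v: "v \<noteq> 0" "v \<in> part V e"
  proof -
    obtain v :: 'v where "v \<noteq> 0" using V by (auto simp: simple_module_def)
    moreover obtain u w where "u \<in> part V 0" "w \<in> part V 1" "v = u + w" using parts_decompose[OF m, of v] by blast
    ultimately show thesis using that[of u 0] that[of w 1] by (cases "u = 0") auto
  qed
  define R where "R = {(smul V k v, Poly_Mapping.single (0::int) k) | k. True}"
  show ?thesis
  proof (rule isomorphic_of_relation[OF V])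
    show "(u + u', f + f') \<in> R" if uf: "(u, f) \<in> R" "(u', f') \<in> R" for u f u' f'
    proof -
      obtain j j' where "u = smul V j v" "f = Poly_Mapping.single 0 j" "u' = smul V j' v" "f' = Poly_Mapping.single 0 j'"
        using uf by (auto simp: R_def)
      then have "(u + u', f + f') = (smul V (j + j') v, Poly_Mapping.single 0 (j + j'))"
        by (simp add: A.scale_left_distrib single_add)
      then show ?thesis unfolding R_def by blast
    qed
    show "(smul V k u, pm_scale k f) \<in> R" if uf: "(u, f) \<in> R" for k u f
    proof -
      obtain j where j: "u = smul V j v" "f = Poly_Mapping.single 0 j" using uf by (auto simp: R_def)
      have "pm_scale k f = Poly_Mapping.single 0 (k * j)"
        by (rule poly_mapping_eqI) (simp add: j lookup_single when_def)
      then show ?thesis using j by (auto simp: R_def)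
    qed
    have "(0, 0) \<in> R" unfolding R_def by (auto intro!: exI[of _ 0])
    then show "(rep_op V x u, rep_op ?M x f) \<in> R" if "(u, f) \<in> R" for x u f
      using that z w by (auto simp: R_def)
    show "\<exists>u0\<in>part V e. \<exists>u1\<in>part V (e + 1). u = u0 + u1 \<and> (u0, f) \<in> R \<and> (u1, 0) \<in> R" if "(u, f) \<in> R" for u f
      using that \<open>(0, 0) \<in> R\<close> v A.subspace_scale[OF sub] A.subspace_0[OF sub]
      by (intro bexI[of _ u] bexI[of _ 0]) (auto simp: R_def)
    show "(v, Poly_Mapping.single 0 1) \<in> R" unfolding R_def by (auto intro!: exI[of _ 1])
    show "v \<noteq> 0" by (rule v)
    show "(v, 0) \<notin> R"
    proof
      assume "(v, 0) \<in> R"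
      then obtain k where k: "v = smul V k v" "Poly_Mapping.single (0::int) k = 0" unfolding R_def by auto
      have "k = 0" using arg_cong[OF k(2), of "\<lambda>f. Poly_Mapping.lookup f 0"] by simp
      then show False using k(1) v by simp
    qed
  qed
qed

theorem proposition5p4:
  fixes V :: "'v::ab_group_add bms_rep"
  assumes "simple_module V"
    and "cuspidal_module V"
  shows "\<exists>a b. isomorphic_to_A' V a b"
proof -
  note V = assms(1)
  have m: "bms_module V" using V by (simp add: simple_module_def)
  interpret A: bms_ops "smul V" "rep_op V" by (rule module_ops[OF m])
  interpret A': bms_ops "smul V" A.reflected by (rule A.reflected_ops)
  have wt: "A.wt s = L0_eigenspace V (- s)" for s by (simp add: A.wt_def L0_eigenspace_def)
  have wt': "A'.wt s = A.wt (- s)" for s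
    unfolding A'.wt_def A.wt_def A.reflected_def by (auto simp: eq_neg_iff_add_eq_0 minus_equation_iff)
  obtain N where N: "\<And>c. (\<exists>B. finite B \<and> A.span B = L0_eigenspace V c) \<and> A.dim (L0_eigenspace V c) \<le> N"
    using assms(2) unfolding cuspidal_module_def by blast
  have fin: "\<exists>B. finite B \<and> card B \<le> N \<and> A.span B = A.wt s" for s
  proof -
    obtain C where C: "finite C" "A.span C = A.wt s" using N wt by metis
    obtain B where B: "B \<subseteq> A.wt s" "A.independent B" "A.wt s \<subseteq> A.span B" "card B = A.dim (A.wt s)"
      using A.basis_exists[of "A.wt s"] by blast
    have "finite B" using A.independent_span_bound[OF C(1) B(2)] B(1) C(2) by simp
    moreover have "A.span B = A.wt s" using B(1,3) A.span_minimal[OF _ A.wt_subspace] by blast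
    ultimately show ?thesis using N wt B(4) by metis
  qed
  have sub: "A.subspace (part V p)" and int: "part V 0 \<inter> part V 1 = {0}" for p
    using m by (simp_all add: bms_module_def)
  have component: "\<exists>z e. H z \<and> (\<forall>n. z n \<in> part V e) \<and> z 0 \<noteq> 0"
    if y: "H y" "y 0 \<noteq> 0" and H: "\<And>z z' e. \<forall>n. y n = z n + z' n \<and> z n \<in> part V e \<and> z' n \<in> part V (e + 1) \<Longrightarrow> H z"
    for H and y :: "nat \<Rightarrow> 'v"
  proof -
    have "\<forall>n. \<exists>u w. u \<in> part V 0 \<and> w \<in> part V 1 \<and> y n = u + w" using parts_decompose[OF m] by blast
    then obtain u w where uw: "\<And>n. u n \<in> part V 0" "\<And>n. w n \<in> part V 1" "\<And>n. y n = u n + w n" by metis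
    have "H u" by (rule H[of u w 0]) (use uw in auto)
    moreover have "H w" by (rule H[of w u 1]) (use uw in \<open>auto simp: add.commute\<close>)
    moreover have "u 0 \<noteq> 0 \<or> w 0 \<noteq> 0" using y(2) uw(3)[of 0] by auto
    ultimately show ?thesis using uw by blast
  qed
  have A_part: "rep_op V x v \<in> part V (bms_parity x + p)" if "v \<in> part V p" for x p v
    by (rule act_part[OF m bms_vec_part that])
  have A'_part: "A.reflected x v \<in> part V (bms_parity x + p)" if "v \<in> part V p" for x p v
    using A_part[OF that, of "opp x"] unfolding A.reflected_def bms_parity_opp by (rule A.subspace_scale[OF sub])
  consider s where "infinite {n::nat. A.wt (s + of_nat n) \<noteq> {0}}" | s where "infinite {n::nat. A.wt (s - of_nat n) \<noteq> {0}}"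
    | "\<And>s. finite {n::nat. A.wt (s + of_nat n) \<noteq> {0}}" "\<And>s. finite {n::nat. A.wt (s - of_nat n) \<noteq> {0}}"
    by blast
  then show ?thesis
  proof cases
    case (1 s)
    then obtain c b y where y: "A.half_line c b y" "y 0 \<noteq> 0"
      using A.half_line_in_direction[OF fin] by blast
    have H: "A.half_line c b z"
      if "\<forall>n. y n = z n + z' n \<and> z n \<in> part V e \<and> z' n \<in> part V (e + 1)" for z z' e
      by (rule A.half_line_component[where P = "part V" and z' = z' and e = e, OF y(1) sub int A_part]) (use that in auto)
    obtain z e where "A.half_line c b z" "\<And>n. z n \<in> part V e" "z 0 \<noteq> 0"
      using component[of "A.half_line c b" y, OF y] H by blast
    then show ?thesis using isomorphic_of_positive_half_line[OF V] by blast
  next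
    case (2 s)
    have "infinite {n::nat. A'.wt (- s + of_nat n) \<noteq> {0}}" using 2 by (simp add: wt')
    then obtain c b y where y: "A'.half_line c b y" "y 0 \<noteq> 0"
      using A'.half_line_in_direction[of N "- s"] fin by (auto simp: wt')
    have H: "A'.half_line c b z"
      if "\<forall>n. y n = z n + z' n \<and> z n \<in> part V e \<and> z' n \<in> part V (e + 1)" for z z' e
      by (rule A'.half_line_component[where P = "part V" and z' = z' and e = e, OF y(1) sub int A'_part]) (use that in auto)
    obtain z e where "A'.half_line c b z" "\<And>n. z n \<in> part V e" "z 0 \<noteq> 0"
      using component[of "A'.half_line c b" y, OF y] H by blast
    then show ?thesis using isomorphic_of_negative_half_line[OF V] by blast
  next
    case 3
    have "(\<Union>s. A.wt s) = (\<Union>c. L0_eigenspace V c)" unfolding wt by (metis (no_types) UN_extend_simps(10) equation_minus_iff surj_def)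
    then have "A.span (\<Union>s. A.wt s) = UNIV" using assms(2) by (simp add: cuspidal_module_def)
    then show ?thesis using isomorphic_of_finite_weights[OF V _ 3] by blast
  qed
qed

end
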